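(* The 3-color Rado number of the equation $x_1^2+x_2^2+x_3^2+x_4^2=y_1^2+y_2^2+y_3^2$ is $32$. That is, $32$ is the least positive integer $N$ such that for every coloring $\chi:\{1,2,\dots,N\}\to\{1,2,3\}$ there exist $x_1,x_2,x_3,x_4,y_1,y_2,y_3\in\{1,2,\dots,N\}$, all of the same color under $\chi$, with $x_1^2+x_2^2+x_3^2+x_4^2=y_1^2+y_2^2+y_3^2$.
   Context: For an equation $\mathcal{E}$ in several variables and a positive integer $r$, the $r$-color Rado number of $\mathcal{E}$ is the least positive integer $N$ such that every coloring $\chi:\{1,\dots,N\}\to\{1,\dots,r\}$ admits a monochromatic solution of $\mathcal{E}$ (a solution in which all variables take values in $\{1,\dots,N\}$ receiving the same color); it is $\infty$ if no such $N$ exists. The variables in a solution need not be distinct. *)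

theory Defs
  imports "HOL-Library.Extended_Nat"
begin

text \<open>An equation is a predicate on assignments of natural numbers to its variables, the elements
  of the type \<open>'v\<close>. Assignments need not be injective.\<close>

definition mono_solution :: "(('v \<Rightarrow> nat) \<Rightarrow> bool) \<Rightarrow> nat \<Rightarrow> (nat \<Rightarrow> nat) \<Rightarrow> ('v \<Rightarrow> nat) \<Rightarrow> bool" where
  "mono_solution E N \<chi> s \<longleftrightarrow> E s \<and> (\<forall>v. s v \<in> {1..N}) \<and> (\<exists>c. \<forall>v. \<chi> (s v) = c)"

definition rado_property :: "nat \<Rightarrow> (('v \<Rightarrow> nat) \<Rightarrow> bool) \<Rightarrow> nat \<Rightarrow> bool" where
  "rado_property r E N \<longleftrightarrow> (\<forall>\<chi>. \<chi> ` {1..N} \<subseteq> {1..r} \<longrightarrow> (\<exists>s. mono_solution E N \<chi> s))"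

text \<open>In \<^typ>\<open>enat\<close> the infimum of a nonempty set is its least element, and that of the empty
  set is \<open>\<infinity>\<close>.\<close>

definition rado_number :: "nat \<Rightarrow> (('v \<Rightarrow> nat) \<Rightarrow> bool) \<Rightarrow> enat" where
  "rado_number r E = Inf (enat ` {N. 0 < N \<and> rado_property r E N})"

datatype var = X1 | X2 | X3 | X4 | Y1 | Y2 | Y3

end

(* A colouring of {1..31} without monochromatic solution is checked by computing, for each colour
   class, the sums of three and of four squares of its elements: the two sets are disjoint. For
   {1..32} a case distinction is needed. Assign numbers to the three classes one after another; a
   branch ends as soon as some class contains a solution. With unit propagation and a good choice of
   the next number, about 15000 assignments and 2100 different solutions suffice. The tree
   was found by an external search and is verified by rewriting. *)

theory Submission
  imports Defs
begin

section \<open>Certificates for the non-existence of colourings\<close>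

text \<open>Branches close early because variables may coincide and a number standing on both sides
  cancels. Two distinct values never suffice: the equation would become
  \<open>m*a^2 = (m-1)*b^2\<close> with both coefficients nonzero (all values are positive) and at
  most 4 in absolute value, and no such quotient is the square of a rational. Three values do, in
  abundance: \<open>k, 2k, 3k\<close> by \<open>3*k^2 + (3*k)^2 = 3*(2*k)^2\<close>;
  \<open>2k, 3k, 4k\<close> by \<open>4*(3*k)^2 = (2*k)^2 + 2*(4*k)^2\<close>;
  \<open>k, 3k, 4k\<close> by \<open>2*k^2 + (4*k)^2 = 2*(3*k)^2\<close>; and every Pythagorean
  triple, padded by repeating one leg. Two numbers of such a triple in one class expel the third, so
  numbers that take part in many of them (9, 12, 8, 3, 6, 4, 16) are placed near the root. The
  remaining cost is to recognise, at each leaf, a solution inside a class. Storing a class as a list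
  of truth values of fixed length turns this into first-order matching.\<close>

text \<open>The entries of the list are the values of \<open>x\<^sub>1, x\<^sub>2, x\<^sub>3, x\<^sub>4, y\<^sub>1, y\<^sub>2, y\<^sub>3\<close>.\<close>

definition solution :: "nat list \<Rightarrow> bool" where
  "solution xs \<longleftrightarrow> (\<exists>a b c d e f g. xs = [a, b, c, d, e, f, g] \<and>
     a^2 + b^2 + c^2 + d^2 = e^2 + f^2 + g^2) \<and> set xs \<subseteq> {1..32}"

definition solution_free :: "nat set \<Rightarrow> bool" where
  "solution_free P \<longleftrightarrow> (\<forall>xs. solution xs \<longrightarrow> \<not> set xs \<subseteq> P)"

text \<open>Partial colour classes are bit lists of length 33 whose bit at index 0 is never set.\<close>

definition marks :: "bool list \<Rightarrow> nat set \<Rightarrow> bool" where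
  "marks S P \<longleftrightarrow> (\<forall>n<length S. S ! n \<longrightarrow> n \<in> P)"

text \<open>The bound \<open>x < length S\<close> is there because \<open>!\<close> is unspecified
  beyond the end of a list.\<close>

definition hit :: "bool list \<Rightarrow> bool" where
  "hit S \<longleftrightarrow> (\<exists>xs. solution xs \<and> (\<forall>x\<in>set xs. x < length S \<and> S ! x))"

text \<open>This includes \<open>a\<close> beyond the end, where the update changes nothing and
  \<open>i = a\<close> cannot occur. Hence the numbers at the nodes of a certificate carry no range
  condition.\<close>

lemma nth_update_True: "i < length S \<Longrightarrow> S[a := True] ! i \<longleftrightarrow> i = a \<or> S ! i"
  by (cases "i = a") auto

lemma marks_update: "marks S P \<Longrightarrow> v \<in> P \<Longrightarrow> marks (S[v := True]) P"
  by (auto simp: marks_def nth_update_True)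

lemma hit_not_solution_free: "hit S \<Longrightarrow> marks S P \<Longrightarrow> \<not> solution_free P"
  unfolding hit_def marks_def solution_free_def by blast

section \<open>Certificate trees and their soundness\<close>

datatype cert = Hit | Split nat cert cert cert | Sym nat cert cert

text \<open>\<open>Split v\<close> puts \<open>v\<close> into each of the three classes in turn. The class that has just grown moves
  to the front, so that \<open>Hit\<close> only has to inspect the first class. \<open>Sym\<close> is used while the last two
  classes are equal (both empty) and thus interchangeable.\<close>

primrec check :: "cert \<Rightarrow> bool list \<Rightarrow> bool list \<Rightarrow> bool list \<Rightarrow> bool" where
  "check Hit S T U = hit S"
| "check (Split v t u w) S T U =
     (check t (S[v := True]) T U \<and> check u (T[v := True]) S U \<and> check w (U[v := True]) S T)"
| "check (Sym v t u) S T U =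
     (T = U \<and> check t (S[v := True]) T U \<and> check u (T[v := True]) S U)"

text \<open>At every node the number \<open>v\<close> lies in \<open>P\<close>, \<open>Q\<close> or
  \<open>R\<close>, and the branch for that class still describes subsets of the true classes.
  Following these branches ends at a \<open>Hit\<close>, whose solution lies inside one of the
  classes. \<open>P\<close>, \<open>Q\<close>, \<open>R\<close> vary in the induction because they
  are permuted together with the bit lists. The cover of all natural numbers gives the case
  distinction for any \<open>v\<close>.\<close>

lemma check_sound:
  assumes "check t S T U" and "marks S P" "marks T Q" "marks U R"
    and "\<forall>n. n \<in> P \<or> n \<in> Q \<or> n \<in> R"
    and "solution_free P" "solution_free Q" "solution_free R"
  shows False
  using assms
proof (induction t arbitrary: S T U P Q R)
  case Hit
  then show ?case using hit_not_solution_free by auto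
next
  case (Split v t u w)
  note prems = Split.prems
  have checks: "check t (S[v := True]) T U" "check u (T[v := True]) S U"
      "check w (U[v := True]) S T"
    using prems(1) by simp_all
  consider "v \<in> P" | "v \<in> Q" | "v \<in> R" using prems(5) by blast
  then show ?case
  proof cases
    case 1
    show ?thesis
      using Split.IH(1)[OF checks(1) marks_update[OF prems(2) 1] prems(3-8)] .
  next
    case 2
    \<comment> \<open>The class that receives \<open>v\<close> leads from here on, so the cover is
      restated in the new order.\<close>
    have "\<forall>n. n \<in> Q \<or> n \<in> P \<or> n \<in> R" using prems(5) by blast
    then show ?thesis
      using Split.IH(2)[OF checks(2) marks_update[OF prems(3) 2] prems(2,4)] prems(6-8) by blast
  next
    case 3
    have "\<forall>n. n \<in> R \<or> n \<in> P \<or> n \<in> Q" using prems(5) by blast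
    then show ?thesis
      using Split.IH(3)[OF checks(3) marks_update[OF prems(4) 3] prems(2,3)] prems(6-8) by blast
  qed
next
  case (Sym v t u)
  note prems = Sym.prems
  have sym: "T = U" and checks: "check t (S[v := True]) T U" "check u (T[v := True]) S U"
    using prems(1) unfolding check.simps by blast+
  consider "v \<in> P" | "v \<in> Q" | "v \<in> R" using prems(5) by blast
  then show ?case
  proof cases
    case 1
    show ?thesis
      using Sym.IH(1)[OF checks(1) marks_update[OF prems(2) 1] prems(3-8)] .
  next
    case 2
    have "\<forall>n. n \<in> Q \<or> n \<in> P \<or> n \<in> R" using prems(5) by blast
    then show ?thesis
      using Sym.IH(2)[OF checks(2) marks_update[OF prems(3) 2] prems(2,4)] prems(6-8) by blast
  next
    case 3
    have "\<forall>n. n \<in> R \<or> n \<in> P \<or> n \<in> Q" using prems(5) by blast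
    then show ?thesis
      using Sym.IH(2)[OF checks(2) marks_update[OF _ 3] prems(2)] prems(3,4,6-8) sym by blast
  qed
qed

section \<open>From solutions to matching patterns\<close>

lemma nth_fold_update:
  "i < length S \<Longrightarrow> fold (\<lambda>x S. S[x := True]) xs S ! i \<longleftrightarrow> i \<in> set xs \<or> S ! i"
  by (induction xs arbitrary: S) (auto simp: nth_update_True)

lemma length_fold_update: "length (fold (\<lambda>x S. S[x := True]) xs S) = length S"
  by (induction xs arbitrary: S) auto

text \<open>With length 33 the index 32 is legal, so each entry of a solution gets its own bit.
  \<open>S\<close> is arbitrary: the bits outside the solution stay undetermined, which is what
  makes a pattern out of it.\<close>

lemma hit_fold_update:
  assumes "list_all solution xss" "length S = 33"
  shows "list_all (\<lambda>xs. hit (fold (\<lambda>x S. S[x := True]) xs S)) xss"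
  using assms(1)
proof (rule list.pred_mono_strong)
  fix xs assume "solution xs"
  moreover from this have "set xs \<subseteq> {1..32}" by (simp add: solution_def)
  ultimately show "hit (fold (\<lambda>x S. S[x := True]) xs S)"
    unfolding hit_def using assms(2)
    by (intro exI[of _ xs]) (force simp: length_fold_update nth_fold_update)
qed

text \<open>Evaluates an update at a literal position of an explicit list by peeling off one element
  per step.\<close>

lemma list_update_numeral:
  "(b # bs)[0 := x] = x # bs"
  "(b # bs)[1 := x] = b # bs[0 := x]"
  "(b # bs)[numeral k := x] = b # bs[pred_numeral k := x]"
  by (simp_all add: numeral_eq_Suc)

text \<open>From position 2 the predecessor comes out as \<open>numeral One\<close>;
  \<open>numeral_One\<close> turns it into the 1 that the second update rule expects.\<close>

lemmas update_simps = list_update_numeral pred_numeral_simps BitM.simps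
  numeral_One

text \<open>Distinct variables at all 33 places: those that the updates overwrite become
  \<open>True\<close>, the others remain as wildcards.\<close>

lemma hit_update:
  assumes "list_all solution xss"
  shows "list_all (\<lambda>xs. hit (fold (\<lambda>x S. S[x := True]) xs
    [b0, b1, b2, b3, b4, b5, b6, b7, b8, b9, b10, b11, b12, b13, b14, b15, b16, b17, b18,
     b19, b20, b21, b22, b23, b24, b25, b26, b27, b28, b29, b30, b31, b32])) xss"
  using hit_fold_update[OF assms] by simp

section \<open>Solutions in \<open>{1..32}\<close>\<close>

text \<open>Each solution becomes a rewrite rule \<open>hit [b0, True, b2, \<dots>] = True\<close> with variables at the
  numbers that do not occur in it. So the term net of the simplifier does the search for a solution
  contained in a given class.\<close>

lemmas hit_unfold = list.pred_inject fold_simps update_simps simp_thms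

text \<open>Since \<open>hit\<close> depends only on the set of entries, one ordering per solution
  is enough; the blocks run through them lexicographically, with the \<open>x\<close> part and the
  \<open>y\<close> part increasing. Repeated entries are essential: \<open>[1,1,1,3,2,2,2]\<close>
  is the triple 1, 2, 3, and in \<open>[1,1,4,10,1,6,9]\<close> a 1 cancels and leaves
  \<open>1^2 + 4^2 + 10^2 = 6^2 + 9^2\<close>.\<close>

lemma solutions1: "list_all solution
  [[1,1,1,3,2,2,2], [1,1,1,4,1,3,3], [1,1,1,8,3,3,7], [1,1,1,12,1,5,11], [1,1,1,12,7,7,7],
  [1,1,1,13,6,6,10], [1,1,1,15,4,4,14], [1,1,1,15,8,8,10], [1,1,1,16,3,5,15], [1,1,1,17,2,12,12],
  [1,1,1,23,8,12,18], [1,1,1,24,1,17,17], [1,1,1,24,5,5,23], [1,1,1,28,9,9,25],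
  [1,1,1,29,14,18,18], [1,1,2,12,5,5,10], [1,1,2,16,9,9,10], [1,1,2,20,1,9,18], [1,1,2,24,7,7,22],
  [1,1,2,30,1,8,29], [1,1,3,8,5,5,5], [1,1,3,15,6,10,10], [1,1,3,16,5,11,11], [1,1,3,16,7,7,13],
  [1,1,3,17,10,10,10], [1,1,3,20,1,11,17], [1,1,3,20,5,5,19], [1,1,3,24,1,15,19],
  [1,1,3,31,18,18,18], [1,1,4,9,1,7,7], [1,1,4,10,1,6,9], [1,1,4,13,5,9,9], [1,1,4,15,1,11,11],
  [1,1,4,15,9,9,9], [1,1,4,18,2,13,13], [1,1,4,18,10,11,11], [1,1,4,21,11,13,13],
  [1,1,4,24,12,15,15], [1,1,4,27,1,11,25], [1,1,4,27,5,19,19], [1,1,4,27,13,17,17],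
  [1,1,4,30,14,19,19], [1,1,5,9,2,2,10], [1,1,5,16,9,9,11], [1,1,5,23,6,6,22], [1,1,5,24,9,9,21],
  [1,1,5,25,2,18,18], [1,1,6,6,1,3,8], [1,1,6,10,1,4,11], [1,1,6,14,1,8,13], [1,1,6,16,1,2,17],
  [1,1,6,16,7,7,14], [1,1,6,20,11,11,14], [1,1,6,22,1,11,20], [1,1,6,28,1,14,25],
  [1,1,7,11,6,6,10], [1,1,7,20,1,15,15], [1,1,7,21,2,2,22], [1,1,8,9,1,5,11], [1,1,8,10,2,9,9],
  [1,1,8,13,1,3,15], [1,1,8,14,1,6,15], [1,1,8,18,1,10,17], [1,1,8,21,13,13,13],
  [1,1,8,24,11,11,20], [1,1,8,27,1,13,25], [1,1,9,9,2,4,12], [1,1,9,9,6,8,8], [1,1,9,11,2,2,14],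
  [1,1,9,11,2,10,10], [1,1,9,16,1,7,17], [1,1,9,16,1,13,13], [1,1,9,16,5,5,17],
  [1,1,9,20,1,11,19], [1,1,9,21,10,10,18], [1,1,9,23,8,8,22], [1,1,9,23,10,16,16],
  [1,1,9,23,12,12,18], [1,1,9,25,14,16,16], [1,1,9,28,17,17,17], [1,1,10,12,2,11,11],
  [1,1,10,12,5,5,14], [1,1,10,16,9,9,14], [1,1,10,18,1,5,20], [1,1,10,18,1,8,19],
  [1,1,10,22,1,12,21], [1,1,11,16,3,3,19], [1,1,11,23,2,18,18], [1,1,11,25,6,6,26],
  [1,1,11,25,10,18,18], [1,1,12,12,1,8,15], [1,1,12,14,2,13,13], [1,1,12,14,3,3,18],
  [1,1,12,19,13,13,13], [1,1,12,20,1,4,23], [1,1,12,22,1,2,25], [1,1,12,22,1,10,23],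
  [1,1,12,26,1,14,25], [1,1,13,15,2,14,14], [1,1,13,15,6,6,18]]"
  by (simp add: solution_def)

text \<open>Unfolding \<open>list_all\<close> gives a conjunction of \<open>hit\<close> patterns;
  the simplifier splits it into one rule per solution.\<close>

lemmas hits1 = hit_update[OF solutions1, unfolded hit_unfold]

lemma solutions2: "list_all solution
  [[1,1,13,21,12,12,18], [1,1,13,27,10,20,20], [1,1,14,16,2,15,15], [1,1,14,18,1,11,20],
  [1,1,14,26,1,12,27], [1,1,15,15,4,6,20], [1,1,15,15,8,8,18], [1,1,15,17,2,16,16],
  [1,1,15,19,14,14,14], [1,1,15,24,9,19,19], [1,1,16,16,3,8,21], [1,1,16,16,8,15,15],
  [1,1,16,18,2,17,17], [1,1,16,18,7,7,22], [1,1,16,20,1,9,24], [1,1,16,21,11,17,17],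
  [1,1,16,21,13,13,19], [1,1,16,25,1,21,21], [1,1,16,27,1,19,25], [1,1,16,30,10,23,23],
  [1,1,17,19,2,18,18], [1,1,18,18,5,7,24], [1,1,18,18,9,13,20], [1,1,18,20,1,7,26],
  [1,1,18,20,1,14,23], [1,1,19,19,2,12,24], [1,1,20,20,1,15,24], [1,1,20,20,3,3,28],
  [1,1,20,24,16,19,19], [1,1,21,21,6,8,28], [1,1,21,21,8,12,26], [1,1,21,21,12,16,22],
  [1,1,21,23,18,18,18], [1,1,24,24,12,13,29], [1,1,24,24,13,16,27], [1,1,25,25,10,24,24],
  [1,2,2,12,4,4,11], [1,2,2,12,5,8,8], [1,2,2,13,4,9,9], [1,2,2,20,11,12,12], [1,2,2,27,4,19,19],
  [1,2,2,27,9,9,24], [1,2,4,9,1,1,10], [1,2,6,19,1,1,20], [1,2,12,23,1,1,26], [1,2,15,16,1,1,22],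
  [1,3,3,8,1,1,9], [1,3,3,20,9,13,13], [1,3,3,23,6,16,16], [1,3,3,27,6,6,26], [1,3,5,16,1,1,17],
  [1,3,6,10,1,1,12], [1,3,7,7,6,6,6], [1,3,11,13,10,10,10], [1,3,14,14,1,1,20],
  [1,3,14,14,8,13,13], [1,3,17,17,14,14,14], [1,4,4,15,1,1,16], [1,4,4,20,6,6,19],
  [1,4,4,23,9,9,20], [1,4,4,28,13,18,18], [1,4,6,7,1,1,10], [1,4,7,15,1,1,17], [1,4,9,10,1,1,14],
  [1,4,11,27,17,17,17], [1,4,20,20,13,18,18], [1,5,5,5,2,6,6], [1,5,5,11,6,6,10],
  [1,5,5,20,9,9,17], [1,5,5,21,2,2,22], [1,5,5,21,10,14,14], [1,5,5,24,1,1,25], [1,5,6,14,1,1,16],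
  [1,5,8,9,1,1,13], [1,5,8,21,1,1,23], [1,5,9,16,1,1,19], [1,5,9,20,13,13,13], [1,5,10,10,8,9,9],
  [1,5,11,11,6,6,14], [1,5,11,21,14,14,14], [1,5,14,14,9,9,16], [1,5,19,19,6,6,26],
  [1,5,19,19,10,18,18], [1,6,6,20,9,14,14], [1,6,6,28,8,8,27], [1,6,7,20,1,1,22],
  [1,6,10,11,1,1,16], [1,6,10,21,1,1,24], [1,6,13,14,1,1,20], [1,7,7,13,6,6,14],
  [1,7,7,24,15,15,15], [1,7,9,29,18,18,18], [1,8,8,8,6,6,11], [1,8,8,17,9,9,16], [1,8,9,9,1,1,15],
  [1,8,9,16,1,1,20], [1,8,9,19,13,13,13], [1,8,14,14,12,12,13], [1,8,17,18,1,1,26],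
  [1,8,17,27,19,19,19]]"
  by (simp add: solution_def)

lemmas hits2 = hit_update[OF solutions2, unfolded hit_unfold]

lemma solutions3: "list_all solution
  [[1,9,9,13,2,2,18], [1,9,9,17,8,8,18], [1,9,9,19,10,10,18], [1,9,9,20,13,13,15],
  [1,9,10,12,1,1,18], [1,9,14,20,1,1,26], [1,9,16,16,3,3,24], [1,9,16,16,4,17,17],
  [1,9,16,23,17,17,17], [1,9,19,19,8,8,26], [1,9,19,23,18,18,18], [1,9,21,21,12,12,26],
  [1,9,23,29,22,22,22], [1,10,10,10,3,6,16], [1,10,10,10,6,11,12], [1,10,10,19,9,9,20],
  [1,10,10,20,6,6,23], [1,10,10,21,11,11,20], [1,10,14,27,1,1,32], [1,11,11,11,2,6,18],
  [1,11,11,16,7,15,15], [1,11,11,21,6,18,18], [1,11,11,27,2,22,22], [1,11,11,27,18,18,18],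
  [1,11,12,19,1,1,25], [1,11,15,25,18,18,18], [1,11,19,19,14,18,18], [1,11,21,21,6,22,22],
  [1,11,26,26,4,27,27], [1,11,29,29,2,30,30], [1,12,12,12,3,10,18], [1,12,12,12,6,6,19],
  [1,12,14,14,5,16,16], [1,12,16,16,3,18,18], [1,13,13,27,14,14,26], [1,13,17,17,6,6,26],
  [1,13,17,17,10,18,18], [1,13,18,18,11,11,24], [1,13,22,22,16,21,21], [1,13,26,26,8,27,27],
  [1,14,14,14,2,12,21], [1,14,14,16,12,12,19], [1,14,14,24,13,20,20], [1,14,14,27,7,7,32],
  [1,14,14,27,13,13,28], [1,15,16,16,9,9,24], [1,16,16,16,11,18,18], [1,16,16,24,18,18,21],
  [1,16,21,21,9,23,23], [1,17,17,17,12,18,20], [1,17,28,28,20,27,27], [1,18,18,18,3,8,30],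
  [1,18,18,20,9,22,22], [1,19,19,27,22,22,22], [1,20,20,24,5,26,26], [2,2,2,6,4,4,4],
  [2,2,2,8,2,6,6], [2,2,2,9,2,5,8], [2,2,2,13,1,6,12], [2,2,2,15,2,8,13], [2,2,2,16,6,6,14],
  [2,2,2,17,3,6,16], [2,2,2,19,2,12,15], [2,2,2,19,6,9,16], [2,2,2,21,2,7,20], [2,2,2,23,6,12,19],
  [2,2,2,24,2,10,22], [2,2,2,24,14,14,14], [2,2,2,25,3,12,22], [2,2,2,25,5,6,24],
  [2,2,2,26,12,12,20], [2,2,2,27,1,8,26], [2,2,2,27,1,16,22], [2,2,2,27,4,7,26],
  [2,2,2,27,4,14,23], [2,2,2,30,8,8,28], [2,2,2,30,16,16,20], [2,2,3,10,2,7,8], [2,2,3,12,2,6,11],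
  [2,2,3,17,8,11,11], [2,2,3,18,2,9,16], [2,2,3,20,5,14,14], [2,2,3,24,9,16,16],
  [2,2,3,25,8,17,17], [2,2,3,28,6,6,27], [2,2,4,15,2,7,14], [2,2,4,15,7,10,10], [2,2,4,15,8,8,11],
  [2,2,4,17,5,12,12], [2,2,4,23,2,15,18], [2,2,4,24,10,10,20], [2,2,4,25,1,18,18],
  [2,2,4,25,12,12,19], [2,2,4,27,8,8,25], [2,2,4,27,14,14,19], [2,2,5,12,7,8,8],
  [2,2,5,14,2,9,12], [2,2,5,15,1,1,16], [2,2,5,16,1,12,12], [2,2,5,18,2,8,17]]"
  by (simp add: solution_def)

lemmas hits3 = hit_update[OF solutions3, unfolded hit_unfold]

lemma solutions4: "list_all solution
  [[2,2,5,23,9,9,20], [2,2,5,24,2,11,22], [2,2,5,28,13,18,18], [2,2,6,15,2,3,16],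
  [2,2,6,15,2,11,12], [2,2,6,16,10,10,10], [2,2,6,21,2,9,20], [2,2,6,27,2,12,25],
  [2,2,7,10,2,3,12], [2,2,7,12,4,4,13], [2,2,7,16,5,12,12], [2,2,7,18,2,4,19], [2,2,7,18,2,11,16],
  [2,2,7,19,9,9,16], [2,2,7,20,12,12,13], [2,2,7,21,11,11,16], [2,2,7,24,11,16,16],
  [2,2,7,27,1,1,28], [2,2,7,27,8,19,19], [2,2,8,15,3,12,12], [2,2,8,18,2,14,14],
  [2,2,8,20,2,12,18], [2,2,8,21,1,16,16], [2,2,8,21,2,5,22], [2,2,8,21,12,12,15],
  [2,2,8,25,7,18,18], [2,2,8,26,10,18,18], [2,2,8,27,1,20,20], [2,2,8,27,2,11,26],
  [2,2,8,27,16,16,17], [2,2,8,30,2,22,22], [2,2,8,30,18,18,18], [2,2,9,9,1,5,12],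
  [2,2,9,10,2,4,13], [2,2,9,10,2,8,11], [2,2,9,14,2,5,16], [2,2,9,18,2,3,20], [2,2,9,19,5,5,20],
  [2,2,9,20,8,8,19], [2,2,9,20,10,10,17], [2,2,9,22,2,13,20], [2,2,9,27,11,11,24],
  [2,2,9,28,15,18,18], [2,2,9,28,16,16,19], [2,2,10,11,2,9,12], [2,2,10,18,4,4,20],
  [2,2,10,18,12,12,12], [2,2,10,27,2,7,28], [2,2,11,15,4,13,13], [2,2,11,17,3,3,20],
  [2,2,11,17,9,9,16], [2,2,11,18,2,7,20], [2,2,11,24,2,5,26], [2,2,11,26,2,15,24],
  [2,2,12,12,2,6,16], [2,2,12,13,4,4,17], [2,2,12,15,2,7,18], [2,2,12,19,6,6,21],
  [2,2,12,20,2,8,22], [2,2,12,21,9,16,16], [2,2,12,23,13,16,16], [2,2,12,23,14,14,17],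
  [2,2,12,25,2,17,22], [2,2,12,27,9,20,20], [2,2,13,14,2,12,15], [2,2,13,20,12,12,17],
  [2,2,13,22,2,9,24], [2,2,13,24,8,8,25], [2,2,13,25,3,3,28], [2,2,14,15,2,8,19],
  [2,2,14,22,12,12,20], [2,2,15,15,4,9,19], [2,2,15,15,5,12,17], [2,2,15,15,9,11,16],
  [2,2,15,19,3,3,24], [2,2,15,24,3,20,20], [2,2,15,28,7,22,22], [2,2,16,20,4,18,18],
  [2,2,16,27,4,4,31], [2,2,16,30,14,22,22], [2,2,17,17,8,9,21], [2,2,17,20,7,18,18],
  [2,2,17,27,11,11,28], [2,2,18,18,4,8,24], [2,2,18,18,12,16,16], [2,2,18,19,2,8,25],
  [2,2,18,22,4,20,20], [2,2,18,32,2,26,26], [2,2,19,20,11,18,18], [2,2,19,24,2,10,29],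
  [2,2,20,23,17,18,18], [2,2,20,24,10,10,28], [2,2,20,27,13,22,22], [2,2,21,28,9,24,24],
  [2,2,23,23,9,16,27], [2,2,24,24,2,16,30], [2,2,32,32,16,30,30], [2,3,3,16,6,11,11],
  [2,3,8,10,2,2,13], [2,4,4,24,8,8,22]]"
  by (simp add: solution_def)

lemmas hits4 = hit_update[OF solutions4, unfolded hit_unfold]

text \<open>Padded Pythagorean triples appear here: \<open>[3,3,3,4,3,3,5]\<close> is
  \<open>3^2 + 4^2 = 5^2\<close>. The entry \<open>[3,3,3,12,3,9,9]\<close> separates 3, 9, 12 at
  the root.\<close>

lemma solutions5: "list_all solution
  [[2,4,4,24,10,16,16], [2,4,4,26,8,18,18], [2,4,5,18,2,2,19], [2,4,8,18,2,2,20],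
  [2,4,9,14,2,2,17], [2,4,17,18,2,2,25], [2,4,21,21,1,1,30], [2,5,5,8,3,3,10], [2,5,5,12,1,1,14],
  [2,5,5,12,7,7,10], [2,5,5,28,9,9,26], [2,5,12,14,2,2,19], [2,6,6,16,2,2,18], [2,6,7,12,2,2,15],
  [2,6,12,20,2,2,24], [2,6,14,14,12,12,12], [2,7,7,12,5,5,14], [2,7,7,16,9,9,14],
  [2,7,7,20,3,3,22], [2,7,10,12,2,2,17], [2,7,16,18,2,2,25], [2,8,8,24,4,4,26], [2,8,9,22,2,2,25],
  [2,8,12,14,2,2,20], [2,8,17,17,9,9,22], [2,9,9,16,7,7,18], [2,9,9,20,11,11,18],
  [2,9,14,16,2,2,23], [2,9,20,22,2,2,31], [2,10,10,10,4,12,12], [2,10,10,18,8,8,20],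
  [2,10,11,12,2,2,19], [2,10,12,17,2,2,23], [2,11,11,16,3,3,22], [2,11,11,20,9,9,22],
  [2,11,11,24,10,19,19], [2,12,13,13,1,1,22], [2,12,13,13,6,15,15], [2,12,13,13,9,9,18],
  [2,12,14,17,2,2,25], [2,12,23,23,18,21,21], [2,13,13,24,6,21,21], [2,16,16,16,12,12,22],
  [2,16,17,17,9,9,26], [2,16,18,18,2,2,30], [2,20,20,20,12,22,24], [3,3,3,3,2,4,4],
  [3,3,3,4,3,3,5], [3,3,3,7,2,6,6], [3,3,3,9,2,2,10], [3,3,3,9,6,6,6], [3,3,3,12,1,1,13],
  [3,3,3,12,3,9,9], [3,3,3,12,5,5,11], [3,3,3,13,4,6,12], [3,3,3,16,3,7,15], [3,3,3,16,9,9,11],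
  [3,3,3,19,10,12,12], [3,3,3,21,2,8,20], [3,3,3,21,4,14,16], [3,3,3,23,6,6,22],
  [3,3,3,24,5,17,17], [3,3,3,24,9,9,21], [3,3,3,24,11,11,19], [3,3,3,25,2,18,18],
  [3,3,3,28,15,15,19], [3,3,3,29,6,16,24], [3,3,3,32,3,9,31], [3,3,3,32,13,21,21],
  [3,3,4,10,6,7,7], [3,3,4,14,3,10,11], [3,3,4,17,7,7,15], [3,3,4,18,9,9,14], [3,3,4,20,3,8,19],
  [3,3,4,30,15,15,22], [3,3,5,8,3,7,7], [3,3,5,15,6,6,14], [3,3,5,17,2,2,18], [3,3,5,21,12,12,14],
  [3,3,5,24,13,15,15], [3,3,5,27,12,12,22], [3,3,5,28,3,17,23], [3,3,6,12,1,1,14],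
  [3,3,6,12,7,7,10], [3,3,6,14,3,4,15], [3,3,6,20,2,15,15], [3,3,6,20,3,11,18],
  [3,3,6,32,3,13,30], [3,3,7,13,6,10,10], [3,3,7,15,2,12,12], [3,3,7,16,3,5,17],
  [3,3,7,17,4,4,18], [3,3,7,19,6,14,14], [3,3,8,8,1,1,12], [3,3,8,8,3,4,11], [3,3,8,13,3,11,11],
  [3,3,8,14,3,10,13], [3,3,8,14,6,11,11], [3,3,8,18,3,6,19], [3,3,8,20,12,13,13]]"
  by (simp add: solution_def)

lemmas hits5 = hit_update[OF solutions5, unfolded hit_unfold]

lemma solutions6: "list_all solution
  [[3,3,8,22,3,14,19], [3,3,8,22,11,11,18], [3,3,8,27,3,19,21], [3,3,8,27,15,15,19],
  [3,3,8,28,12,19,19], [3,3,9,9,4,8,10], [3,3,9,24,15,15,15], [3,3,10,10,4,9,11],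
  [3,3,10,10,5,7,12], [3,3,10,14,3,4,17], [3,3,10,14,3,7,16], [3,3,10,16,5,5,18],
  [3,3,10,16,6,13,13], [3,3,10,18,3,12,17], [3,3,10,26,3,16,23], [3,3,11,16,3,5,19],
  [3,3,11,17,6,14,14], [3,3,12,12,5,5,16], [3,3,12,12,8,11,11], [3,3,12,15,7,7,17],
  [3,3,12,17,1,15,15], [3,3,12,18,1,1,22], [3,3,12,21,5,17,17], [3,3,12,22,3,14,21],
  [3,3,12,22,14,15,15], [3,3,12,24,4,19,19], [3,3,12,24,13,13,20], [3,3,12,27,3,21,21],
  [3,3,12,28,3,19,24], [3,3,12,28,8,21,21], [3,3,12,30,2,23,23], [3,3,12,30,3,18,27],
  [3,3,13,13,4,4,18], [3,3,13,13,4,12,14], [3,3,13,13,6,8,16], [3,3,13,19,6,16,16],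
  [3,3,13,20,3,17,17], [3,3,13,23,14,14,18], [3,3,13,24,3,15,23], [3,3,13,29,8,8,30],
  [3,3,14,14,4,13,15], [3,3,14,16,3,10,19], [3,3,14,20,6,17,17], [3,3,15,15,2,8,20],
  [3,3,15,15,4,14,16], [3,3,15,23,12,12,22], [3,3,15,27,18,18,18], [3,3,16,16,3,11,20],
  [3,3,16,16,4,15,17], [3,3,16,16,5,8,21], [3,3,16,17,13,13,15], [3,3,16,22,6,19,19],
  [3,3,16,24,15,15,20], [3,3,17,17,12,14,16], [3,3,17,23,6,20,20], [3,3,18,18,3,9,24],
  [3,3,18,18,4,11,23], [3,3,19,19,8,10,24], [3,3,19,19,12,14,20], [3,3,20,20,3,5,28],
  [3,3,20,20,5,8,27], [3,3,20,20,11,11,24], [3,3,20,24,3,12,29], [3,3,20,26,6,23,23],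
  [3,3,20,28,12,23,23], [3,3,21,21,4,20,22], [3,3,21,21,10,20,20], [3,3,22,28,6,25,25],
  [3,3,23,23,12,16,26], [3,3,25,25,10,12,32], [3,3,27,27,14,16,32], [3,4,4,11,3,3,12],
  [3,4,4,16,6,6,15], [3,4,4,20,7,14,14], [3,4,4,24,14,14,15], [3,4,7,13,3,3,15], [3,4,9,9,3,3,13],
  [3,4,13,13,11,11,11], [3,4,19,19,3,3,27], [3,4,23,23,19,19,19], [3,4,26,26,15,24,24],
  [3,5,5,7,2,2,10], [3,5,5,7,6,6,6], [3,5,5,13,8,8,10], [3,5,5,20,3,3,21], [3,5,5,20,11,13,13],
  [3,5,5,23,14,14,14], [3,5,5,25,6,18,18], [3,5,5,32,19,19,19], [3,5,6,12,3,3,14],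
  [3,5,8,8,3,3,12], [3,5,8,19,3,3,21], [3,5,13,16,3,3,21], [3,5,15,15,12,12,14],
  [3,5,17,17,10,16,16], [3,5,28,28,12,27,27], [3,6,6,15,5,5,16], [3,6,6,15,8,11,11],
  [3,6,6,16,7,12,12], [3,6,6,24,8,8,23]]"
  by (simp add: solution_def)

lemmas hits6 = hit_update[OF solutions6, unfolded hit_unfold]

lemma solutions7: "list_all solution
  [[3,6,6,25,15,15,16], [3,7,7,11,4,4,14], [3,7,7,15,2,2,18], [3,7,7,16,5,13,13],
  [3,7,7,16,11,11,11], [3,7,7,17,2,14,14], [3,7,7,17,10,10,14], [3,7,7,20,13,13,13],
  [3,7,7,24,11,11,21], [3,7,7,27,6,20,20], [3,7,8,11,3,3,15], [3,7,11,11,10,10,10],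
  [3,7,12,21,3,3,25], [3,7,13,13,2,14,14], [3,7,13,13,6,6,18], [3,7,13,19,14,14,14],
  [3,7,14,14,5,5,20], [3,7,15,24,3,3,29], [3,7,17,25,18,18,18], [3,7,22,22,12,21,21],
  [3,8,8,8,1,10,10], [3,8,8,8,4,4,13], [3,8,8,11,1,1,16], [3,8,8,13,5,5,16], [3,8,8,16,1,14,14],
  [3,8,8,16,4,4,19], [3,8,8,19,11,11,16], [3,8,8,20,5,16,16], [3,8,8,27,12,19,19],
  [3,8,8,28,11,20,20], [3,8,8,29,16,19,19], [3,8,9,15,3,3,19], [3,8,10,13,3,3,18],
  [3,8,12,12,6,6,17], [3,8,13,13,5,5,19], [3,8,13,25,17,17,17], [3,8,20,20,4,4,29],
  [3,8,20,20,15,18,18], [3,8,22,22,16,16,23], [3,8,25,25,21,21,21], [3,9,9,15,2,14,14],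
  [3,9,9,15,10,10,14], [3,9,9,21,10,16,16], [3,9,9,24,3,3,27], [3,9,11,11,2,2,18],
  [3,9,18,18,4,19,19], [3,9,18,18,13,13,20], [3,9,21,21,18,18,18], [3,9,27,27,14,26,26],
  [3,10,10,10,7,8,14], [3,10,10,12,8,8,15], [3,10,10,17,7,7,20], [3,10,10,17,11,11,16],
  [3,10,10,23,9,9,24], [3,10,10,23,13,13,20], [3,10,12,21,3,3,26], [3,10,14,17,3,3,24],
  [3,11,11,16,13,13,13], [3,11,11,19,8,8,22], [3,11,11,19,10,16,16], [3,11,12,12,3,3,20],
  [3,11,16,16,8,17,17], [3,11,16,17,15,15,15], [3,11,17,17,14,16,16], [3,11,23,23,6,24,24],
  [3,12,12,12,7,14,14], [3,12,12,20,6,6,25], [3,12,12,21,4,19,19], [3,12,12,21,13,13,20],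
  [3,12,12,24,4,4,29], [3,12,12,24,16,16,19], [3,12,13,15,3,3,23], [3,12,15,15,5,17,17],
  [3,12,15,15,11,11,19], [3,12,18,21,3,3,30], [3,12,22,22,14,14,27], [3,12,27,27,19,25,25],
  [3,13,13,13,2,16,16], [3,13,13,13,4,4,22], [3,13,13,13,4,10,20], [3,13,13,13,8,14,16],
  [3,13,13,16,5,17,17], [3,13,13,19,14,16,16], [3,13,13,20,3,3,27], [3,13,13,25,18,18,18],
  [3,13,16,22,3,3,30], [3,13,19,19,10,20,20], [3,14,14,14,2,8,23], [3,14,14,14,7,8,22],
  [3,14,14,16,8,8,23], [3,14,14,20,6,6,27], [3,14,14,20,16,16,17], [3,14,14,25,12,21,21],
  [3,14,14,25,15,15,24], [3,15,15,15,2,2,26], [3,15,15,15,2,14,22], [3,15,15,15,6,18,18],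
  [3,15,15,15,10,10,22], [3,15,15,17,6,6,26], [3,15,15,20,3,3,29]]"
  by (simp add: solution_def)

lemmas hits7 = hit_update[OF solutions7, unfolded hit_unfold]

text \<open>The entries \<open>[4,4,4,12,8,8,8]\<close> and \<open>[4,4,4,16,4,12,12]\<close> forbid
  4, 8, 12 and 4, 12, 16 in one class; many upper nodes rest on them.\<close>

lemma solutions8: "list_all solution
  [[3,15,15,27,12,12,30], [3,15,18,18,7,7,28], [3,15,23,23,18,22,22], [3,16,16,16,4,19,20],
  [3,16,18,18,12,12,25], [3,16,22,22,9,24,24], [3,16,23,23,21,21,21], [3,17,17,17,10,10,26],
  [3,17,17,17,14,14,22], [3,17,17,32,19,25,25], [3,17,18,18,8,21,21], [3,17,18,18,9,9,28],
  [3,19,29,29,24,24,30], [3,20,22,22,15,24,24], [3,22,22,25,12,27,27], [3,24,24,24,13,28,28],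
  [4,4,4,5,1,6,6], [4,4,4,7,5,6,6], [4,4,4,9,1,8,8], [4,4,4,9,2,2,11], [4,4,4,9,2,5,10],
  [4,4,4,12,8,8,8], [4,4,4,13,6,9,10], [4,4,4,15,2,10,13], [4,4,4,16,4,12,12], [4,4,4,17,7,12,12],
  [4,4,4,18,4,10,16], [4,4,4,19,2,9,18], [4,4,4,19,6,7,18], [4,4,4,19,11,12,12],
  [4,4,4,21,1,2,22], [4,4,4,21,8,8,19], [4,4,4,21,8,13,16], [4,4,4,21,10,10,17],
  [4,4,4,23,12,12,17], [4,4,4,25,4,9,24], [4,4,4,25,5,18,18], [4,4,4,26,2,12,24],
  [4,4,4,27,2,17,22], [4,4,4,27,4,19,20], [4,4,4,27,11,16,20], [4,4,4,29,4,12,27],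
  [4,4,4,29,9,18,22], [4,4,4,30,4,16,26], [4,4,4,31,18,18,19], [4,4,4,32,12,12,28],
  [4,4,5,11,4,9,9], [4,4,5,12,1,10,10], [4,4,5,18,4,13,14], [4,4,5,19,9,9,16],
  [4,4,5,21,11,11,16], [4,4,5,24,2,2,25], [4,4,5,24,4,16,19], [4,4,5,24,11,16,16],
  [4,4,5,27,1,1,28], [4,4,5,27,8,19,19], [4,4,5,29,4,21,21], [4,4,5,30,4,10,29],
  [4,4,6,13,4,10,11], [4,4,6,15,4,9,14], [4,4,6,20,4,14,16], [4,4,7,12,5,10,10],
  [4,4,7,14,4,6,15], [4,4,7,15,5,5,16], [4,4,7,15,8,11,11], [4,4,7,18,4,10,17],
  [4,4,7,22,4,15,18], [4,4,7,24,3,18,18], [4,4,7,24,8,8,23], [4,4,7,25,15,15,16],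
  [4,4,7,27,4,13,25], [4,4,8,9,2,2,13], [4,4,8,15,4,7,16], [4,4,8,15,10,10,11], [4,4,8,21,2,2,23],
  [4,4,8,21,5,16,16], [4,4,8,27,4,5,28], [4,4,8,27,5,20,20], [4,4,8,27,10,10,25],
  [4,4,8,30,4,14,28], [4,4,8,30,14,20,20], [4,4,9,9,5,5,12], [4,4,9,11,4,7,13], [4,4,9,16,2,2,19],
  [4,4,9,16,4,8,17], [4,4,9,16,10,10,13], [4,4,9,17,1,1,20], [4,4,9,17,4,5,19],
  [4,4,9,17,8,13,13], [4,4,9,18,4,14,15], [4,4,9,20,1,16,16], [4,4,9,20,6,6,21],
  [4,4,9,20,11,14,14], [4,4,9,23,11,11,20], [4,4,9,24,4,12,23], [4,4,9,25,4,19,19],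
  [4,4,9,31,4,23,23], [4,4,9,32,13,22,22], [4,4,10,17,4,9,18], [4,4,10,19,4,6,21]]"
  by (simp add: solution_def)

lemmas hits8 = hit_update[OF solutions8, unfolded hit_unfold]

lemma solutions9: "list_all solution
  [[4,4,10,21,4,14,19], [4,4,10,24,14,16,16], [4,4,11,11,3,3,16], [4,4,11,12,6,6,15],
  [4,4,11,13,4,9,15], [4,4,11,18,4,10,19], [4,4,11,21,4,17,17], [4,4,11,21,13,13,16],
  [4,4,11,24,9,18,18], [4,4,11,24,12,12,21], [4,4,11,27,7,7,28], [4,4,11,32,18,18,23],
  [4,4,12,15,3,14,14], [4,4,12,21,4,5,24], [4,4,12,21,14,14,15], [4,4,12,25,6,6,27],
  [4,4,13,27,4,17,25], [4,4,14,20,4,6,24], [4,4,15,15,4,5,21], [4,4,15,15,12,13,13],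
  [4,4,15,16,6,6,21], [4,4,15,18,4,6,23], [4,4,15,20,3,18,18], [4,4,15,22,4,7,26],
  [4,4,15,23,8,19,19], [4,4,16,19,1,18,18], [4,4,16,21,9,18,18], [4,4,16,23,13,18,18],
  [4,4,16,27,7,22,22], [4,4,16,27,14,14,25], [4,4,16,30,6,24,24], [4,4,18,18,2,10,24],
  [4,4,18,19,4,5,26], [4,4,18,20,4,8,26], [4,4,18,20,4,16,22], [4,4,20,21,16,16,19],
  [4,4,21,21,4,13,27], [4,4,21,21,8,11,27], [4,4,21,21,13,13,24], [4,4,21,24,9,22,22],
  [4,4,23,23,15,17,24], [4,4,24,24,4,12,32], [4,4,25,25,20,21,21], [4,4,29,29,16,27,27],
  [4,5,5,9,7,7,7], [4,5,5,14,9,9,10], [4,5,5,15,7,11,11], [4,5,5,21,13,13,13], [4,5,5,24,8,17,17],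
  [4,5,5,24,11,11,20], [4,5,6,6,4,4,9], [4,5,10,10,6,6,13], [4,5,12,24,4,4,27],
  [4,5,14,14,6,6,19], [4,5,14,18,4,4,23], [4,5,17,17,13,15,15], [4,6,6,11,3,10,10],
  [4,6,6,13,4,4,15], [4,6,6,15,5,12,12], [4,6,6,27,12,12,23], [4,6,7,10,4,4,13],
  [4,6,10,13,4,4,17], [4,6,15,15,3,3,22], [4,6,19,19,7,7,26], [4,6,19,19,14,17,17],
  [4,6,19,19,15,15,18], [4,7,7,10,3,3,14], [4,7,7,15,1,13,13], [4,7,7,15,5,5,17],
  [4,7,7,18,10,13,13], [4,7,7,18,11,11,14], [4,7,7,20,8,15,15], [4,7,7,27,11,19,19],
  [4,7,11,11,3,3,17], [4,7,17,27,19,19,19], [4,8,8,23,5,18,18], [4,8,8,27,4,4,29],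
  [4,8,8,27,16,16,19], [4,8,9,20,4,4,23], [4,8,13,13,9,9,16], [4,8,15,16,4,4,23],
  [4,8,19,19,3,3,28], [4,9,9,10,6,11,11], [4,9,9,14,5,5,18], [4,9,9,18,3,3,22], [4,9,9,19,7,7,21],
  [4,9,9,20,1,1,24], [4,9,9,22,13,13,18], [4,9,10,10,2,2,17], [4,9,10,10,6,6,15],
  [4,9,10,14,4,4,19], [4,9,11,11,1,13,13], [4,9,11,17,13,13,13], [4,9,14,14,10,10,17],
  [4,9,17,17,5,5,25], [4,9,17,17,15,15,15], [4,10,10,15,7,14,14], [4,10,10,16,6,6,20],
  [4,10,10,21,3,18,18], [4,10,10,21,4,4,25]]"
  by (simp add: solution_def)

lemmas hits9 = hit_update[OF solutions9, unfolded hit_unfold]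

lemma solutions10: "list_all solution
  [[4,10,10,21,8,8,23], [4,10,10,24,2,2,28], [4,10,10,24,14,14,20], [4,10,10,31,5,24,24],
  [4,10,11,11,9,9,14], [4,10,11,18,4,4,23], [4,10,15,15,11,11,18], [4,10,19,19,9,9,26],
  [4,11,11,11,3,3,19], [4,11,11,11,3,9,17], [4,11,11,12,1,1,20], [4,11,11,16,8,15,15],
  [4,11,11,18,7,7,22], [4,11,11,23,9,9,25], [4,11,11,24,5,5,28], [4,11,11,25,1,21,21],
  [4,11,11,30,10,23,23], [4,11,13,13,5,15,15], [4,11,20,20,17,18,18], [4,12,12,13,4,4,21],
  [4,12,13,13,7,7,20], [4,12,17,17,9,9,24], [4,12,17,17,13,13,20], [4,12,28,28,24,24,24],
  [4,13,13,13,1,9,21], [4,13,13,13,3,15,17], [4,13,13,13,9,9,19], [4,13,13,18,1,1,26],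
  [4,13,13,22,9,9,26], [4,13,13,27,5,23,23], [4,13,13,27,19,19,19], [4,13,13,30,2,25,25],
  [4,13,13,30,14,23,23], [4,13,14,14,12,12,17], [4,13,16,16,6,6,25], [4,13,22,22,1,24,24],
  [4,14,14,17,6,6,25], [4,14,14,17,7,18,18], [4,14,14,19,11,18,18], [4,14,14,27,13,22,22],
  [4,14,19,19,15,15,22], [4,14,25,25,2,27,27], [4,15,15,15,9,9,23], [4,15,19,19,9,21,21],
  [4,15,23,23,7,25,25], [4,16,16,21,2,2,31], [4,16,16,27,17,22,22], [4,16,17,17,15,15,20],
  [4,16,25,25,8,27,27], [4,17,17,17,1,21,21], [4,17,17,18,14,19,19], [4,17,17,22,14,21,21],
  [4,17,17,27,21,21,21], [4,19,20,20,18,18,23], [4,20,20,20,8,24,24], [4,20,21,21,19,19,24],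
  [4,22,22,29,5,30,30], [5,5,5,8,3,3,11], [5,5,5,11,4,6,12], [5,5,5,12,5,5,13],
  [5,5,5,15,10,10,10], [5,5,5,16,5,9,15], [5,5,5,16,9,9,13], [5,5,5,17,2,6,18],
  [5,5,5,19,6,12,16], [5,5,5,20,5,15,15], [5,5,5,21,2,16,16], [5,5,5,21,4,4,22],
  [5,5,5,21,8,14,16], [5,5,5,27,2,4,28], [5,5,5,27,2,20,20], [5,5,5,27,8,8,26],
  [5,5,5,27,8,16,22], [5,5,5,28,3,3,29], [5,5,6,16,2,13,13], [5,5,6,16,3,3,18],
  [5,5,6,16,5,11,14], [5,5,6,20,1,1,22], [5,5,6,20,9,9,18], [5,5,6,22,5,16,17], [5,5,7,12,3,3,15],
  [5,5,7,12,9,9,9], [5,5,7,13,6,6,14], [5,5,7,15,6,12,12], [5,5,7,17,10,12,12],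
  [5,5,7,24,15,15,15], [5,5,8,8,4,9,9], [5,5,8,10,3,3,14], [5,5,8,13,9,9,11], [5,5,8,15,1,13,13],
  [5,5,8,18,10,13,13], [5,5,8,18,11,11,14], [5,5,8,19,5,15,15], [5,5,8,26,5,18,21],
  [5,5,8,27,1,1,29], [5,5,8,27,5,17,23], [5,5,8,27,11,19,19], [5,5,9,13,10,10,10],
  [5,5,9,16,7,7,17], [5,5,9,19,2,2,22]]"
  by (simp add: solution_def)

lemmas hits10 = hit_update[OF solutions10, unfolded hit_unfold]

lemma solutions11: "list_all solution
  [[5,5,9,19,10,14,14], [5,5,9,20,11,11,17], [5,5,9,29,18,18,18], [5,5,10,10,5,9,12],
  [5,5,10,12,7,7,14], [5,5,10,18,5,7,20], [5,5,11,11,2,12,12], [5,5,11,21,10,16,16],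
  [5,5,11,24,5,19,19], [5,5,11,24,13,17,17], [5,5,11,27,10,20,20], [5,5,11,31,18,18,22],
  [5,5,12,20,3,3,24], [5,5,12,20,4,17,17], [5,5,12,22,1,1,26], [5,5,12,22,10,17,17],
  [5,5,13,16,5,15,15], [5,5,13,23,10,18,18], [5,5,13,25,14,18,18], [5,5,14,14,3,12,17],
  [5,5,14,16,3,3,22], [5,5,14,20,9,9,22], [5,5,14,24,10,19,19], [5,5,15,16,11,11,17],
  [5,5,15,21,14,14,18], [5,5,15,27,6,22,22], [5,5,16,16,9,9,20], [5,5,16,18,5,11,22],
  [5,5,16,21,5,19,19], [5,5,16,22,5,6,27], [5,5,16,27,5,13,29], [5,5,16,30,19,19,22],
  [5,5,17,17,4,6,24], [5,5,17,27,14,14,26], [5,5,18,18,1,11,24], [5,5,18,18,1,16,21],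
  [5,5,18,18,5,12,23], [5,5,18,18,9,16,19], [5,5,18,20,7,7,26], [5,5,18,20,14,17,17],
  [5,5,19,19,12,12,22], [5,5,20,24,12,21,21], [5,5,21,21,2,12,28], [5,5,21,21,4,4,30],
  [5,5,21,24,5,9,31], [5,5,24,24,12,23,23], [5,5,25,28,1,27,27], [5,6,6,16,8,8,15],
  [5,6,6,23,5,5,24], [5,6,6,25,12,17,17], [5,6,6,28,9,20,20], [5,6,7,14,5,5,16],
  [5,6,8,11,5,5,14], [5,6,9,22,5,5,24], [5,7,7,7,6,6,10], [5,7,7,9,2,2,14], [5,7,7,16,3,3,19],
  [5,7,7,19,12,12,14], [5,7,7,20,9,9,19], [5,7,7,23,2,18,18], [5,7,7,25,10,18,18],
  [5,7,8,15,11,11,11], [5,7,8,27,17,17,17], [5,7,13,27,18,18,18], [5,7,14,14,4,15,15],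
  [5,7,17,17,2,18,18], [5,7,18,18,12,17,17], [5,7,23,23,18,18,22], [5,7,25,25,18,18,26],
  [5,8,8,12,2,2,17], [5,8,8,12,6,6,15], [5,8,8,21,3,3,24], [5,8,8,21,12,15,15],
  [5,8,8,21,13,13,16], [5,8,8,24,9,18,18], [5,8,8,24,12,12,21], [5,8,8,28,17,18,18],
  [5,8,8,32,18,18,23], [5,8,9,13,5,5,17], [5,8,10,10,1,12,12], [5,8,11,18,5,5,22],
  [5,8,13,24,5,5,28], [5,8,16,16,6,6,23], [5,8,16,27,5,5,32], [5,8,18,18,2,2,27],
  [5,8,18,18,15,16,16], [5,8,21,21,11,11,27], [5,9,9,9,6,6,14], [5,9,9,13,4,4,18],
  [5,9,9,16,1,1,21], [5,9,9,19,6,16,16], [5,9,9,23,14,14,18], [5,9,10,10,5,5,16],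
  [5,9,10,10,8,11,11], [5,9,11,19,14,14,14], [5,9,14,14,7,7,20], [5,9,14,14,11,11,16],
  [5,9,14,18,5,5,24], [5,9,15,15,6,6,22], [5,9,17,17,6,18,18]]"
  by (simp add: solution_def)

lemmas hits11 = hit_update[OF solutions11, unfolded hit_unfold]

lemma solutions12: "list_all solution
  [[5,9,17,17,10,10,22], [5,9,22,22,4,23,23], [5,9,22,22,5,5,32], [5,10,10,24,1,20,20],
  [5,10,10,24,6,6,27], [5,10,10,24,16,16,17], [5,11,11,11,10,12,12], [5,11,11,12,5,5,19],
  [5,11,11,15,2,2,22], [5,11,11,16,9,9,19], [5,11,11,17,6,6,22], [5,11,11,27,16,16,22],
  [5,11,16,18,5,5,26], [5,11,21,21,8,8,30], [5,11,28,28,16,27,27], [5,12,12,12,6,14,15],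
  [5,12,14,14,7,16,16], [5,12,16,16,14,14,17], [5,12,19,19,3,21,21], [5,12,19,19,5,5,29],
  [5,12,20,20,1,22,22], [5,13,13,15,14,14,14], [5,13,13,17,2,18,18], [5,14,14,14,1,6,24],
  [5,14,14,17,15,15,16], [5,14,14,20,13,18,18], [5,14,17,18,5,5,28], [5,14,18,23,5,5,32],
  [5,15,15,16,3,19,19], [5,15,19,19,18,18,18], [5,16,16,20,17,18,18], [5,16,16,21,17,17,20],
  [5,16,16,27,4,25,25], [5,16,16,27,11,11,32], [5,16,18,18,10,10,27], [5,16,24,24,9,26,26],
  [5,17,17,23,18,18,22], [5,17,29,29,14,30,30], [5,19,19,24,21,21,21], [5,21,21,21,14,24,24],
  [5,25,25,25,10,30,30], [5,25,25,32,27,27,29], [6,6,6,6,4,8,8], [6,6,6,8,6,6,10],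
  [6,6,6,14,4,12,12], [6,6,6,17,3,8,18], [6,6,6,18,4,4,20], [6,6,6,18,12,12,12],
  [6,6,6,19,8,9,18], [6,6,6,19,10,12,15], [6,6,6,24,2,2,26], [6,6,6,24,6,18,18],
  [6,6,6,24,10,10,22], [6,6,6,25,6,11,24], [6,6,6,25,6,16,21], [6,6,6,26,8,12,24],
  [6,6,6,27,2,7,28], [6,6,6,27,4,14,25], [6,6,6,27,6,15,24], [6,6,6,31,12,14,27],
  [6,6,6,31,12,21,22], [6,6,6,32,18,18,22], [6,6,7,19,12,13,13], [6,6,7,20,3,16,16],
  [6,6,7,20,6,14,17], [6,6,7,27,15,15,20], [6,6,8,20,12,14,14], [6,6,8,21,12,12,17],
  [6,6,9,9,4,7,13], [6,6,9,16,6,7,18], [6,6,9,19,8,15,15], [6,6,9,21,4,17,17],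
  [6,6,9,21,13,13,16], [6,6,9,24,10,10,23], [6,6,9,27,7,7,28], [6,6,9,28,6,15,26],
  [6,6,10,13,6,7,16], [6,6,10,16,6,14,14], [6,6,10,17,6,13,16], [6,6,10,27,6,9,28],
  [6,6,10,27,6,17,24], [6,6,10,30,12,12,28], [6,6,11,11,5,8,15], [6,6,11,11,8,9,13],
  [6,6,11,14,6,8,17], [6,6,11,15,3,3,20], [6,6,11,18,6,9,20], [6,6,11,18,6,15,16],
  [6,6,11,20,6,14,19], [6,6,11,20,9,16,16], [6,6,12,15,7,14,14], [6,6,12,19,6,10,21],
  [6,6,12,21,4,4,25], [6,6,12,21,8,8,23], [6,6,12,23,6,15,22], [6,6,12,24,2,2,28],
  [6,6,12,24,14,14,20], [6,6,12,28,6,8,30], [6,6,12,31,5,24,24], [6,6,13,13,1,3,20]]"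
  by (simp add: solution_def)

lemmas hits12 = hit_update[OF solutions12, unfolded hit_unfold]

lemma solutions13: "list_all solution
  [[6,6,14,17,6,11,20], [6,6,14,19,6,8,23], [6,6,14,21,6,12,23], [6,6,14,26,12,20,20],
  [6,6,15,15,1,11,20], [6,6,15,21,13,13,20], [6,6,15,22,6,13,24], [6,6,15,24,4,4,29],
  [6,6,15,24,16,16,19], [6,6,15,26,6,19,24], [6,6,15,29,16,21,21], [6,6,16,16,2,2,24],
  [6,6,16,16,6,8,22], [6,6,16,28,12,22,22], [6,6,17,17,5,7,24], [6,6,17,17,9,13,20],
  [6,6,17,17,13,15,16], [6,6,17,20,4,4,27], [6,6,18,18,8,16,20], [6,6,19,19,1,8,27],
  [6,6,19,19,3,16,23], [6,6,19,19,11,12,23], [6,6,19,19,13,15,20], [6,6,19,31,12,25,25],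
  [6,6,20,20,8,18,22], [6,6,20,20,10,14,24], [6,6,20,21,12,12,25], [6,6,20,27,7,24,24],
  [6,6,23,23,11,15,28], [6,6,23,23,12,19,25], [6,6,24,24,10,10,32], [6,6,24,24,16,22,22],
  [6,7,7,8,1,1,14], [6,7,7,20,5,5,22], [6,7,7,20,13,13,14], [6,8,8,22,6,6,24], [6,8,11,11,3,3,18],
  [6,8,18,18,6,6,26], [6,8,19,19,13,13,22], [6,8,25,25,15,15,30], [6,8,26,26,22,22,22],
  [6,9,9,16,2,15,15], [6,9,9,24,14,17,17], [6,9,9,28,10,21,21], [6,9,16,18,6,6,25],
  [6,10,10,14,4,4,20], [6,10,10,14,12,12,12], [6,10,11,16,6,6,21], [6,10,12,24,6,6,28],
  [6,10,16,16,6,6,24], [6,11,11,16,5,5,22], [6,11,11,16,13,13,14], [6,11,11,20,1,1,26],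
  [6,11,11,20,10,17,17], [6,11,11,28,2,23,23], [6,12,12,24,10,20,20], [6,12,14,15,6,6,23],
  [6,12,21,21,2,23,23], [6,12,21,21,17,17,22], [6,13,13,20,7,7,26], [6,13,13,20,14,17,17],
  [6,14,14,32,22,22,22], [6,14,15,24,6,6,31], [6,14,22,22,20,20,20], [6,15,15,24,2,23,23],
  [6,15,15,24,9,9,30], [6,15,15,24,17,17,22], [6,16,16,16,2,20,20], [6,16,16,16,8,8,26],
  [6,16,19,19,13,13,26], [6,16,23,23,10,25,25], [6,24,24,24,14,28,28], [7,7,7,7,4,6,12],
  [7,7,7,8,7,9,9], [7,7,7,9,4,4,14], [7,7,7,11,6,6,14], [7,7,7,12,7,11,11], [7,7,7,15,4,10,16],
  [7,7,7,17,6,12,16], [7,7,7,20,3,3,23], [7,7,7,21,14,14,14], [7,7,7,23,6,8,24],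
  [7,7,7,24,7,7,25], [7,7,7,25,12,12,22], [7,7,7,27,2,14,26], [7,7,7,27,10,10,26],
  [7,7,7,27,14,14,22], [7,7,7,28,7,21,21], [7,7,7,28,9,15,25], [7,7,8,15,7,13,13],
  [7,7,8,16,3,3,20], [7,7,8,18,1,1,22], [7,7,8,18,6,15,15], [7,7,8,21,11,11,19],
  [7,7,8,22,14,15,15], [7,7,8,24,4,19,19], [7,7,8,24,13,13,20], [7,7,8,27,5,5,29],
  [7,7,8,30,2,23,23], [7,7,8,30,7,22,23]]"
  by (simp add: solution_def)

lemmas hits13 = hit_update[OF solutions13, unfolded hit_unfold]

lemma solutions14: "list_all solution
  [[7,7,9,9,4,10,12], [7,7,9,11,10,10,10], [7,7,9,23,4,4,26], [7,7,9,25,2,20,20],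
  [7,7,10,10,3,8,15], [7,7,10,12,2,13,13], [7,7,10,12,3,3,18], [7,7,10,16,2,15,15],
  [7,7,10,24,7,14,23], [7,7,10,24,14,17,17], [7,7,10,24,15,15,18], [7,7,11,16,5,15,15],
  [7,7,11,25,14,18,18], [7,7,12,12,3,4,19], [7,7,12,12,7,9,16], [7,7,12,14,7,10,17],
  [7,7,12,14,10,13,13], [7,7,12,20,8,17,17], [7,7,12,23,7,19,19], [7,7,12,25,17,17,17],
  [7,7,12,26,6,21,21], [7,7,13,13,6,12,16], [7,7,13,15,2,2,22], [7,7,13,27,14,20,20],
  [7,7,13,27,16,16,22], [7,7,14,14,3,9,20], [7,7,14,16,10,15,15], [7,7,14,18,7,13,20],
  [7,7,15,15,2,12,20], [7,7,15,15,6,16,16], [7,7,15,16,5,5,23], [7,7,15,16,7,13,19],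
  [7,7,15,17,10,16,16], [7,7,15,17,12,12,18], [7,7,15,28,7,23,23], [7,7,16,16,3,5,24],
  [7,7,16,16,5,12,21], [7,7,16,17,3,3,25], [7,7,16,22,9,9,26], [7,7,16,27,5,23,23],
  [7,7,16,27,19,19,19], [7,7,16,30,14,23,23], [7,7,17,17,6,8,24], [7,7,18,18,1,4,27],
  [7,7,18,18,1,13,24], [7,7,18,18,7,11,24], [7,7,18,18,7,16,21], [7,7,18,18,11,15,20],
  [7,7,18,20,10,19,19], [7,7,19,27,6,24,24], [7,7,20,20,4,21,21], [7,7,20,24,4,23,23],
  [7,7,22,22,7,21,24], [7,7,23,23,2,24,24], [7,7,24,24,11,20,27], [7,7,25,27,22,22,22],
  [7,7,25,28,7,27,27], [7,7,27,27,14,24,28], [7,8,8,8,3,6,14], [7,8,8,8,6,6,13],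
  [7,8,8,16,6,6,19], [7,8,8,23,15,15,16], [7,8,8,24,14,14,19], [7,8,10,10,5,12,12],
  [7,8,11,15,7,7,19], [7,8,11,21,15,15,15], [7,8,12,25,7,7,28], [7,8,18,18,4,4,27],
  [7,8,20,20,12,12,25], [7,9,9,9,2,12,12], [7,9,9,11,2,2,18], [7,9,9,21,2,18,18],
  [7,9,9,25,16,16,18], [7,9,11,16,13,13,13], [7,9,11,24,7,7,27], [7,9,12,20,7,7,24],
  [7,9,17,17,4,4,26], [7,9,17,17,14,16,16], [7,9,23,23,6,24,24], [7,10,10,10,3,4,18],
  [7,10,10,10,6,12,13], [7,10,10,13,9,9,16], [7,10,10,20,1,18,18], [7,11,11,15,2,16,16],
  [7,11,11,15,4,4,22], [7,11,11,19,2,18,18], [7,11,11,20,9,9,23], [7,11,11,24,13,13,23],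
  [7,11,11,24,17,17,17], [7,11,11,29,18,18,22], [7,11,11,31,10,24,24], [7,11,17,17,6,6,26],
  [7,11,17,17,10,18,18], [7,11,19,21,18,18,18], [7,11,22,22,16,21,21], [7,12,12,12,2,6,21],
  [7,12,12,17,5,5,24], [7,12,12,24,6,6,29], [7,12,12,32,3,26,26], [7,12,15,15,3,3,25]]"
  by (simp add: solution_def)

lemmas hits14 = hit_update[OF solutions14, unfolded hit_unfold]

lemma solutions15: "list_all solution
  [[7,12,15,16,7,7,24], [7,12,22,22,3,24,24], [7,13,13,13,6,6,22], [7,13,13,16,3,3,25],
  [7,13,13,19,6,6,26], [7,13,13,19,10,18,18], [7,13,13,24,9,21,21], [7,13,15,23,18,18,18],
  [7,14,14,14,5,6,24], [7,14,14,14,12,13,18], [7,14,14,16,6,6,25], [7,14,14,24,12,12,27],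
  [7,15,15,15,2,12,24], [7,15,15,15,12,16,18], [7,15,16,16,8,19,19], [7,15,20,20,4,23,23],
  [7,15,21,21,2,24,24], [7,16,16,16,4,15,24], [7,16,16,16,12,12,23], [7,16,16,16,13,18,18],
  [7,16,22,22,11,24,24], [7,16,22,22,18,18,25], [7,19,19,19,18,18,22], [7,20,20,20,5,18,30],
  [7,20,20,20,12,23,24], [7,20,20,20,14,18,27], [7,20,20,25,4,27,27], [7,23,23,23,22,24,24],
  [8,8,8,9,2,10,13], [8,8,8,10,2,12,12], [8,8,8,11,5,12,12], [8,8,8,13,6,6,17],
  [8,8,8,14,10,12,12], [8,8,8,15,5,14,14], [8,8,8,15,8,8,17], [8,8,8,17,6,11,18],
  [8,8,8,18,2,16,16], [8,8,8,18,4,4,22], [8,8,8,18,4,10,20], [8,8,8,19,2,15,18],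
  [8,8,8,19,3,12,20], [8,8,8,21,2,2,25], [8,8,8,21,2,10,23], [8,8,8,21,8,13,20],
  [8,8,8,21,11,16,16], [8,8,8,23,1,12,24], [8,8,8,23,6,18,19], [8,8,8,23,8,9,24],
  [8,8,8,24,16,16,16], [8,8,8,25,3,18,22], [8,8,8,25,12,12,23], [8,8,8,25,13,18,18],
  [8,8,8,26,12,18,20], [8,8,8,27,4,11,28], [8,8,8,27,7,14,26], [8,8,8,27,10,14,25],
  [8,8,8,27,11,20,20], [8,8,8,27,14,14,23], [8,8,8,29,6,6,31], [8,8,8,31,1,24,24],
  [8,8,8,32,8,24,24], [8,8,9,9,3,5,16], [8,8,9,17,11,11,16], [8,8,9,20,8,16,17],
  [8,8,9,25,16,17,17], [8,8,9,28,5,22,22], [8,8,10,22,8,18,18], [8,8,10,24,2,20,20],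
  [8,8,11,11,8,9,15], [8,8,11,13,9,9,16], [8,8,11,20,1,18,18], [8,8,11,20,8,12,21],
  [8,8,11,24,5,20,20], [8,8,11,24,8,19,20], [8,8,11,27,8,17,25], [8,8,11,27,16,19,19],
  [8,8,12,17,13,14,14], [8,8,12,19,2,2,25], [8,8,12,23,1,20,20], [8,8,13,13,4,15,15],
  [8,8,13,18,8,14,19], [8,8,13,20,6,6,25], [8,8,13,20,7,18,18], [8,8,13,21,9,9,24],
  [8,8,13,27,1,1,32], [8,8,13,27,8,11,29], [8,8,13,27,11,11,28], [8,8,15,15,1,1,24],
  [8,8,15,15,3,13,20], [8,8,15,15,4,11,21], [8,8,15,24,10,10,27], [8,8,15,31,8,25,25],
  [8,8,16,17,5,18,18], [8,8,16,18,4,4,26], [8,8,17,17,3,16,21], [8,8,17,20,13,18,18],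
  [8,8,17,23,8,21,21], [8,8,18,18,10,10,24], [8,8,18,32,20,20,26], [8,8,19,19,7,15,24]]"
  by (simp add: solution_def)

lemmas hits15 = hit_update[OF solutions15, unfolded hit_unfold]

text \<open>Contains \<open>[9,9,9,9,6,12,12]\<close> and \<open>[9,9,9,12,9,9,15]\<close>, which
  expel 6 and 15 from a class with 9 and 12.\<close>

lemma solutions16: "list_all solution
  [[8,8,19,19,9,12,25], [8,8,19,19,15,15,20], [8,8,20,21,1,22,22], [8,8,20,27,8,13,32],
  [8,8,21,21,5,16,27], [8,8,23,23,9,9,32], [8,8,23,24,14,14,29], [8,9,9,9,3,3,17],
  [8,9,9,10,1,1,18], [8,9,9,20,5,5,24], [8,9,9,26,17,17,18], [8,9,10,18,8,8,21],
  [8,9,16,16,3,18,18], [8,9,16,16,4,4,25], [8,9,16,16,8,8,23], [8,9,19,19,11,11,25],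
  [8,9,19,19,17,17,17], [8,10,10,15,8,8,19], [8,10,10,18,14,14,14], [8,10,10,27,4,4,31],
  [8,10,10,27,5,22,22], [8,10,12,12,8,8,18], [8,10,14,27,8,8,31], [8,10,20,20,12,12,26],
  [8,11,11,16,9,9,20], [8,11,11,21,3,3,27], [8,11,11,21,5,19,19], [8,11,13,13,9,9,19],
  [8,11,13,27,19,19,19], [8,11,21,21,3,23,23], [8,11,21,21,13,13,27], [8,12,12,17,10,10,21],
  [8,12,12,22,6,20,20], [8,12,12,23,9,20,20], [8,12,12,25,3,22,22], [8,12,12,26,8,8,30],
  [8,12,12,29,15,22,22], [8,12,14,20,8,8,26], [8,12,25,25,21,21,24], [8,13,13,13,11,15,15],
  [8,13,13,18,2,19,19], [8,13,13,18,5,5,26], [8,13,13,18,11,11,22], [8,13,18,18,9,20,20],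
  [8,13,19,27,21,21,21], [8,13,25,25,5,27,27], [8,14,14,15,13,16,16], [8,14,14,30,2,26,26],
  [8,14,19,19,10,21,21], [8,14,29,29,22,27,27], [8,15,15,18,9,9,26], [8,15,15,25,9,23,23],
  [8,15,16,16,6,6,27], [8,16,16,19,17,18,18], [8,16,16,21,7,22,22], [8,16,16,21,14,14,25],
  [8,16,19,19,3,3,32], [8,16,31,31,27,27,28], [8,17,17,17,7,21,21], [8,17,17,21,19,19,19],
  [8,18,18,20,12,22,22], [8,18,18,21,1,24,24], [8,18,20,20,12,12,30], [8,18,20,20,16,16,26],
  [8,18,22,22,2,26,26], [8,18,23,23,14,25,25], [8,19,19,19,9,21,25], [8,20,20,27,5,28,28],
  [8,20,20,30,14,28,28], [8,21,29,29,27,27,27], [9,9,9,9,2,8,16], [9,9,9,9,6,12,12],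
  [9,9,9,9,8,8,14], [9,9,9,11,2,6,18], [9,9,9,12,1,5,19], [9,9,9,12,7,7,17], [9,9,9,12,7,13,13],
  [9,9,9,12,9,9,15], [9,9,9,15,2,8,20], [9,9,9,15,4,14,16], [9,9,9,16,7,15,15],
  [9,9,9,17,8,12,18], [9,9,9,20,3,3,25], [9,9,9,20,9,11,21], [9,9,9,21,2,2,26],
  [9,9,9,21,6,18,18], [9,9,9,21,10,10,22], [9,9,9,23,12,12,22], [9,9,9,24,11,13,23],
  [9,9,9,25,6,16,24], [9,9,9,25,12,18,20], [9,9,9,27,2,22,22], [9,9,9,27,6,6,30],
  [9,9,9,27,10,14,26], [9,9,9,27,18,18,18], [9,9,10,10,4,11,15], [9,9,10,14,9,11,16],
  [9,9,10,18,9,12,19], [9,9,10,20,13,13,18], [9,9,10,28,9,17,26]]"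
  by (simp add: solution_def)

lemmas hits16 = hit_update[OF solutions16, unfolded hit_unfold]

lemma solutions17: "list_all solution
  [[9,9,11,11,2,12,16], [9,9,11,11,4,8,18], [9,9,11,13,8,8,18], [9,9,11,16,7,7,21],
  [9,9,11,16,9,13,17], [9,9,11,28,3,23,23], [9,9,11,28,9,19,25], [9,9,12,12,5,5,20],
  [9,9,12,12,5,8,19], [9,9,12,21,13,17,17], [9,9,12,26,10,21,21], [9,9,13,13,10,12,16],
  [9,9,13,15,6,6,22], [9,9,13,16,3,17,17], [9,9,13,20,1,1,27], [9,9,13,21,12,12,22],
  [9,9,13,24,5,21,21], [9,9,14,14,3,4,23], [9,9,14,14,3,16,17], [9,9,14,16,6,17,17],
  [9,9,14,20,6,19,19], [9,9,14,24,9,18,23], [9,9,14,32,18,23,23], [9,9,15,15,4,14,20],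
  [9,9,15,16,9,11,21], [9,9,15,19,6,6,26], [9,9,15,19,10,18,18], [9,9,15,24,9,21,21],
  [9,9,16,16,7,7,24], [9,9,16,16,8,13,21], [9,9,16,20,11,11,24], [9,9,16,22,1,1,30],
  [9,9,16,22,9,14,25], [9,9,16,22,17,17,18], [9,9,16,23,15,19,19], [9,9,16,27,9,15,29],
  [9,9,17,17,4,18,20], [9,9,17,17,8,10,24], [9,9,17,17,12,14,20], [9,9,17,29,18,22,22],
  [9,9,18,18,1,5,28], [9,9,18,18,4,13,25], [9,9,18,18,5,16,23], [9,9,18,18,7,19,20],
  [9,9,18,18,8,11,25], [9,9,18,18,11,17,20], [9,9,18,20,2,21,21], [9,9,18,24,2,23,23],
  [9,9,18,24,17,17,22], [9,9,20,20,5,19,24], [9,9,20,20,9,16,25], [9,9,20,22,9,17,26],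
  [9,9,20,22,18,19,19], [9,9,21,21,2,16,28], [9,9,21,23,18,18,22], [9,9,21,24,11,23,23],
  [9,9,22,22,11,15,28], [9,9,22,22,12,19,25], [9,9,23,23,6,20,28], [9,9,24,24,8,25,25],
  [9,9,24,24,16,23,23], [9,9,25,25,8,18,32], [9,9,25,25,16,16,30], [9,9,27,27,14,20,32],
  [9,9,28,28,9,25,32], [9,10,10,10,2,4,19], [9,10,10,10,2,11,16], [9,10,10,11,1,1,20],
  [9,10,10,11,8,13,13], [9,10,10,16,2,2,23], [9,10,10,19,11,11,20], [9,10,10,20,14,14,17],
  [9,10,10,21,12,17,17], [9,10,14,19,9,9,24], [9,11,11,13,2,2,22], [9,11,11,15,6,16,16],
  [9,11,11,16,1,17,17], [9,11,11,16,5,5,23], [9,11,11,17,8,8,22], [9,11,11,17,10,16,16],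
  [9,11,11,17,12,12,18], [9,11,11,19,2,2,26], [9,11,11,19,6,18,18], [9,11,12,21,9,9,25],
  [9,11,14,14,4,17,17], [9,11,15,15,2,18,18], [9,11,15,24,9,9,29], [9,11,16,25,19,19,19],
  [9,11,18,18,15,15,20], [9,11,25,25,22,22,22], [9,11,31,31,18,30,30], [9,12,12,12,1,16,16],
  [9,12,12,12,2,5,22], [9,12,12,20,11,18,18], [9,12,12,28,1,24,24], [9,12,16,16,2,2,27],
  [9,12,17,18,9,9,26], [9,12,18,18,4,4,29], [9,12,18,18,16,16,19], [9,13,13,13,2,10,22]]"
  by (simp add: solution_def)

lemmas hits17 = hit_update[OF solutions17, unfolded hit_unfold]

lemma solutions18: "list_all solution
  [[9,13,13,13,14,14,14], [9,13,13,16,15,15,15], [9,13,13,17,4,4,26], [9,13,18,18,4,21,21],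
  [9,13,19,19,18,18,18], [9,13,21,21,18,18,22], [9,13,26,26,12,27,27], [9,14,14,16,10,10,23],
  [9,14,14,19,16,17,17], [9,14,14,20,15,18,18], [9,14,14,20,16,16,19], [9,14,14,28,17,22,22],
  [9,15,15,15,4,16,22], [9,15,15,16,9,9,25], [9,15,15,21,18,18,18], [9,15,15,24,7,23,23],
  [9,15,15,25,2,24,24], [9,15,16,16,11,11,24], [9,15,16,21,9,9,29], [9,15,21,21,16,16,26],
  [9,15,24,24,20,23,23], [9,16,16,16,1,8,28], [9,16,16,16,2,2,29], [9,16,16,16,2,13,26],
  [9,16,16,16,4,7,28], [9,16,16,16,7,20,20], [9,16,16,23,19,19,20], [9,16,16,28,15,24,24],
  [9,16,16,32,7,28,28], [9,16,19,19,1,23,23], [9,16,20,20,13,22,22], [9,16,24,24,18,18,29],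
  [9,16,25,25,23,23,23], [9,16,26,26,11,28,28], [9,17,17,17,4,16,26], [9,17,17,23,6,24,24],
  [9,17,17,25,20,20,22], [9,17,17,27,6,26,26], [9,18,18,18,4,14,29], [9,18,18,18,4,19,26],
  [9,18,18,18,11,16,26], [9,18,18,18,13,20,22], [9,18,18,20,12,12,29], [9,19,19,19,14,22,22],
  [9,19,19,28,23,23,23], [9,19,21,21,18,18,26], [9,20,20,20,1,16,32], [9,20,20,20,11,22,26],
  [9,20,23,23,17,17,31], [9,23,23,23,10,28,28], [9,23,23,23,20,22,28], [9,24,24,24,3,30,30],
  [9,24,24,24,22,22,29], [10,10,10,11,4,9,18], [10,10,10,13,1,12,18], [10,10,10,13,6,12,17],
  [10,10,10,13,8,9,18], [10,10,10,13,10,12,15], [10,10,10,15,10,13,16], [10,10,10,16,6,6,22],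
  [10,10,10,17,2,12,21], [10,10,10,17,3,16,18], [10,10,10,19,2,9,24], [10,10,10,19,6,7,24],
  [10,10,10,19,9,16,18], [10,10,10,22,8,12,24], [10,10,10,24,10,10,26], [10,10,10,27,2,8,31],
  [10,10,10,27,7,14,28], [10,10,10,27,16,17,22], [10,10,10,30,20,20,20], [10,10,10,32,10,18,30],
  [10,10,10,32,18,18,26], [10,10,11,11,3,12,17], [10,10,11,18,10,16,17], [10,10,12,13,1,16,16],
  [10,10,12,13,6,6,21], [10,10,12,15,8,8,21], [10,10,12,17,11,16,16], [10,10,12,25,1,22,22],
  [10,10,12,25,13,20,20], [10,10,13,13,4,9,21], [10,10,13,15,3,3,24], [10,10,13,15,4,17,17],
  [10,10,13,20,11,18,18], [10,10,14,17,10,12,21], [10,10,14,24,18,18,18], [10,10,15,15,3,4,25],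
  [10,10,16,16,8,18,18], [10,10,16,19,12,12,23], [10,10,17,17,3,12,25], [10,10,17,17,9,11,24],
  [10,10,19,19,15,16,21], [10,10,20,20,10,18,24], [10,10,22,22,4,24,24], [10,11,11,12,1,1,22],
  [10,11,11,12,6,15,15], [10,11,11,12,9,9,18], [10,11,11,24,6,21,21], [10,11,11,24,14,19,19]]"
  by (simp add: solution_def)

lemmas hits18 = hit_update[OF solutions18, unfolded hit_unfold]

lemma solutions19: "list_all solution
  [[10,12,13,13,2,17,17], [10,12,13,13,7,7,22], [10,12,17,17,13,13,22], [10,12,25,25,6,27,27],
  [10,13,13,16,3,3,26], [10,14,14,14,12,12,20], [10,14,14,18,4,20,20], [10,14,16,30,22,22,22],
  [10,18,18,18,12,12,28], [10,18,20,20,10,10,32], [10,22,22,22,20,24,24], [11,11,11,11,4,12,18],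
  [11,11,11,11,12,12,14], [11,11,11,12,13,13,13], [11,11,11,15,2,10,22], [11,11,11,15,14,14,14],
  [11,11,11,16,13,15,15], [11,11,11,17,2,18,18], [11,11,11,19,2,12,24], [11,11,11,21,2,20,20],
  [11,11,11,21,8,8,26], [11,11,11,24,7,7,29], [11,11,11,24,11,17,23], [11,11,11,31,18,18,26],
  [11,11,12,17,15,15,15], [11,11,12,19,3,3,27], [11,11,12,20,8,19,19], [11,11,12,24,11,20,21],
  [11,11,14,14,3,7,24], [11,11,14,32,2,27,27], [11,11,15,15,8,12,22], [11,11,15,16,7,7,25],
  [11,11,15,20,17,17,17], [11,11,16,18,10,19,19], [11,11,16,21,7,7,29], [11,11,16,27,13,23,23],
  [11,11,17,21,2,22,22], [11,11,17,21,18,18,18], [11,11,18,18,5,9,28], [11,11,18,18,11,12,25],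
  [11,11,19,19,8,18,24], [11,11,19,20,11,21,21], [11,11,19,23,18,18,22], [11,11,19,24,11,23,23],
  [11,11,20,27,11,25,25], [11,11,21,21,18,20,20], [11,11,22,22,12,15,29], [11,11,24,24,12,25,25],
  [11,11,24,28,12,27,27], [11,12,12,12,2,15,18], [11,12,22,22,9,24,24], [11,12,23,23,21,21,21],
  [11,13,13,13,4,6,24], [11,13,13,15,2,2,26], [11,13,13,15,6,18,18], [11,13,13,17,10,18,18],
  [11,13,13,27,16,16,26], [11,15,15,16,7,7,27], [11,15,15,20,11,11,27], [11,16,16,16,6,18,23],
  [11,16,16,16,9,18,22], [11,16,25,25,13,27,27], [11,17,17,28,5,27,27], [11,20,20,20,13,24,24],
  [11,24,24,24,7,30,30], [11,25,25,25,14,30,30], [12,12,12,12,8,16,16], [12,12,12,13,3,4,24],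
  [12,12,12,13,6,6,23], [12,12,12,15,2,13,22], [12,12,12,15,3,18,18], [12,12,12,15,4,4,25],
  [12,12,12,15,8,8,23], [12,12,12,16,12,12,20], [12,12,12,17,3,6,26], [12,12,12,21,4,4,29],
  [12,12,12,21,15,18,18], [12,12,12,21,16,16,19], [12,12,12,23,6,14,27], [12,12,12,23,6,21,22],
  [12,12,12,23,14,18,21], [12,12,12,25,9,20,24], [12,12,12,25,15,16,24], [12,12,12,27,3,24,24],
  [12,12,12,27,6,15,30], [12,12,12,27,14,17,26], [12,12,12,27,19,20,20], [12,12,12,28,8,24,24],
  [12,12,12,29,11,24,24], [12,12,12,29,12,20,27], [12,12,12,29,16,21,24], [12,12,12,29,18,18,25],
  [12,12,13,13,3,16,19], [12,12,13,13,4,9,23], [12,12,13,13,9,16,17], [12,12,13,24,6,6,31],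
  [12,12,13,28,16,16,27], [12,12,15,15,4,19,19], [12,12,15,15,7,8,25], [12,12,15,15,11,16,19]]"
  by (simp add: solution_def)

lemmas hits19 = hit_update[OF solutions19, unfolded hit_unfold]

lemma solutions20: "list_all solution
  [[12,12,15,15,13,13,20], [12,12,15,17,3,3,28], [12,12,15,20,6,6,29], [12,12,15,24,8,8,31],
  [12,12,15,24,17,20,20], [12,12,16,17,14,14,21], [12,12,16,27,11,24,24], [12,12,17,17,9,16,23],
  [12,12,17,17,12,19,19], [12,12,17,25,12,23,23], [12,12,18,18,8,14,26], [12,12,19,20,9,22,22],
  [12,12,20,32,12,28,28], [12,12,23,23,12,19,29], [12,12,27,27,8,29,29], [12,12,27,27,19,19,32],
  [12,13,13,14,10,17,17], [12,13,13,25,15,21,21], [12,13,13,29,21,21,21], [12,14,14,15,4,4,27],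
  [12,14,14,16,2,2,28], [12,14,14,17,5,20,20], [12,14,14,17,10,10,25], [12,14,14,25,3,24,24],
  [12,14,17,17,3,3,30], [12,14,17,17,6,21,21], [12,15,15,22,14,21,21], [12,15,15,27,21,21,21],
  [12,15,18,18,14,14,25], [12,15,21,21,1,25,25], [12,15,24,24,13,26,26], [12,16,16,19,12,12,27],
  [12,16,23,23,21,21,24], [12,17,17,20,8,23,23], [12,17,17,22,18,21,21], [12,17,20,20,9,24,24],
  [12,19,29,29,27,27,27], [12,20,20,28,24,24,24], [12,23,23,23,7,29,29], [13,13,13,13,6,8,24],
  [13,13,13,16,3,15,23], [13,13,13,20,5,21,21], [13,13,13,24,5,23,23], [13,13,13,24,11,11,29],
  [13,13,13,24,13,17,25], [13,13,13,24,19,19,19], [13,13,13,25,18,18,22], [13,13,13,27,14,16,28],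
  [13,13,13,29,14,24,24], [13,13,14,14,8,15,21], [13,13,14,14,12,15,19], [13,13,15,15,4,14,24],
  [13,13,15,21,6,22,22], [13,13,15,24,9,23,23], [13,13,15,25,6,24,24], [13,13,15,25,12,12,30],
  [13,13,16,16,7,15,24], [13,13,16,16,15,15,20], [13,13,16,17,1,21,21], [13,13,16,27,13,23,25],
  [13,13,16,27,21,21,21], [13,13,17,17,4,18,24], [13,13,17,17,12,14,24], [13,13,18,18,1,16,27],
  [13,13,18,18,9,11,28], [13,13,18,20,2,23,23], [13,13,20,20,16,21,21], [13,13,20,28,8,27,27],
  [13,13,27,28,13,29,29], [13,14,14,14,12,17,18], [13,14,14,15,8,19,19], [13,14,14,24,16,16,25],
  [13,15,15,15,14,18,18], [13,15,17,17,6,6,30], [13,15,17,17,18,18,18], [13,15,23,23,22,22,22],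
  [13,16,16,16,3,12,28], [13,16,16,16,17,18,18], [13,16,16,21,8,23,23], [13,16,16,21,13,13,28],
  [13,16,23,23,5,27,27], [13,17,17,24,21,21,21], [13,18,18,18,6,9,32], [13,18,18,18,9,22,24],
  [13,20,20,20,8,24,27], [14,14,14,14,8,12,24], [14,14,14,15,14,16,19], [14,14,14,16,14,18,18],
  [14,14,14,17,2,12,27], [14,14,14,18,8,8,28], [14,14,14,19,7,18,24], [14,14,14,22,12,12,28],
  [14,14,14,24,14,22,22], [14,14,14,25,14,21,24], [14,14,14,29,9,18,32], [14,14,15,15,3,7,28],
  [14,14,15,15,7,8,27], [14,14,15,15,9,19,20], [14,14,15,20,12,12,27], [14,14,16,21,8,8,31]]"
  by (simp add: solution_def)

lemmas hits20 = hit_update[OF solutions20, unfolded hit_unfold]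

lemma solutions21: "list_all solution
  [[14,14,17,17,4,15,27], [14,14,17,29,8,27,27], [14,14,18,18,8,20,24], [14,14,18,22,20,20,20],
  [14,14,19,19,3,9,32], [14,14,20,21,9,24,24], [14,14,25,27,8,29,29], [14,14,30,30,12,32,32],
  [14,16,16,16,6,12,28], [14,16,16,16,12,12,26], [14,16,20,20,10,24,24], [14,17,17,28,10,27,27],
  [14,18,18,18,4,24,24], [14,19,19,24,6,27,27], [15,15,15,15,4,10,28], [15,15,15,15,4,20,22],
  [15,15,15,15,10,20,20], [15,15,15,16,7,21,21], [15,15,15,17,12,12,26], [15,15,15,20,15,15,25],
  [15,15,15,23,6,12,32], [15,15,15,24,1,25,25], [15,15,15,24,19,19,23], [15,15,15,25,12,16,30],
  [15,15,15,28,1,27,27], [15,15,16,16,8,13,27], [15,15,17,20,9,23,23], [15,15,24,24,12,27,27],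
  [15,15,24,24,17,17,32], [15,16,16,16,5,22,22], [15,16,16,17,12,21,21], [15,16,16,17,15,15,24],
  [15,16,19,19,17,17,25], [15,18,18,19,15,15,28], [15,20,20,28,3,30,30], [15,21,21,21,14,26,26],
  [15,21,21,21,18,18,30], [15,21,21,24,19,19,31], [16,16,16,17,6,11,30], [16,16,16,18,4,20,26],
  [16,16,16,19,12,12,29], [16,16,16,20,4,24,24], [16,16,16,22,10,24,24], [16,16,16,27,16,20,29],
  [16,16,16,27,22,22,23], [16,16,17,17,9,15,28], [16,16,19,19,8,21,27], [16,16,19,19,15,15,28],
  [16,16,19,21,16,23,23], [16,16,19,29,16,27,27], [16,16,21,21,12,25,25], [16,16,26,26,8,30,30],
  [16,17,17,17,9,9,31], [16,17,17,25,1,27,27], [16,18,18,23,9,26,26], [16,19,19,22,2,27,27],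
  [16,19,19,26,14,27,27], [16,21,21,21,11,27,27], [17,17,17,17,2,24,24], [17,17,17,24,17,23,25],
  [17,17,18,18,9,19,28], [17,17,18,18,16,21,23], [17,17,18,18,17,19,24], [17,18,18,18,6,21,28],
  [17,19,25,25,10,30,30], [17,20,20,20,18,18,29], [18,18,18,18,4,16,32], [18,18,18,18,12,24,24],
  [18,18,18,18,16,16,28], [18,18,18,19,9,24,26], [18,18,18,24,18,18,30], [18,18,18,32,14,30,30],
  [18,18,19,19,20,21,23], [18,18,23,23,9,28,29], [18,18,30,30,20,32,32], [18,19,19,20,14,25,25],
  [18,20,23,23,10,29,29], [18,26,26,26,28,28,28], [19,19,19,19,12,20,30], [19,19,19,20,5,27,27],
  [19,19,20,20,8,27,27], [19,19,21,21,6,28,28], [19,19,24,24,19,27,28], [20,20,20,21,20,20,29],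
  [20,20,20,25,5,30,30], [20,20,20,26,20,24,30], [20,20,20,31,19,30,30], [20,20,23,23,20,27,27],
  [20,20,24,26,2,32,32], [21,21,21,21,14,28,28], [21,21,21,24,21,27,27], [21,21,21,24,23,23,29],
  [21,21,21,27,2,32,32], [21,21,22,22,21,25,28], [21,21,23,31,18,32,32], [21,21,24,24,25,25,28],
  [21,23,23,23,26,26,26], [21,24,24,24,11,32,32], [22,22,22,22,24,24,28], [22,22,22,24,26,26,26]]"
  by (simp add: solution_def)

lemmas hits21 = hit_update[OF solutions21, unfolded hit_unfold]

text \<open>Eight times \<open>4*3^2 = 2^2 + 2*4^2\<close>. Since \<open>{1..31}\<close> can be
  coloured, some branches have to reach 32.\<close>

lemma solutions22: "list_all solution
  [[24,24,24,24,16,32,32]]"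
  by (simp add: solution_def)

lemmas hits22 = hit_update[OF solutions22, unfolded hit_unfold]

lemmas hit_simps =
  hits1 hits2 hits3 hits4 hits5 hits6 hits7 hits8 hits9 hits10 hits11 hits12 hits13 hits14 hits15
  hits16 hits17 hits18 hits19 hits20 hits21 hits22

section \<open>The certificate for \<open>{1..32}\<close>\<close>

text \<open>The letters name the classes, in their current order, in which \<open>v\<close> does not complete a solution
  at once.\<close>

abbreviation "X v \<equiv> Split v Hit Hit Hit"
abbreviation "A v t \<equiv> Split v t Hit Hit"
abbreviation "B v t \<equiv> Split v Hit t Hit"
abbreviation "C v t \<equiv> Split v Hit Hit t"
abbreviation "AB v t u \<equiv> Split v t u Hit"
abbreviation "AC v t u \<equiv> Split v t Hit u"
abbreviation "BC v t u \<equiv> Split v Hit t u"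

section \<open>Positions with 9 and 12 in one class\<close>

text \<open>A position gives the marked numbers of the three classes on entry, front class first;
  here \<open>{16,18} / {3,6,15} / {9,12}\<close>. The front class excludes 14 by
  \<open>3*14^2 + 16^2 = 14^2 + 2*18^2\<close>.\<close>

definition cert1 :: cert where
  "cert1 =
  BC 14 (BC 5 (AC 11 (Split 7 (BC 22 (C 2 (A 24 (C 17 (B 10 (C 8 (X 26)))))) (AC 24 (C 26 (B 2 (C
  17 (C 10 (X 20))))) (B 2 (C 27 (C 23 (C 13 (B 1 (X 10)))))))) (C 1 (A 28 (AC 2 (C 4 (C 24 (X
  25))) (B 8 (B 4 (C 17 (C 19 (X 26)))))))) (C 1 (C 2 (X 8)))) (BC 7 (C 13 (Split 20 (C 21 (C 25
  (B 2 (X 4)))) (Split 2 (C 4 (C 8 (B 10 (A 17 (X 21))))) (C 26 (AC 1 (B 21 (B 28 (C 24 (B 4 (X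
  8))))) (B 22 (X 24)))) (B 4 (C 10 (C 22 (X 24))))) (B 21 (B 28 (C 32 (B 4 (B 8 (C 2 (X
  24))))))))) (B 28 (AC 2 (C 4 (C 10 (B 13 (C 17 (B 1 (X 19)))))) (B 8 (B 4 (B 19 (C 20 (X
  25))))))))) (C 4 (C 10 (B 20 (C 22 (C 2 (B 24 (X 26)))))))) (BC 8 (BC 2 (C 24 (AC 13 (B 10 (C 4
  (B 22 (X 28)))) (B 7 (B 5 (C 25 (C 17 (C 11 (C 1 (X 26))))))))) (Split 22 (C 10 (C 20 (B 26 (C
  24 (C 13 (C 7 (X 17))))))) (C 4 (B 7 (B 1 (C 10 (C 5 (B 11 (A 13 (C 24 (B 23 (X 28)))))))))) (B
  24 (C 19 (C 17 (B 7 (C 13 (X 28)))))))) (C 11 (C 1 (AB 2 (B 4 (B 10 (B 17 (C 13 (X 20))))) (C 7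
  (B 13 (C 17 (C 28 (C 19 (C 10 (B 4 (X 5))))))))))))"

text \<open>Position \<open>{9,12,18} / {3,6,15} / {}\<close>. The front class excludes 24 by
  \<open>4*18^2 = 12^2 + 2*24^2\<close>.\<close>

definition cert2 :: cert where
  "cert2 =
  BC 24 (C 27 (Split 16 (Split 13 (Split 11 (BC 23 (Split 7 (C 25 (C 20 (X 29))) (C 19 (A 22 (C 25
  (C 14 (X 20))))) (C 5 (A 8 (B 19 (X 22))))) (BC 22 (C 5 (C 7 (C 17 (B 4 (X 10))))) (B 26 (C 28
  (B 8 (X 14)))))) (BC 20 (C 23 (AB 8 (B 14 (C 7 (B 1 (X 10)))) (B 19 (C 28 (C 22 (B 5 (X
  29))))))) (C 25 (B 23 (B 8 (C 1 (C 4 (B 5 (C 17 (C 2 (B 7 (X 19))))))))))) (BC 14 (AC 7 (C 20 (B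
  10 (C 22 (B 25 (C 4 (C 8 (B 23 (C 17 (C 1 (A 19 (X 26))))))))))) (B 25 (B 4 (B 10 (C 8 (B 5 (A
  17 (B 22 (C 23 (C 20 (C 2 (X 26)))))))))))) (C 4 (A 25 (C 5 (C 7 (X 29))))))) (Split 20 (BC 4 (C
  29 (B 5 (X 25))) (C 8 (A 11 (B 19 (B 2 (X 17)))))) (C 23 (B 5 (A 22 (B 8 (B 4 (X 25)))))) (C 5
  (A 25 (B 4 (B 8 (B 22 (B 19 (C 1 (B 2 (X 17)))))))))) (BC 19 (C 7 (B 2 (A 5 (C 29 (C 20 (C 11 (B
  21 (B 4 (X 14))))))))) (C 2 (A 11 (Split 20 (B 5 (C 4 (X 23))) (B 5 (C 22 (C 21 (C 4 (X 25)))))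
  (B 1 (C 22 (B 8 (C 17 (X 26)))))))))) (BC 20 (AC 5 (C 2 (B 7 (B 19 (B 4 (B 8 (X 25)))))) (B 4 (B
  19 (B 8 (X 29))))) (C 5 (A 25 (A 29 (AB 4 (B 8 (B 7 (X 22))) (B 8 (B 7 (C 13 (C 11 (X
  17)))))))))) (Split 23 (BC 1 (AC 19 (C 22 (B 4 (X 20))) (B 2 (A 26 (B 8 (B 4 (X 7)))))) (C 2 (A
  4 (A 8 (X 25))))) (C 20 (B 1 (A 2 (AB 4 (B 14 (A 19 (B 7 (X 28)))) (B 8 (X 14)))))) (C 2 (A 8 (A
  19 (B 7 (X 20)))))))) (Split 16 (BC 8 (Split 20 (BC 2 (C 14 (B 4 (A 5 (X 11)))) (C 26 (B 10 (X
  22)))) (C 4 (B 14 (C 2 (C 10 (C 7 (A 13 (C 11 (X 25)))))))) (C 10 (AC 2 (B 4 (X 14)) (B 5 (C 17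
  (B 14 (B 4 (B 7 (C 22 (X 25)))))))))) (BC 2 (C 17 (B 11 (C 7 (C 14 (C 13 (C 19 (X 20))))))) (C
  10 (AB 1 (B 17 (B 11 (C 26 (C 22 (B 25 (C 21 (B 5 (X 27)))))))) (B 4 (A 17 (C 5 (X 20))))))))
  (BC 2 (C 14 (B 4 (AB 8 (B 20 (C 17 (X 22))) (B 1 (A 7 (C 17 (C 22 (X 23)))))))) (C 4 (A 8 (X
  20)))) (BC 7 (C 25 (BC 11 (C 29 (B 20 (B 27 (BC 4 (C 5 (A 8 (B 2 (C 10 (X 14))))) (C 5 (X
  19)))))) (C 20 (AC 2 (C 14 (B 8 (X 13))) (B 13 (B 8 (B 4 (A 14 (C 10 (X 22)))))))))) (C 2 (C 17
  (B 8 (A 11 (A 13 (C 25 (C 20 (X 29))))))))))"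

text \<open>Position \<open>{5,15} / {3,6} / {9,12}\<close>. The triple 5, 10, 15 excludes 10 from
  the front class.\<close>

definition cert3 :: cert where
  "cert3 =
  BC 10 (BC 8 (Split 16 (Split 7 (BC 13 (C 1 (AB 17 (B 19 (X 24)) (B 4 (A 20 (B 11 (B 18 (B 22 (X
  24)))))))) (C 11 (B 4 (B 14 (B 17 (B 19 (X 24))))))) (C 13 (C 11 (B 4 (C 14 (X 19))))) (C 1 (X
  17))) (C 14 (C 13 (B 1 (A 2 (C 4 (X 11)))))) (C 20 (AC 4 (C 7 (C 11 (X 14))) (C 21 (C 19 (B 13
  (B 14 (X 17)))))))) (BC 16 (C 14 (C 13 (C 11 (C 4 (X 7))))) (AC 4 (C 7 (C 1 (A 13 (C 11 (C 14 (X
  21)))))) (B 7 (C 11 (C 13 (B 20 (C 18 (C 19 (X 23)))))))))) (AC 20 (BC 14 (BC 8 (BC 4 (C 7 (C 1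
  (B 11 (C 16 (B 18 (C 13 (B 19 (X 21)))))))) (C 2 (AC 1 (B 16 (C 11 (B 13 (X 19)))) (C 11 (B 13
  (C 16 (X 19))))))) (BC 1 (C 4 (B 2 (C 16 (C 13 (B 11 (X 19)))))) (B 11 (B 13 (C 18 (C 16 (X
  19))))))) (AC 16 (BC 18 (C 2 (AC 8 (C 13 (X 19)) (B 1 (A 11 (C 4 (B 7 (X 24))))))) (BC 19 (Split
  24 (BC 8 (BC 1 (C 17 (C 2 (A 7 (B 11 (X 13))))) (B 7 (X 11))) (C 2 (A 7 (X 23)))) (C 7 (B 2 (A
  13 (C 8 (B 1 (X 11)))))) (C 7 (A 22 (B 23 (C 4 (C 8 (X 17))))))) (Split 8 (B 2 (AC 1 (C 25 (B 7
  (B 17 (B 4 (X 11))))) (B 4 (X 23)))) (C 1 (X 17)) (C 1 (A 11 (C 4 (B 2 (X 22)))))))) (BC 22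
  (Split 7 (C 13 (C 11 (B 17 (B 2 (X 21))))) (C 23 (A 24 (C 4 (C 8 (X 17))))) (B 13 (C 4 (B 1 (B 8
  (X 17)))))) (Split 7 (BC 1 (C 2 (X 8)) (C 8 (X 17))) (C 23 (A 24 (C 11 (C 2 (C 1 (C 4 (C 8 (X
  18)))))))) (C 19 (X 21)))))) (Split 7 (Split 14 (BC 4 (C 2 (A 8 (B 13 (X 19)))) (C 21 (B 17 (B 8
  (A 13 (B 1 (X 11))))))) (C 13 (B 16 (B 1 (C 8 (B 4 (B 11 (B 18 (C 2 (X 28))))))))) (C 13 (C 11
  (C 16 (C 18 (B 1 (X 2))))))) (BC 8 (C 1 (A 4 (B 11 (X 16)))) (C 17 (B 13 (B 1 (X 2))))) (BC 24
  (Split 14 (BC 11 (C 4 (C 8 (X 16))) (C 2 (A 18 (B 17 (C 19 (C 13 (B 16 (C 8 (X 22))))))))) (C 11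
  (C 13 (B 8 (B 4 (C 16 (X 18)))))) (C 11 (C 8 (C 4 (X 16))))) (Split 4 (BC 17 (C 8 (B 2 (B 18 (B
  16 (X 22))))) (C 23 (B 16 (B 2 (B 18 (X 28)))))) (BC 11 (C 14 (X 17)) (C 16 (C 18 (C 22 (B 1 (B
  8 (X 13))))))) (C 18 (AC 8 (C 1 (C 16 (B 11 (X 14)))) (B 2 (C 17 (X 23)))))))))"

text \<open>Position \<open>{3,5,6} / {15} / {9,12}\<close>. The front class excludes 7 by
  \<open>3^2 + 2*5^2 + 7^2 = 3*6^2\<close>.\<close>

definition cert4 :: cert where
  "cert4 =
  BC 7 (AC 4 (Split 8 (BC 16 (AC 11 (C 13 (C 14 (B 1 (A 2 (X 22))))) (B 13 (B 17 (C 18 (A 19 (B 2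
  (X 10))))))) (C 20 (AB 11 (B 13 (B 17 (C 1 (X 14)))) (B 13 (C 1 (B 14 (C 17 (X 18)))))))) (Split
  16 (BC 18 (C 22 (B 23 (B 2 (A 13 (X 20))))) (C 24 (B 1 (B 10 (B 2 (X 20)))))) (C 1 (A 10 (AC 24
  (C 25 (C 18 (C 21 (C 22 (X 28))))) (C 18 (C 13 (B 11 (B 2 (X 22)))))))) (C 1 (B 11 (B 2 (B 10 (C
  13 (X 17))))))) (BC 14 (BC 1 (Split 18 (C 10 (AC 16 (B 2 (C 13 (X 24))) (B 24 (B 17 (X 27)))))
  (C 16 (AC 2 (C 11 (X 13)) (B 10 (X 17)))) (C 16 (C 24 (X 25)))) (C 2 (B 10 (B 11 (C 13 (A 16 (BC
  18 (C 20 (X 24)) (C 19 (X 25))))))))) (Split 24 (BC 18 (C 17 (B 1 (B 23 (B 28 (C 25 (BC 2 (B 20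
  (C 10 (B 13 (X 16)))) (B 10 (B 16 (C 11 (X 20)))))))))) (C 22 (B 23 (B 2 (B 17 (C 10 (X
  20))))))) (C 23 (C 25 (B 18 (B 28 (C 20 (A 22 (B 2 (B 13 (C 16 (X 21)))))))))) (B 16 (C 1 (AC 2
  (C 10 (B 18 (C 20 (C 17 (X 23))))) (B 10 (B 18 (B 11 (X 22)))))))))) (BC 8 (Split 24 (C 16 (AC
  13 (C 17 (X 19)) (B 19 (C 11 (X 21))))) (C 17 (AC 16 (B 13 (C 18 (B 1 (B 2 (C 14 (B 11 (X
  20))))))) (B 23 (B 28 (B 18 (B 25 (C 20 (C 1 (B 21 (B 11 (X 27))))))))))) (C 17 (C 23 (C 16 (BC
  10 (B 19 (C 13 (C 2 (X 21)))) (C 2 (A 18 (C 14 (C 1 (X 28)))))))))) (Split 24 (C 16 (C 21 (B 13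
  (B 10 (B 2 (X 22)))))) (Split 14 (C 2 (A 11 (C 16 (B 13 (X 22))))) (C 23 (B 28 (B 18 (AC 1 (C 20
  (A 21 (B 11 (C 13 (X 16))))) (B 2 (A 20 (B 11 (X 21)))))))) (B 11 (C 21 (C 16 (X 19))))) (C 1 (B
  2 (AB 10 (C 16 (C 18 (X 23))) (C 14 (B 23 (B 17 (C 13 (X 22))))))))))) (BC 8 (C 1 (A 2 (A 11 (C
  4 (B 10 (C 14 (AB 13 (B 16 (X 17)) (B 16 (C 20 (C 21 (B 22 (B 23 (B 18 (B 24 (C 19 (X
  29)))))))))))))))) (C 17 (AB 1 (B 2 (B 13 (B 16 (C 24 (C 18 (C 20 (X 25))))))) (B 16 (B 2 (X
  13))))))"

text \<open>Position \<open>{3,4} / {6,15} / {9,12}\<close>. The triple 3, 4, 5 excludes 5 from the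
  front class.\<close>

definition cert5 :: cert where
  "cert5 =
  BC 5 (AC 2 (C 1 (BC 16 (C 7 (AC 8 (C 13 (C 11 (C 14 (C 10 (B 18 (B 17 (X 21))))))) (B 14 (B 10
  (B 18 (B 13 (X 21))))))) (BC 11 (Split 24 (BC 13 (B 8 (C 18 (C 17 (X 20)))) (C 14 (B 18 (B 17 (C
  10 (X 20)))))) (B 20 (B 10 (C 14 (B 13 (B 18 (X 19)))))) (C 7 (A 14 (C 10 (X 18))))) (BC 14
  (Split 24 (C 8 (A 10 (C 18 (B 20 (C 19 (B 13 (C 21 (B 22 (B 23 (C 26 (X 30))))))))))) (B 7 (C 10
  (X 18))) (C 18 (C 17 (C 10 (A 20 (X 22)))))) (C 8 (C 13 (AB 7 (C 24 (C 18 (X 22))) (C 20 (B 10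
  (B 18 (B 22 (C 23 (X 24))))))))))))) (AC 10 (BC 8 (C 11 (C 16 (C 1 (X 13)))) (C 11 (Split 24 (B
  7 (A 18 (C 27 (B 20 (B 14 (C 13 (X 22))))))) (C 20 (B 14 (C 16 (X 18)))) (C 14 (AC 18 (C 22 (C
  16 (B 13 (C 7 (X 20))))) (C 13 (C 16 (X 19)))))))) (AB 20 (Split 14 (C 7 (C 24 (B 17 (A 18 (B 13
  (C 19 (B 8 (X 16)))))))) (C 13 (AB 1 (C 8 (B 11 (C 18 (C 16 (C 7 (X 24)))))) (C 16 (C 11 (B 8 (B
  7 (X 24))))))) (C 13 (C 11 (C 7 (C 8 (X 16)))))) (BC 16 (Split 14 (C 7 (C 24 (B 17 (A 18 (B 19
  (C 8 (X 13))))))) (C 11 (C 8 (B 13 (C 18 (B 1 (A 24 (C 7 (A 17 (X 25))))))))) (C 11 (C 13 (B 8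
  (C 18 (C 19 (B 22 (X 27)))))))) (C 7 (BC 1 (C 14 (C 8 (X 13))) (C 11 (X 18)))))))) (AC 2 (C 1
  (AC 8 (C 10 (A 11 (X 14))) (B 11 (A 13 (B 10 (A 14 (B 7 (C 18 (C 16 (X 24)))))))))) (Split 11
  (AC 13 (AC 10 (B 1 (C 16 (A 20 (C 19 (C 24 (C 18 (B 14 (X 22)))))))) (AC 16 (C 18 (AB 8 (B 14 (C
  17 (X 24))) (C 24 (C 19 (B 1 (C 7 (X 20))))))) (C 1 (C 8 (A 20 (C 18 (B 14 (C 7 (X 24)))))))))
  (C 8 (B 14 (AC 10 (C 7 (B 16 (B 19 (C 18 (B 17 (X 20)))))) (B 16 (B 19 (B 20 (B 7 (C 18 (X
  24)))))))))) (B 1 (C 8 (B 13 (B 10 (A 14 (B 7 (C 18 (B 17 (C 20 (X 24)))))))))) (C 8 (C 16 (C 7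
  (X 10))))))"

text \<open>Position \<open>{4,9,12} / {6,15} / {3}\<close>. The triple 4, 8, 12 excludes 8 from the
  front class.\<close>

definition cert6 :: cert where
  "cert6 =
  BC 8 (AC 16 (C 5 (AC 1 (C 2 (B 7 (A 10 (C 11 (C 17 (C 13 (A 14 (C 19 (C 20 (C 18 (X
  24))))))))))) (B 2 (A 7 (B 10 (BC 14 (B 17 (X 24)) (C 18 (C 17 (B 19 (B 11 (X 22))))))))))) (AC
  2 (Split 24 (C 17 (BC 5 (C 7 (C 13 (B 14 (X 21)))) (B 14 (C 11 (X 19))))) (C 1 (A 13 (BC 7 (C 5
  (A 19 (B 11 (X 21)))) (C 11 (B 5 (C 10 (B 14 (X 18)))))))) (B 17 (AC 18 (C 5 (C 11 (X 14))) (C 1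
  (C 7 (C 5 (C 11 (X 14)))))))) (B 10 (AC 11 (C 7 (C 13 (X 17))) (B 1 (A 5 (C 17 (B 13 (C 7 (B 14
  (X 19))))))))))) (AC 5 (BC 7 (C 1 (A 11 (C 14 (B 10 (B 13 (X 16)))))) (B 16 (BC 24 (C 1 (BC 2 (B
  21 (B 13 (C 17 (C 18 (C 10 (B 20 (C 22 (X 27)))))))) (B 18 (C 10 (A 11 (B 20 (C 17 (X 27))))))))
  (Split 14 (C 11 (A 13 (C 18 (B 17 (C 20 (B 1 (X 10))))))) (C 18 (A 23 (C 13 (B 11 (B 20 (B 1 (X
  21))))))) (B 11 (X 21)))))) (Split 7 (B 16 (C 24 (BC 28 (C 18 (Split 13 (B 17 (C 11 (B 14 (X
  22)))) (BC 2 (B 17 (C 20 (B 1 (B 10 (C 14 (B 11 (X 21))))))) (C 11 (X 14))) (C 19 (C 11 (B 14 (B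
  21 (C 1 (C 17 (X 20))))))))) (C 23 (C 21 (C 22 (C 13 (C 2 (C 11 (X 14)))))))))) (AC 20 (B 16 (C
  13 (B 23 (AC 11 (C 14 (C 10 (C 21 (C 2 (C 17 (X 24)))))) (C 10 (A 24 (B 22 (C 2 (X 14)))))))))
  (AB 10 (AC 1 (BC 14 (AC 16 (C 18 (X 24)) (C 22 (B 21 (C 2 (B 17 (X 24)))))) (C 11 (B 16 (B 2 (X
  17))))) (C 2 (AB 14 (BC 13 (C 18 (B 17 (X 24))) (C 18 (A 21 (X 23)))) (B 16 (C 11 (X 13))))))
  (BC 1 (C 2 (A 11 (B 14 (BC 16 (C 13 (A 17 (C 18 (A 21 (B 22 (A 24 (C 23 (X 28)))))))) (C 24 (B
  17 (X 26))))))) (C 2 (B 11 (B 14 (BC 16 (C 13 (A 17 (C 18 (C 21 (X 25))))) (C 24 (B 17 (C 18 (X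
  25))))))))))) (C 10 (C 1 (B 2 (B 13 (B 14 (A 16 (C 18 (C 24 (C 17 (X 27))))))))))))"

text \<open>Position \<open>{4,9,12} / {3,15} / {6}\<close>: as before \<open>cert6\<close>, but
  with 3 and 6 exchanged.\<close>

definition cert7 :: cert where
  "cert7 =
  BC 8 (AC 5 (BC 7 (C 1 (A 10 (A 11 (C 13 (X 16))))) (AC 11 (C 14 (Split 24 (B 17 (AB 1 (B 10 (B
  19 (A 20 (C 2 (X 26))))) (B 10 (X 20)))) (B 17 (B 10 (X 19))) (C 13 (A 16 (C 10 (B 1 (A 17 (C 2
  (B 19 (A 20 (C 21 (X 26)))))))))))) (B 14 (AB 1 (C 13 (X 16)) (B 20 (C 13 (B 2 (X 16)))))))) (AC
  17 (AB 16 (Split 2 (BC 13 (C 1 (A 20 (B 24 (B 10 (B 14 (X 18)))))) (C 14 (C 11 (B 21 (B 7 (C 26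
  (C 22 (B 10 (X 24))))))))) (Split 14 (C 22 (C 23 (B 24 (B 11 (X 18))))) (C 1 (C 7 (B 10 (X
  18)))) (C 13 (BC 10 (B 1 (A 20 (B 26 (C 21 (A 24 (C 19 (X 27))))))) (B 7 (C 22 (B 19 (C 24 (C 18
  (X 27))))))))) (BC 7 (C 10 (B 1 (C 22 (AC 14 (B 19 (A 20 (C 24 (X 27)))) (C 11 (C 18 (B 19 (A 20
  (C 24 (X 27)))))))))) (C 1 (A 10 (X 11))))) (BC 7 (C 24 (Split 2 (C 10 (C 18 (AB 11 (B 14 (C 22
  (B 21 (X 26)))) (B 14 (C 13 (X 21)))))) (B 1 (C 18 (B 10 (C 14 (X 20))))) (C 18 (AC 26 (C 20 (B
  1 (B 13 (C 11 (X 19))))) (C 10 (C 22 (C 13 (X 19)))))))) (C 1 (C 2 (B 13 (B 10 (C 24 (C 20 (C 14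
  (B 11 (C 22 (X 26)))))))))))) (BC 16 (Split 10 (C 7 (A 24 (B 19 (AC 1 (C 11 (X 13)) (C 2 (X
  21)))))) (BC 2 (C 18 (C 1 (X 20))) (AC 7 (C 18 (B 14 (X 24))) (B 14 (B 18 (X 24))))) (B 7 (A 19
  (Split 11 (B 24 (C 27 (C 18 (B 1 (X 13))))) (C 14 (C 13 (B 22 (C 21 (A 24 (B 18 (X 27))))))) (C
  14 (C 13 (X 18))))))) (C 7 (A 24 (B 23 (C 14 (B 10 (C 13 (X 19)))))))))) (BC 2 (C 10 (C 5 (AB 16
  (C 22 (C 23 (AB 24 (B 26 (C 13 (C 7 (B 1 (X 11))))) (C 20 (C 26 (B 17 (X 21))))))) (B 7 (C 13
  (BC 1 (C 11 (X 14)) (C 17 (B 21 (B 19 (A 23 (B 14 (X 18)))))))))))) (Split 24 (Split 13 (B 5 (C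
  10 (B 16 (B 23 (C 22 (C 7 (C 14 (X 19)))))))) (C 17 (C 7 (C 5 (A 16 (X 23))))) (C 14 (A 19 (C 23
  (B 7 (B 16 (X 21))))))) (B 16 (C 13 (C 7 (C 23 (B 21 (B 14 (B 5 (X 19)))))))) (AC 26 (B 10 (C 5
  (A 22 (B 16 (BC 1 (C 20 (B 7 (B 13 (C 11 (X 14))))) (C 7 (X 20))))))) (C 16 (A 18 (B 25 (A 28
  (AC 1 (C 14 (B 7 (X 13))) (B 7 (B 13 (B 14 (C 11 (X 22)))))))))))))"

text \<open>Position \<open>{4,6} / {3,15} / {9,12}\<close>. The front class excludes 8 by
  \<open>4*6^2 = 4^2 + 2*8^2\<close>.\<close>

definition cert8 :: cert where
  "cert8 =
  BC 8 (AC 2 (Split 5 (BC 7 (AC 11 (C 14 (B 13 (B 10 (B 20 (B 26 (C 21 (X 24))))))) (B 13 (B 10 (B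
  14 (B 1 (X 20)))))) (C 1 (A 11 (B 10 (B 13 (A 17 (B 26 (C 21 (X 24))))))))) (C 1 (C 7 (C 16 (AC
  10 (C 13 (C 14 (B 18 (X 24)))) (B 18 (B 20 (C 14 (C 19 (C 21 (X 26)))))))))) (C 13 (A 20 (AC 7
  (C 10 (C 22 (C 19 (B 1 (X 26))))) (B 10 (C 1 (X 16))))))) (Split 5 (BC 20 (C 10 (A 13 (B 1 (X
  7)))) (AC 10 (C 14 (B 11 (B 1 (X 13)))) (B 1 (A 7 (X 22))))) (C 7 (AC 10 (C 1 (B 17 (AB 11 (B 14
  (C 13 (X 24))) (C 13 (C 14 (X 16)))))) (B 11 (B 14 (B 20 (C 18 (BC 1 (C 19 (B 17 (C 22 (A 24 (C
  21 (X 26)))))) (C 16 (C 21 (X 24)))))))))) (C 7 (C 1 (C 16 (A 17 (Split 14 (B 10 (X 11)) (B 13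
  (B 10 (C 18 (C 20 (B 21 (A 24 (C 22 (X 27)))))))) (C 22 (C 13 (B 10 (X 21))))))))))) (AC 2 (BC
  16 (Split 20 (C 10 (B 5 (B 7 (A 14 (AC 1 (C 24 (C 17 (C 18 (C 21 (X 27))))) (C 17 (B 21 (A 22 (C
  27 (B 18 (B 24 (C 13 (X 25))))))))))))) (BC 10 (C 14 (A 18 (A 22 (C 24 (C 17 (B 13 (C 21 (C 5 (X
  7))))))))) (C 5 (B 7 (B 22 (C 11 (C 1 (B 17 (X 24)))))))) (B 5 (B 7 (C 1 (C 10 (B 13 (C 14 (C 11
  (X 21))))))))) (C 7 (B 5 (B 10 (C 1 (A 13 (B 19 (C 18 (B 14 (B 11 (X 17))))))))))) (AC 7 (C 16
  (Split 24 (C 18 (C 10 (B 20 (X 22)))) (B 14 (C 18 (B 17 (B 19 (X 25))))) (B 18 (C 14 (X 28)))))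
  (BC 5 (AB 14 (Split 18 (B 16 (AC 19 (C 26 (A 27 (B 13 (B 10 (X 24))))) (B 25 (B 13 (X 24))))) (C
  20 (B 23 (B 24 (AB 1 (B 11 (B 10 (X 22))) (B 10 (B 22 (B 11 (X 13)))))))) (C 10 (B 1 (A 13 (B 20
  (C 16 (X 21))))))) (AB 16 (C 1 (A 10 (C 18 (B 20 (C 19 (X 26)))))) (C 21 (AC 1 (C 13 (B 10 (X
  22))) (B 13 (C 11 (C 17 (X 20)))))))) (BC 10 (C 13 (B 16 (B 14 (C 18 (X 24))))) (C 20 (AB 13 (B
  14 (B 11 (C 22 (A 24 (X 26))))) (B 16 (B 14 (C 18 (X 24))))))))))"

text \<open>Position \<open>{3,15} / {6} / {9,12}\<close>. If 4 joins 3, the triple 3, 4, 5 applies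
  next.\<close>

definition cert9 :: cert where
  "cert9 =
  Split 4 (BC 5 (AC 2 (C 1 (Split 14 (C 8 (C 11 (A 13 (B 16 (B 7 (AC 17 (C 24 (C 18 (X 22))) (B 19
  (X 24)))))))) (C 16 (B 7 (C 11 (C 13 (B 8 (A 10 (C 18 (B 17 (B 20 (X 22)))))))))) (C 16 (C 13 (B
  11 (B 24 (C 18 (B 20 (C 27 (C 28 (B 7 (X 19)))))))))))) (BC 7 (BC 10 (BC 11 (Split 13 (C 8
  (Split 16 (C 14 (C 24 (B 17 (X 19)))) (B 18 (C 22 (C 27 (C 21 (C 19 (X 25)))))) (C 1 (C 22 (B 18
  (A 20 (B 21 (A 27 (C 24 (X 30)))))))))) (C 14 (C 16 (B 22 (B 17 (C 24 (B 19 (C 8 (B 18 (C 20 (X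
  30)))))))))) (B 8 (C 1 (B 17 (X 18))))) (C 8 (C 13 (B 14 (X 16))))) (BC 22 (C 20 (Split 11 (C 13
  (C 14 (X 16))) (C 16 (C 13 (X 14))) (B 13 (C 14 (X 16))))) (Split 14 (C 20 (AC 8 (C 13 (B 11 (X
  24))) (B 13 (A 19 (B 24 (X 27)))))) (C 16 (AC 17 (C 24 (B 11 (A 13 (C 18 (C 8 (C 20 (A 25 (X
  27)))))))) (B 24 (X 25)))) (C 16 (C 11 (X 13)))))) (BC 16 (C 1 (AC 8 (C 11 (C 10 (C 13 (B 17 (B
  19 (X 22)))))) (B 11 (C 10 (B 13 (A 20 (C 21 (C 14 (B 22 (X 24)))))))))) (AC 17 (Split 18 (C 13
  (C 14 (C 11 (C 10 (C 8 (X 22)))))) (C 22 (AC 1 (C 13 (B 10 (C 8 (C 11 (X 24))))) (B 24 (B 10 (X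
  13))))) (B 13 (C 10 (C 8 (C 14 (X 20)))))) (B 1 (Split 18 (C 24 (C 14 (B 11 (C 8 (X 20))))) (B
  13 (C 10 (B 8 (X 11)))) (B 24 (C 10 (C 8 (C 11 (A 13 (X 20)))))))))))) (Split 8 (C 2 (AC 10 (C
  16 (B 7 (A 11 (X 14)))) (B 20 (B 16 (B 7 (A 11 (X 14))))))) (C 13 (AB 10 (C 1 (B 2 (A 11 (C 16
  (B 7 (C 14 (B 19 (B 24 (B 17 (C 18 (X 22))))))))))) (B 7 (A 20 (C 22 (B 2 (A 19 (B 1 (B 11 (C 16
  (C 14 (X 24)))))))))))) (B 2 (B 1 (C 10 (A 11 (B 7 (X 13)))))))) cert8 cert7"

text \<open>Position \<open>{3,6} / {9,12} / {}\<close>. The triple 9, 12, 15 keeps 15 out of the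
  second class.\<close>

definition cert10 :: cert where
  "cert10 =
  AC 15 (BC 18 cert2 (Split 16 cert1 (BC 7 (AC 5 (AC 25 (C 4 (AB 2 (C 10 (C 8 (C 13 (B 14 (C 11 (X
  21)))))) (C 8 (C 1 (A 17 (X 24)))))) (Split 24 (B 4 (Split 17 (B 2 (C 14 (B 10 (C 11 (A 19 (C 20
  (X 22))))))) (B 2 (C 19 (X 23))) (B 8 (A 11 (AC 2 (B 20 (C 14 (C 13 (B 10 (X 26))))) (C 14 (C 20
  (C 1 (X 10))))))))) (Split 14 (B 2 (A 4 (C 1 (X 10)))) (C 11 (C 8 (A 13 (C 20 (C 10 (B 1 (C 17
  (B 2 (X 4))))))))) (C 11 (AC 19 (B 1 (C 4 (A 8 (X 17)))) (C 13 (A 21 (X 22)))))) (BC 19 (C 4 (A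
  8 (X 22))) (C 22 (AB 2 (B 8 (A 17 (X 27))) (C 11 (X 23))))))) (B 4 (AC 10 (C 13 (C 17 (C 19 (X
  20)))) (B 13 (A 20 (C 8 (X 14))))))) (C 2 (A 5 (AC 8 (C 17 (B 11 (A 13 (C 25 (C 22 (B 10 (C 4 (X
  24)))))))) (B 11 (X 17)))))) (BC 1 (AC 4 (AC 20 (Split 2 (C 8 (C 10 (B 13 (C 7 (C 11 (X 17))))))
  (BC 8 (C 22 (C 10 (B 13 (C 7 (X 21))))) (C 11 (C 10 (C 13 (C 7 (C 17 (X 24))))))) (B 7 (A 8 (C
  26 (AC 10 (C 13 (A 21 (X 24))) (B 22 (B 24 (B 13 (X 27))))))))) (Split 13 (B 7 (C 27 (B 2 (X
  19)))) (C 2 (B 11 (B 10 (B 5 (C 27 (B 7 (C 14 (X 24)))))))) (C 10 (X 11)))) (B 8 (AC 22 (B 7 (C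
  10 (C 5 (A 13 (AB 2 (B 14 (C 11 (B 17 (X 19)))) (C 11 (C 20 (C 17 (B 19 (C 21 (X 24)))))))))))
  (B 2 (B 14 (B 13 (C 19 (B 11 (X 23))))))))) (C 4 (A 7 (A 8 (Split 13 (C 10 (C 20 (C 5 (C 14 (C
  23 (X 26)))))) (B 20 (C 2 (C 21 (X 22)))) (B 10 (C 14 (X 20)))))))))) (Split 5 cert3 cert4 (BC
  20 (C 10 (Split 1 (B 4 (A 7 (C 8 (B 13 (X 16))))) (B 7 (B 4 (C 11 (B 2 (A 8 (X 13)))))) (BC 13
  (C 7 (A 16 (Split 24 (B 4 (B 2 (X 11))) (B 19 (C 8 (C 14 (C 2 (B 11 (B 4 (C 17 (X 28)))))))) (C
  21 (A 25 (C 4 (C 8 (B 18 (X 32))))))))) (C 16 (B 2 (C 8 (B 14 (C 11 (B 4 (X 7)))))))))) (AC 7 (C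
  13 (AB 10 (C 16 (B 1 (C 8 (B 4 (C 2 (X 14)))))) (B 4 (C 8 (B 2 (X 11)))))) (Split 8 (B 13 (C 17
  (BC 10 (C 4 (C 16 (B 19 (X 23)))) (B 1 (C 19 (C 16 (X 24))))))) (B 4 (A 10 (C 2 (B 1 (C 11 (X
  13)))))) (BC 14 (C 11 (B 16 (B 10 (B 4 (C 18 (X 24)))))) (AC 16 (C 2 (A 4 (X 10))) (AB 2 (B 10
  (B 4 (B 11 (B 19 (C 18 (X 27)))))) (B 4 (B 10 (C 21 (X 24)))))))))))"

section \<open>Positions with 8 and 12 in one class and 9 in another\<close>

text \<open>Position \<open>{8,12,15} / {5} / {4,9,16}\<close>. The front class excludes 1 by
  \<open>2*1^2 + 2*12^2 = 1^2 + 8^2 + 15^2\<close>.\<close>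

definition cert11 :: cert where
  "cert11 =
  BC 1 (Split 24 (C 17 (A 23 (C 25 (C 31 (Split 18 (C 7 (B 20 (BC 3 (C 6 (C 2 (B 11 (X 14)))) (C
  10 (X 11))))) (BC 6 (C 14 (B 3 (X 7))) (C 14 (X 21))) (B 20 (C 10 (B 13 (X 14))))))))) (BC 18
  (AC 31 (Split 2 (Split 7 (C 17 (A 23 (C 25 (AB 6 (C 26 (C 11 (X 20))) (C 14 (X 21)))))) (C 25 (C
  19 (B 17 (B 23 (B 11 (C 3 (X 10))))))) (B 14 (A 28 (B 17 (C 26 (B 6 (X 13))))))) (C 3 (C 6 (A 13
  (B 10 (B 21 (B 23 (B 14 (X 28)))))))) (C 3 (C 11 (C 27 (C 22 (C 6 (C 10 (A 14 (X 26))))))))) (B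
  17 (A 23 (Split 2 (BC 6 (C 3 (B 11 (B 20 (B 13 (X 19))))) (C 13 (B 3 (B 11 (B 7 (X 19)))))) (C
  21 (C 27 (B 11 (B 3 (C 10 (B 13 (B 7 (X 14)))))))) (C 21 (AC 3 (C 6 (A 10 (X 13))) (B 14 (X
  28)))))))) (C 14 (A 27 (A 28 (C 21 (B 10 (X 32))))))) (B 23 (AC 20 (Split 3 (C 7 (AC 2 (C 19 (C
  13 (B 6 (X 10)))) (C 11 (X 17)))) (C 27 (C 21 (B 13 (B 2 (X 11))))) (BC 10 (C 18 (B 11 (C 21 (X
  27)))) (C 2 (A 18 (C 7 (X 25)))))) (B 25 (Split 2 (BC 3 (C 18 (B 6 (C 11 (A 14 (B 21 (B 27 (X
  28))))))) (C 6 (X 18))) (B 7 (AC 3 (C 6 (B 10 (X 18))) (B 6 (X 22)))) (B 10 (A 17 (C 3 (B 11 (B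
  6 (B 14 (C 18 (C 21 (C 27 (X 28))))))))))))))) (C 17 (Split 24 (C 3 (C 2 (C 11 (C 7 (X 13)))))
  (B 23 (AC 25 (AC 13 (Split 18 (C 3 (C 2 (X 10))) (BC 3 (C 14 (B 10 (A 11 (B 7 (B 6 (B 20 (B 21
  (C 22 (X 26))))))))) (C 10 (A 11 (B 30 (B 27 (B 20 (X 28))))))) (B 3 (B 20 (BC 6 (C 22 (B 10 (X
  26))) (C 10 (X 30)))))) (B 7 (A 20 (B 3 (BC 2 (C 18 (C 21 (X 27))) (C 10 (B 18 (C 27 (X
  30))))))))) (B 7 (A 20 (B 3 (BC 2 (C 18 (X 21)) (C 10 (C 6 (X 30))))))))) (BC 18 (Split 2 (B 7
  (X 13)) (B 3 (A 7 (C 6 (B 10 (A 13 (B 19 (X 23))))))) (BC 20 (B 14 (B 23 (B 27 (C 22 (X 29)))))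
  (C 10 (A 13 (B 11 (B 7 (X 19))))))) (C 14 (A 27 (A 28 (C 10 (X 21))))))))"

text \<open>Position \<open>{5,8,12} / {4,9,16} / {}\<close>. The triple 5, 12, 13 excludes 13 from
  the front class.\<close>

definition cert12 :: cert where
  "cert12 =
  BC 13 (C 3 (Split 2 (C 1 (B 10 (A 15 (BC 20 (C 22 (B 26 (C 14 (C 11 (B 7 (X 21)))))) (B 7 (B 11
  (C 6 (B 18 (B 22 (X 26)))))))))) (B 11 (Split 24 (C 19 (B 15 (B 14 (B 10 (C 7 (C 20 (X 26)))))))
  (BC 7 (C 10 (B 1 (X 6))) (C 1 (A 10 (B 17 (B 15 (X 20)))))) (B 14 (B 15 (B 1 (A 6 (C 7 (X
  20)))))))) (B 1 (A 10 (C 17 (B 11 (B 7 (B 6 (C 15 (B 14 (X 20))))))))))) (AC 3 (Split 24 (BC 19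
  (Split 2 (BC 1 (C 17 (B 15 (B 7 (A 10 (B 11 (X 14)))))) (C 7 (A 15 (B 10 (B 6 (C 18 (X 20)))))))
  (C 17 (C 1 (C 15 (C 10 (B 11 (C 14 (A 26 (B 18 (C 6 (X 20)))))))))) (C 11 (X 29))) (BC 2 (Split
  7 (C 25 (C 23 (B 1 (C 15 (C 10 (C 14 (X 26))))))) (C 1 (A 14 (C 15 (C 10 (B 11 (C 20 (X
  26))))))) (C 1 (B 17 (C 15 (X 20))))) (Split 21 (C 25 (C 7 (X 28))) (C 7 (C 20 (B 15 (C 1 (A 10
  (B 6 (X 18))))))) (C 17 (B 1 (AB 7 (C 14 (X 15)) (C 27 (C 20 (C 10 (X 11)))))))))) (BC 18 (AC 14
  (C 23 (C 15 (A 25 (C 31 (C 1 (B 7 (X 20))))))) (Split 17 (B 11 (AC 1 (C 2 (X 10)) (B 2 (A 7 (X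
  15))))) (C 15 (B 7 (C 6 (X 20)))) (C 7 (A 15 (C 2 (X 23)))))) (C 14 (A 21 (X 28)))) (BC 23 (AC
  20 (C 7 (C 10 (C 2 (B 1 (C 17 (X 18)))))) (Split 18 (BC 6 (C 22 (B 10 (C 7 (C 1 (C 17 (X
  26)))))) (C 2 (A 10 (A 22 (B 15 (C 1 (C 7 (X 11)))))))) (B 25 (B 7 (C 15 (B 11 (C 14 (C 6 (X
  10))))))) (C 11 (AC 7 (C 10 (B 6 (X 14))) (B 10 (C 1 (B 15 (C 14 (B 19 (A 21 (C 26 (C 22 (X
  28))))))))))))) (C 25 (C 18 (B 11 (AC 7 (C 10 (B 6 (X 14))) (B 10 (C 1 (B 15 (C 14 (B 19 (B 20
  (B 17 (C 26 (C 22 (X 28)))))))))))))))) (B 11 (AC 2 (Split 24 (BC 17 (C 14 (C 15 (B 26 (C 20 (C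
  18 (C 1 (X 7))))))) (C 19 (B 20 (B 14 (C 7 (X 23)))))) (BC 20 (C 21 (B 15 (B 25 (B 23 (B 18 (B 6
  (B 1 (C 10 (X 26))))))))) (C 15 (AB 6 (B 18 (B 22 (X 23))) (C 14 (C 10 (X 22)))))) (Split 15 (B
  1 (A 6 (C 10 (X 18)))) (C 14 (B 18 (C 17 (B 1 (X 23))))) (C 14 (A 23 (AC 1 (B 18 (B 21 (X 28)))
  (B 7 (A 17 (C 18 (X 21))))))))) (B 1 (A 6 (C 10 (Split 14 (B 17 (C 24 (B 18 (X 21)))) (B 7 (C 15
  (X 20))) (C 18 (C 15 (X 24))))))))))"

text \<open>Position \<open>{5} / {4,9,16} / {8,12}\<close>. If 15 joins 5, the triple 5, 10, 15
  expels 10.\<close>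

definition cert13 :: cert where
  "cert13 =
  Split 15 (BC 10 (AC 20 (BC 24 (C 7 (B 1 (B 25 (C 17 (C 11 (C 14 (A 18 (B 2 (X 6))))))))) (C 18
  (AB 13 (C 14 (C 17 (X 19))) (C 19 (C 11 (X 14)))))) (Split 14 (BC 24 (C 2 (A 6 (A 26 (BC 1 (C 3
  (C 7 (A 13 (B 22 (B 17 (X 18)))))) (C 3 (C 11 (X 13))))))) (Split 3 (B 13 (C 17 (C 1 (X 2)))) (C
  7 (C 11 (A 13 (B 19 (B 2 (X 26)))))) (B 2 (A 6 (C 1 (A 18 (C 17 (X 26)))))))) (BC 7 (C 1 (A 17
  (B 24 (B 13 (X 18))))) (C 24 (B 18 (B 19 (B 13 (X 17)))))) (B 13 (C 11 (C 3 (C 6 (B 2 (A 7 (X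
  18))))))))) (BC 18 (Split 3 (C 6 (B 2 (BC 1 (C 7 (A 17 (X 20))) (C 7 (C 14 (C 13 (C 11 (X
  21)))))))) (C 19 (C 2 (AC 13 (B 14 (C 17 (A 20 (C 7 (B 22 (C 23 (X 24))))))) (C 20 (C 1 (B 6 (B
  11 (X 14)))))))) (B 2 (A 6 (C 1 (AB 11 (B 13 (C 14 (B 7 (C 17 (C 19 (X 22)))))) (B 13 (C 14 (B
  17 (B 19 (X 22)))))))))) (C 14 (BC 11 (B 2 (C 24 (B 22 (B 3 (B 1 (C 6 (X 19))))))) (C 13 (C 3 (B
  6 (B 2 (C 1 (X 22)))))))))) (BC 14 (AC 7 (Split 24 (C 22 (A 25 (B 23 (B 1 (C 2 (X 3)))))) (C 21
  (AC 3 (C 11 (A 25 (A 28 (C 27 (C 6 (X 18)))))) (B 20 (A 23 (B 1 (X 17)))))) (Split 6 (B 13 (A 22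
  (AC 18 (B 23 (X 25)) (C 21 (X 27))))) (B 13 (C 11 (B 3 (C 1 (B 2 (X 10)))))) (B 21 (C 25 (AB 3
  (B 23 (B 1 (X 17))) (B 11 (C 18 (B 27 (X 28))))))))) (B 1 (Split 21 (C 11 (C 10 (C 2 (X 6)))) (B
  17 (BC 24 (B 22 (A 25 (AC 18 (B 23 (C 2 (X 29))) (B 27 (X 28))))) (C 3 (C 11 (A 25 (A 28 (C 27
  (C 6 (X 18))))))))) (B 11 (C 6 (B 18 (B 19 (B 17 (C 2 (C 3 (X 28))))))))))) (AC 13 (C 1 (A 17 (C
  24 (B 11 (Split 18 (C 21 (B 7 (C 10 (C 2 (C 6 (B 3 (X 22))))))) (B 10 (C 3 (A 6 (B 20 (B 21 (X
  27)))))) (B 7 (A 25 (A 28 (B 21 (B 20 (B 3 (B 22 (C 6 (X 27)))))))))))))) (AC 24 (B 23 (B 25 (B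
  1 (X 7)))) (B 11 (AC 20 (C 3 (B 7 (B 21 (B 22 (A 25 (C 27 (C 6 (X 18)))))))) (AB 1 (B 3 (A 7 (C
  6 (X 10)))) (AC 2 (B 3 (C 6 (C 10 (A 19 (C 18 (B 22 (B 21 (X 27)))))))) (B 6 (X 10)))))))))
  cert11"

text \<open>Position \<open>{5,16} / {3,8,12} / {4,9}\<close>. The second class excludes 1 by
  \<open>2*3^2 + 2*8^2 = 2*1^2 + 12^2\<close>.\<close>

definition cert14 :: cert where
  "cert14 =
  AC 1 (AC 11 (BC 18 (BC 15 (C 10 (AC 2 (C 13 (A 17 (B 14 (C 19 (X 24))))) (B 14 (B 13 (A 17 (C 19
  (C 20 (X 24)))))))) (Split 21 (C 24 (C 17 (X 19))) (C 17 (C 24 (B 25 (B 27 (B 6 (B 10 (C 22 (B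
  14 (B 2 (X 26)))))))))) (C 17 (C 19 (B 2 (X 25)))))) (BC 27 (BC 21 (Split 10 (C 22 (C 25 (B 13
  (A 17 (B 6 (C 14 (X 19))))))) (C 6 (A 15 (AB 13 (C 20 (C 7 (B 23 (C 19 (X 22))))) (C 23 (C 22 (X
  26)))))) (C 6 (C 2 (B 15 (C 13 (X 20)))))) (C 28 (Split 13 (C 25 (C 19 (C 17 (X 20)))) (B 32 (C
  25 (B 20 (C 17 (C 6 (X 10)))))) (B 25 (C 24 (X 32)))))) (BC 24 (Split 2 (C 19 (B 21 (BC 6 (C 10
  (X 14)) (C 10 (B 15 (B 23 (X 30))))))) (C 6 (C 10 (C 14 (X 22)))) (C 6 (C 21 (B 15 (C 30 (C 29
  (C 20 (C 14 (X 25))))))))) (C 19 (C 25 (B 23 (BC 2 (C 15 (C 10 (X 17))) (C 15 (C 7 (X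
  21)))))))))) (Split 15 (Split 24 (BC 21 (C 2 (B 10 (B 14 (X 18)))) (C 25 (AB 18 (B 2 (B 10 (B 14
  (C 7 (X 27))))) (B 10 (A 17 (C 27 (B 6 (C 2 (X 14))))))))) (C 17 (A 23 (C 25 (C 19 (X 20))))) (C
  14 (C 18 (B 27 (AC 2 (C 20 (B 13 (B 21 (A 23 (C 6 (C 19 (B 7 (A 25 (X 28))))))))) (C 6 (C 10 (C
  21 (B 20 (B 13 (X 19))))))))))) (C 2 (C 10 (C 6 (C 7 (X 14))))) (C 2 (Split 25 (C 18 (C 24 (C 27
  (C 17 (C 20 (B 19 (X 28))))))) (C 21 (C 17 (B 18 (B 20 (C 24 (X 27)))))) (B 23 (C 24 (BC 14 (C
  18 (B 27 (C 13 (C 6 (X 20))))) (C 17 (B 18 (B 27 (C 7 (X 13)))))))))))) (BC 15 (AB 11 (C 7 (C 14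
  (B 10 (A 13 (B 20 (C 6 (C 17 (C 18 (X 22))))))))) (C 13 (B 20 (B 10 (C 14 (X 19)))))) (BC 2 (C
  10 (A 11 (Split 27 (B 18 (C 20 (C 13 (X 25)))) (B 18 (B 17 (C 14 (X 22)))) (C 21 (C 17 (B 18 (B
  19 (B 24 (B 30 (C 20 (X 25))))))))))) (AC 17 (AC 18 (B 7 (C 11 (X 13))) (AC 24 (B 11 (AC 27 (C
  20 (B 25 (C 13 (B 19 (C 7 (B 14 (B 6 (X 22)))))))) (C 21 (C 10 (A 30 (C 20 (X 25))))))) (C 27
  (AC 23 (B 7 (C 13 (X 22))) (C 20 (C 19 (B 7 (A 21 (C 22 (X 29)))))))))) (C 21 (C 28 (C 18 (B 10
  (A 27 (C 7 (C 11 (C 13 (X 14))))))))))))"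

text \<open>Position \<open>{3,16} / {4,9} / {8,12}\<close>. If 11 joins the front class, 7 is
  expelled by \<open>3^2 + 2*7^2 + 16^2 = 3*11^2\<close>.\<close>

definition cert15 :: cert where
  "cert15 =
  Split 11 (BC 7 (AC 13 (BC 19 (C 1 (A 5 (C 10 (C 2 (C 6 (B 18 (B 14 (C 20 (C 15 (B 24 (C 22 (X
  26)))))))))))) (Split 15 (C 1 (X 5)) (C 17 (C 14 (C 10 (B 20 (C 2 (X 6)))))) (B 14 (C 17 (BC 1
  (C 6 (B 5 (C 2 (C 10 (X 24))))) (C 5 (C 2 (C 10 (C 6 (C 18 (X 20))))))))))) (C 5 (B 1 (B 14 (C
  15 (C 17 (B 6 (C 2 (B 19 (X 21)))))))))) (AC 13 (BC 5 (C 1 (B 15 (B 6 (C 10 (C 2 (C 14 (C 20 (B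
  17 (X 21))))))))) (C 6 (Split 17 (B 15 (B 1 (C 10 (C 14 (X 18))))) (B 15 (C 25 (C 18 (X 20))))
  (C 20 (C 15 (B 14 (C 18 (C 10 (C 1 (X 24)))))))))) (BC 19 (AC 14 (BC 1 (C 5 (A 21 (C 2 (C 10 (C
  6 (X 15)))))) (C 5 (B 10 (C 6 (X 18))))) (C 17 (C 15 (B 20 (C 1 (B 2 (A 5 (B 10 (C 6 (X
  18)))))))))) (B 1 (C 5 (C 2 (C 10 (C 6 (C 15 (B 14 (C 20 (X 24)))))))))))) (BC 2 (BC 13 (C 1 (C
  7 (X 15))) (B 5 (Split 15 (BC 1 (C 7 (B 10 (B 6 (C 14 (B 18 (X 21)))))) (C 7 (B 6 (B 10 (B 22 (B
  20 (X 21))))))) (C 1 (C 7 (B 10 (C 6 (B 17 (X 24)))))) (C 1 (C 14 (C 21 (C 18 (X 24)))))))) (BC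
  10 (C 6 (AC 5 (C 7 (A 15 (X 18))) (B 7 (C 1 (B 13 (C 15 (X 20))))))) (Split 17 (B 5 (C 1 (C 7 (A
  13 (C 15 (C 14 (X 20))))))) (B 5 (C 15 (B 1 (B 6 (BC 14 (B 19 (C 18 (B 20 (B 21 (X 23))))) (C 13
  (C 18 (B 19 (X 24))))))))) (BC 5 (C 15 (B 13 (X 21))) (C 13 (C 6 (C 15 (C 14 (C 7 (B 1 (B 19 (C
  18 (B 20 (C 21 (X 23))))))))))))))) (BC 14 (AC 7 (Split 6 (C 5 (AC 1 (B 13 (C 15 (C 22 (B 21 (B
  2 (X 10)))))) (B 15 (B 10 (B 2 (A 18 (B 19 (X 20)))))))) (C 10 (A 18 (AC 1 (C 2 (B 13 (B 5 (C 15
  (X 17))))) (B 2 (X 13))))) (B 5 (B 13 (C 10 (A 15 (X 19)))))) (B 5 (Split 6 (C 1 (C 15 (B 23 (B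
  18 (C 21 (B 13 (X 25))))))) (B 13 (C 2 (AC 15 (C 17 (X 21)) (B 17 (B 18 (X 19)))))) (B 1 (C 2 (A
  18 (AB 10 (C 15 (X 17)) (C 19 (C 17 (X 20)))))))))) (C 7 (A 13 (B 5 (C 18 (C 6 (X 10)))))))"

text \<open>Position \<open>{16} / {4,9} / {8,12}\<close>. If 3 joins 9, the triple 3, 6, 9 expels
  6; if it joins 8 and 12, \<open>3^2 + 5^2 + 2*8^2 = 2*3^2 + 12^2\<close> expels 5.\<close>

definition cert16 :: cert where
  "cert16 =
  Split 3 cert15 (BC 6 (AC 2 (BC 14 (C 18 (B 10 (A 24 (B 20 (C 22 (AB 1 (B 5 (X 15)) (B 7 (X
  15)))))))) (C 10 (C 11 (B 24 (BC 1 (C 5 (B 13 (X 15))) (C 13 (X 15))))))) (AB 5 (B 1 (A 13 (C 10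
  (B 11 (BC 14 (C 15 (C 17 (B 18 (C 21 (X 24))))) (C 15 (C 17 (X 24)))))))) (Split 15 (C 10 (C 13
  (C 11 (BC 14 (C 17 (X 18)) (C 7 (A 17 (A 18 (C 19 (C 20 (X 21)))))))))) (B 1 (A 13 (C 10 (AC 14
  (B 17 (C 18 (B 19 (C 21 (X 24))))) (C 11 (C 18 (B 17 (X 24)))))))) (Split 14 (B 10 (C 7 (B 1 (X
  11)))) (C 1 (C 10 (B 11 (C 13 (A 17 (X 20)))))) (C 24 (C 10 (B 11 (B 18 (C 19 (X 25)))))))))) (C
  2 (AC 18 (Split 7 (B 13 (B 5 (C 11 (X 17)))) (B 1 (C 11 (B 10 (A 13 (C 17 (C 15 (B 14 (C 19 (X
  24))))))))) (C 14 (AC 1 (C 13 (AC 10 (C 15 (B 24 (B 19 (A 20 (C 22 (X 28)))))) (B 11 (B 15 (B 20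
  (X 24)))))) (C 11 (B 10 (C 17 (B 13 (C 15 (B 19 (X 24)))))))))) (BC 14 (C 24 (B 13 (A 22 (AB 1
  (B 21 (X 27)) (B 19 (C 15 (B 23 (C 21 (X 27))))))))) (C 24 (AB 5 (B 21 (C 17 (C 7 (X 11)))) (B
  13 (B 19 (C 17 (C 7 (X 11))))))))))) (BC 5 cert14 (C 11 (AC 6 (Split 15 (C 7 (C 14 (B 13 (A 18
  (C 10 (C 1 (A 20 (X 24)))))))) (B 1 (C 10 (C 18 (C 14 (C 13 (X 20)))))) (BC 2 (C 10 (C 14 (C 7
  (C 18 (B 17 (B 1 (C 20 (C 19 (X 27))))))))) (C 10 (B 1 (AC 14 (B 17 (X 18)) (C 7 (B 13 (C 21 (X
  24))))))))) (BC 18 (C 1 (AB 2 (B 10 (B 17 (C 14 (C 7 (X 24))))) (C 7 (B 13 (C 14 (B 10 (B 17 (C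
  19 (X 28))))))))) (Split 21 (BC 15 (BC 1 (C 17 (A 23 (C 24 (B 13 (X 27))))) (Split 24 (C 17 (B
  10 (C 22 (X 25)))) (B 13 (A 22 (A 27 (C 2 (X 26))))) (AB 2 (B 10 (A 17 (A 23 (C 30 (B 25 (X
  27)))))) (AC 22 (C 27 (B 29 (X 30))) (B 14 (A 25 (A 29 (B 30 (B 27 (B 13 (X 19))))))))))) (C 13
  (B 7 (C 2 (B 10 (X 20)))))) (C 25 (A 27 (B 13 (B 7 (C 20 (B 17 (B 1 (X 24)))))))) (C 27 (B 29 (B
  7 (B 13 (C 20 (B 17 (B 1 (X 24)))))))))))))"

text \<open>Position \<open>{4,5,16} / {1,9} / {3,8,12}\<close>. The third class excludes 11 by
  \<open>2*3^2 + 2*12^2 = 8^2 + 2*11^2\<close>.\<close>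

definition cert17 :: cert where
  "cert17 =
  AB 11 (BC 24 (Split 15 (C 21 (C 25 (C 27 (C 18 (C 6 (B 7 (C 14 (X 22)))))))) (C 17 (AC 13 (C 14
  (A 20 (C 6 (C 2 (C 10 (B 18 (X 21))))))) (B 14 (B 7 (A 10 (C 6 (C 18 (X 21)))))))) (C 17 (AC 18
  (C 2 (A 10 (C 14 (X 22)))) (AC 21 (B 10 (A 23 (C 30 (B 27 (AC 2 (B 6 (C 25 (X 28))) (C 7 (X
  13))))))) (C 27 (C 25 (X 28))))))) (BC 18 (C 14 (A 28 (C 21 (X 25)))) (C 27 (B 28 (C 25 (B 21 (C
  7 (X 23)))))))) (Split 15 (Split 24 (BC 19 (C 21 (B 25 (C 27 (C 18 (C 6 (B 2 (X 14))))))) (C 17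
  (A 20 (B 21 (B 25 (C 27 (C 18 (C 6 (B 2 (X 14)))))))))) (Split 10 (C 14 (AC 2 (C 6 (X 20)) (B 18
  (B 6 (B 20 (B 19 (X 26))))))) (C 20 (B 19 (BC 2 (C 14 (X 18)) (C 14 (C 6 (C 7 (A 13 (C 18 (B 26
  (C 22 (C 21 (X 25)))))))))))) (B 14 (C 2 (X 18)))) (C 14 (C 18 (B 27 (C 25 (B 21 (B 2 (C 7 (C 10
  (B 6 (X 19))))))))))) (BC 10 (C 7 (A 20 (B 13 (C 14 (B 17 (C 18 (C 2 (X 24)))))))) (AC 13 (C 20
  (C 19 (B 14 (X 18)))) (C 14 (B 18 (X 19))))) (BC 2 (C 10 (B 18 (B 17 (A 23 (AC 7 (C 6 (A 27 (C
  24 (C 30 (C 14 (X 20)))))) (B 13 (B 6 (A 27 (B 20 (C 24 (X 30))))))))))) (Split 20 (C 18 (C 27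
  (B 21 (C 10 (B 24 (X 30)))))) (Split 28 (C 21 (AC 10 (C 18 (B 19 (A 25 (B 24 (B 17 (X 30))))))
  (B 18 (B 17 (B 24 (B 30 (X 32))))))) (C 18 (C 27 (B 21 (B 6 (C 10 (A 17 (A 23 (C 24 (B 13 (A 30
  (B 14 (X 25)))))))))))) (C 17 (A 25 (B 18 (C 27 (B 21 (C 10 (B 24 (X 30))))))))) (B 10 (B 18 (C
  6 (C 17 (B 21 (B 27 (B 22 (B 13 (B 19 (C 25 (X 28))))))))))))))"

text \<open>Position \<open>{1,4,16} / {3,8,12} / {9}\<close>. The front class excludes 15 by
  \<open>1^2 + 2*4^2 + 15^2 = 2*1^2 + 16^2\<close>.\<close>

definition cert18 :: cert where
  "cert18 =
  BC 15 (BC 18 (C 10 (A 11 (BC 7 (Split 24 (B 5 (C 13 (B 17 (X 20)))) (B 17 (B 2 (C 14 (X 22))))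
  (C 14 (B 13 (B 19 (C 20 (B 2 (X 26))))))) (B 14 (C 13 (B 2 (A 17 (C 20 (B 19 (C 5 (B 23 (A 25 (C
  26 (A 28 (C 24 (X 30)))))))))))))))) (BC 27 (BC 24 (C 30 (AB 2 (C 6 (C 21 (AC 10 (B 20 (C 14 (X
  22))) (B 23 (B 11 (X 29)))))) (B 17 (B 21 (B 23 (B 10 (B 19 (C 14 (B 20 (B 6 (B 22 (C 5 (X
  31))))))))))))) (C 17 (AB 2 (B 11 (B 5 (B 29 (C 7 (X 13))))) (B 10 (A 30 (C 20 (B 14 (C 13 (B 19
  (B 5 (X 25))))))))))) (AB 5 (AB 11 (B 17 (AC 19 (C 24 (X 28)) (B 20 (A 28 (B 29 (B 22 (C 23 (C
  13 (X 24))))))))) (Split 20 (C 6 (C 17 (B 21 (C 25 (B 22 (B 13 (X 24))))))) (B 2 (C 6 (C 17 (C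
  23 (C 24 (B 13 (X 28))))))) (B 19 (C 13 (B 17 (C 21 (X 28))))))) (C 29 (BC 17 (AC 2 (C 11 (B 20
  (C 21 (C 13 (X 23))))) (C 6 (C 22 (C 10 (A 23 (B 20 (B 11 (C 13 (X 24))))))))) (C 11 (A 22 (C 25
  (B 21 (C 20 (X 23))))))))))) (AB 5 (BC 10 (Split 24 (C 20 (AC 6 (C 14 (C 13 (B 18 (X 19)))) (B
  14 (A 22 (B 17 (X 18)))))) (Split 6 (C 18 (AC 20 (C 22 (A 30 (B 14 (B 7 (B 23 (X 27)))))) (B 30
  (B 21 (B 7 (C 11 (B 19 (B 17 (C 2 (X 22)))))))))) (C 7 (C 11 (X 14))) (B 18 (BC 21 (C 27 (B 29
  (B 20 (C 13 (X 23))))) (B 17 (B 2 (C 22 (B 20 (B 7 (X 13))))))))) (C 18 (C 27 (C 29 (B 20 (C 11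
  (C 19 (B 13 (C 17 (X 28)))))))))) (BC 14 (C 6 (A 11 (B 18 (B 19 (C 20 (B 13 (X 21))))))) (C 18
  (B 19 (AC 20 (C 21 (X 27)) (B 21 (C 13 (C 17 (B 7 (X 23)))))))))) (AB 11 (BC 18 (C 21 (C 27 (C
  25 (C 20 (B 19 (X 28)))))) (C 6 (A 24 (B 21 (C 27 (C 17 (C 22 (B 20 (X 25))))))))) (Split 24
  (Split 25 (C 6 (C 2 (B 21 (BC 10 (C 18 (B 27 (C 20 (X 29)))) (C 17 (B 18 (B 27 (C 19 (X
  20))))))))) (C 21 (C 27 (B 6 (X 18)))) (C 21 (B 29 (C 18 (B 2 (X 6)))))) (Split 22 (C 14 (C 10
  (C 7 (C 20 (C 2 (A 13 (X 26))))))) (C 25 (B 23 (Split 2 (B 20 (C 13 (C 21 (C 17 (C 10 (B 14 (X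
  26))))))) (B 6 (A 19 (C 18 (B 10 (X 21))))) (C 14 (C 10 (X 21)))))) (C 25 (B 20 (B 6 (A 19 (C 18
  (C 14 (X 28)))))))) (C 14 (C 18 (B 27 (B 28 (C 19 (C 13 (C 17 (B 20 (C 2 (C 10 (B 7 (X
  23)))))))))))))))"

text \<open>Position \<open>{3,9} / {4,16} / {8,12}\<close>. The triple 3, 6, 9 excludes 6 from the
  front class.\<close>

definition cert19 :: cert where
  "cert19 =
  BC 6 (Split 24 (BC 18 (AC 2 (C 10 (A 20 (AC 11 (C 21 (X 27)) (B 25 (C 13 (C 14 (B 7 (X
  15)))))))) (B 10 (Split 15 (B 20 (X 22)) (C 21 (C 13 (B 19 (C 5 (X 20))))) (C 21 (A 27 (C 32 (B
  20 (B 1 (X 19))))))))) (C 10 (B 2 (B 20 (X 30))))) (BC 15 (C 21 (Split 14 (C 7 (AB 1 (B 2 (C 18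
  (C 10 (X 11)))) (B 2 (C 10 (B 13 (X 28)))))) (B 18 (C 10 (B 2 (B 20 (B 11 (B 7 (X 13))))))) (B 2
  (A 13 (B 1 (C 20 (B 5 (X 25)))))))) (Split 10 (B 2 (C 14 (X 18))) (B 2 (C 21 (A 23 (C 19 (B 13
  (C 11 (X 18))))))) (B 18 (B 21 (C 17 (B 1 (C 2 (A 5 (C 7 (X 11)))))))))) (BC 18 (C 14 (A 28 (A
  32 (BC 13 (C 25 (C 7 (B 15 (X 20)))) (C 19 (B 31 (C 1 (B 2 (B 10 (X 15)))))))))) (Split 25 (B 2
  (BC 10 (Split 15 (C 14 (C 20 (B 22 (C 32 (B 28 (C 21 (B 5 (X 27)))))))) (C 13 (A 21 (X 27))) (C
  13 (A 21 (C 1 (C 17 (X 20)))))) (C 14 (C 20 (B 22 (C 17 (C 13 (X 21)))))))) (C 21 (Split 13 (C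
  11 (C 2 (A 27 (B 15 (C 14 (B 7 (X 10))))))) (C 2 (C 11 (B 5 (X 17)))) (B 14 (B 7 (C 20 (B 15 (X
  28))))))) (C 21 (B 27 (C 5 (A 14 (C 13 (X 29))))))))) (BC 18 (BC 24 (AC 21 (C 27 (AC 25 (C 5 (A
  14 (B 13 (X 23)))) (B 2 (A 13 (AB 5 (C 20 (C 23 (A 28 (X 29)))) (C 29 (C 20 (C 11 (X 22)))))))))
  (AC 13 (B 27 (C 28 (C 26 (BC 5 (C 11 (X 20)) (C 11 (X 23)))))) (B 14 (B 28 (B 26 (BC 7 (C 15 (C
  17 (X 27))) (B 11 (X 17)))))))) (AB 2 (B 10 (AC 20 (C 30 (A 32 (B 14 (B 17 (C 13 (X 21)))))) (B
  14 (BC 13 (C 15 (C 7 (X 17))) (C 21 (C 17 (C 22 (C 1 (X 26))))))))) (B 10 (C 20 (C 14 (A 22 (BC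
  1 (C 15 (C 7 (C 5 (X 13)))) (C 15 (X 17))))))))) (C 10 (B 2 (BC 20 (C 30 (B 28 (BC 1 (C 15 (B 23
  (B 21 (B 5 (C 7 (C 11 (X 13))))))) (C 15 (X 25))))) (C 14 (Split 23 (B 28 (C 24 (C 32 (BC 5 (C
  19 (B 15 (C 1 (X 17)))) (C 13 (A 15 (C 11 (C 7 (B 1 (X 17)))))))))) (C 13 (C 1 (X 17))) (C 13 (X
  15))))))))"

text \<open>Position \<open>{3,4,16} / {8,12} / {9}\<close>. The front class excludes 11 by
  \<open>2*4^2 + 2*11^2 = 2*3^2 + 16^2\<close>.\<close>

definition cert20 :: cert where
  "cert20 =
  BC 11 (C 5 (AC 14 (C 13 (BC 2 (B 7 (BC 22 (C 20 (C 19 (X 27))) (C 15 (B 20 (C 6 (B 10 (C 1 (X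
  19)))))))) (B 6 (C 10 (C 15 (X 19)))))) (Split 10 (B 7 (AC 15 (C 24 (B 18 (B 19 (B 2 (X 17)))))
  (B 1 (A 17 (B 24 (B 18 (B 2 (X 6)))))))) (C 15 (B 1 (B 2 (B 18 (X 21))))) (C 2 (A 18 (AB 1 (C 6
  (C 20 (C 15 (X 21)))) (B 15 (B 21 (C 20 (C 6 (X 17))))))))))) (AC 1 (AC 2 (BC 10 (BC 18 (BC 15
  (C 6 (A 7 (X 13))) (C 17 (B 14 (C 5 (C 24 (C 6 (X 20))))))) (BC 6 (B 14 (C 24 (AB 5 (B 22 (B 20
  (B 13 (X 15)))) (B 15 (B 7 (C 17 (X 21))))))) (B 5 (Split 26 (C 14 (C 21 (B 20 (B 13 (X 24)))))
  (C 24 (C 14 (A 20 (C 22 (C 13 (B 15 (X 28))))))) (C 13 (A 23 (X 24))))))) (C 14 (C 18 (B 6 (C 15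
  (X 20)))))) (BC 10 (AB 5 (C 6 (C 15 (B 13 (C 19 (C 18 (C 7 (X 20))))))) (C 7 (AC 6 (B 20 (C 15
  (C 14 (B 18 (C 19 (X 25)))))) (B 13 (C 20 (C 15 (C 14 (B 18 (C 19 (X 25)))))))))) (AC 6 (BC 13
  (C 5 (A 15 (B 14 (X 20)))) (C 14 (B 18 (X 24)))) (Split 14 (C 5 (C 7 (A 13 (B 15 (X 20))))) (BC
  17 (C 24 (B 18 (B 5 (X 21)))) (C 5 (A 19 (X 24)))) (B 18 (C 20 (X 24))))))) (BC 15 (Split 18 (B
  2 (B 5 (C 10 (AB 6 (B 7 (C 14 (X 24))) (B 17 (C 14 (X 21))))))) (AB 2 (B 5 (C 10 (A 14 (B 7 (X
  24))))) (AC 24 (AC 23 (C 6 (A 7 (B 10 (C 5 (C 13 (B 19 (X 22))))))) (C 21 (B 26 (C 10 (C 5 (C 7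
  (B 19 (A 20 (B 22 (X 27)))))))))) (AB 10 (B 6 (C 14 (B 26 (C 13 (X 28))))) (C 5 (A 20 (C 22 (C
  13 (X 26)))))))) (C 14 (C 10 (B 5 (B 2 (C 7 (B 13 (A 24 (C 17 (C 19 (X 20))))))))))) (C 7 (AC 6
  (C 14 (C 10 (C 13 (C 22 (B 28 (B 18 (B 20 (B 5 (A 17 (C 21 (X 23))))))))))) (B 2 (C 10 (X
  18)))))))"

text \<open>Position \<open>{1,4,5} / {3,8,12} / {9,16}\<close>. The front class excludes 6 by
  \<open>3*4^2 + 5^2 = 1^2 + 2*6^2\<close>.\<close>

definition cert21 :: cert where
  "cert21 =
  BC 6 (BC 18 (BC 25 (Split 24 (BC 20 (C 10 (A 13 (B 7 (A 14 (B 11 (X 17)))))) (C 7 (B 27 (B 23 (B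
  2 (X 22)))))) (C 11 (A 17 (B 2 (X 10)))) (C 23 (B 21 (AB 2 (C 14 (C 7 (A 17 (C 10 (X 22))))) (C
  7 (X 15)))))) (Split 19 (B 11 (B 10 (C 15 (C 23 (C 2 (C 24 (B 14 (C 13 (X 28))))))))) (B 2 (A 10
  (B 11 (C 15 (B 23 (B 20 (C 14 (X 22)))))))) (C 20 (C 10 (C 15 (C 23 (AC 2 (C 11 (X 17)) (B 11 (B
  17 (C 24 (B 13 (X 14)))))))))))) (BC 27 (Split 23 (C 14 (C 15 (B 13 (X 21)))) (C 24 (B 17 (B 21
  (C 14 (X 22))))) (C 24 (B 29 (B 21 (BC 15 (B 11 (C 14 (X 20))) (C 30 (C 10 (B 19 (C 14 (X
  22)))))))))) (C 28 (C 19 (C 10 (AB 17 (B 11 (C 13 (B 21 (B 15 (C 20 (X 23)))))) (B 24 (B 21 (C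
  15 (X 23)))))))))) (Split 15 (B 11 (Split 21 (C 13 (A 25 (C 17 (B 14 (C 7 (C 20 (B 10 (B 18 (X
  22))))))))) (BC 18 (C 24 (A 25 (B 7 (C 14 (C 10 (C 2 (X 19))))))) (C 24 (B 25 (B 13 (X 29)))))
  (B 25 (C 27 (C 18 (X 24)))))) (B 11 (C 20 (AB 10 (B 14 (C 2 (A 13 (X 18)))) (B 14 (C 7 (X
  24)))))) (Split 24 (Split 25 (BC 21 (C 18 (AB 2 (C 13 (C 19 (C 23 (B 7 (X 14))))) (B 10 (X
  20)))) (C 17 (B 14 (B 10 (X 22))))) (C 18 (A 23 (B 14 (B 2 (C 7 (X 13)))))) (C 18 (B 2 (A 14 (X
  27))))) (C 10 (A 18 (B 11 (C 20 (X 25))))) (C 17 (A 23 (C 25 (C 31 (C 10 (B 2 (A 11 (X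
  22))))))))))"

text \<open>Position \<open>{3,8,12} / {9,16} / {4}\<close>. The front class excludes 5 by
  \<open>3^2 + 5^2 + 2*8^2 = 2*3^2 + 12^2\<close>.\<close>

definition cert22 :: cert where
  "cert22 =
  BC 5 (BC 10 (C 15 (AC 1 (C 11 (X 14)) (B 11 (X 14)))) (AC 15 (C 20 (B 13 (AC 1 (C 11 (C 14 (B 7
  (C 19 (X 24))))) (B 11 (C 14 (C 2 (X 6))))))) (BC 23 (Split 27 (B 20 (B 13 (C 19 (B 1 (A 11 (X
  18)))))) (BC 21 (C 17 (B 1 (B 18 (B 19 (C 6 (A 14 (B 7 (X 20)))))))) (C 1 (A 2 (A 19 (AC 13 (B
  18 (C 6 (B 24 (C 30 (C 14 (X 20)))))) (B 20 (C 18 (B 7 (B 24 (X 30)))))))))) (B 18 (B 11 (B 1 (C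
  21 (B 28 (B 13 (B 14 (X 20))))))))) (C 11 (A 18 (B 1 (B 17 (C 13 (X 20))))))))) (AC 1 cert21 (BC
  13 (Split 15 (B 11 (C 17 (B 6 (B 10 (B 14 (C 18 (X 25))))))) (Split 18 (C 21 (C 25 (A 27 (B 7 (B
  14 (C 17 (X 22))))))) (C 25 (C 21 (C 23 (C 24 (B 7 (C 14 (C 2 (X 10)))))))) (C 24 (BC 21 (B 25
  (B 7 (C 17 (B 2 (X 23))))) (B 11 (C 23 (B 25 (B 7 (X 29)))))))) (BC 23 (AC 18 (C 10 (B 2 (C 14
  (C 7 (X 24))))) (C 27 (B 21 (X 24)))) (C 17 (C 21 (B 25 (C 18 (X 27))))))) (BC 20 (Split 18 (C
  11 (AC 24 (C 28 (C 19 (BC 2 (C 10 (C 15 (B 21 (X 25)))) (C 14 (X 22))))) (B 14 (A 27 (A 28 (B 2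
  (C 15 (A 17 (B 21 (C 25 (A 29 (X 32)))))))))))) (C 24 (A 25 (B 7 (BC 6 (C 11 (B 10 (B 15 (C 2 (C
  14 (X 19)))))) (B 2 (C 11 (A 14 (C 15 (B 10 (B 19 (C 26 (X 28)))))))))))) (C 25 (BC 21 (C 22 (C
  30 (B 29 (C 23 (B 26 (B 11 (X 17))))))) (C 11 (A 23 (C 32 (C 10 (B 14 (C 7 (X 24)))))))))) (BC
  15 (Split 24 (BC 19 (C 27 (B 18 (B 2 (X 23)))) (C 23 (B 27 (B 7 (B 6 (B 2 (X 18))))))) (C 11 (B
  17 (B 2 (B 10 (X 18))))) (C 7 (A 17 (A 23 (AB 2 (B 18 (C 21 (X 27))) (B 10 (B 18 (C 21 (X
  27))))))))) (Split 21 (B 11 (C 24 (B 18 (C 6 (C 25 (C 2 (X 7))))))) (C 7 (A 25 (B 24 (C 11 (X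
  14))))) (C 25 (AC 11 (B 24 (C 18 (X 27))) (C 18 (C 6 (B 7 (B 14 (X 24))))))))))))"

text \<open>Position \<open>{9,16} / {4} / {8,12}\<close>. If 3 joins 9, then 6 is expelled; if it
  joins 4, then 5 is.\<close>

definition cert23 :: cert where
  "cert23 =
  Split 3 (BC 6 (BC 2 (Split 5 (BC 15 (C 13 (B 11 (B 1 (X 14)))) (C 1 (AB 10 (B 11 (X 13)) (B 13
  (A 14 (X 20)))))) (C 1 (C 7 (C 15 (C 10 (A 13 (B 11 (X 14))))))) (C 11 (A 13 (B 10 (C 15 (C 7 (X
  14))))))) (AB 11 (BC 5 (C 7 (AC 1 (B 13 (B 10 (C 15 (X 21)))) (C 15 (X 20)))) (C 10 (A 13 (B 7
  (C 15 (X 17)))))) (AC 10 (BC 13 (BC 5 (C 15 (C 7 (B 1 (BC 24 (C 25 (C 18 (B 14 (C 21 (X 27)))))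
  (B 20 (C 25 (X 28))))))) (C 15 (C 20 (C 14 (X 18))))) (C 1 (C 5 (X 15)))) (Split 1 (BC 24 (C 13
  (B 5 (B 17 (B 14 (C 15 (X 20)))))) (C 14 (A 17 (B 21 (C 15 (X 25)))))) (C 5 (BC 13 (B 21 (C 15
  (X 24))) (C 7 (C 14 (X 15))))) (C 5 (C 7 (B 15 (C 13 (X 21))))))))) (BC 2 (C 10 (A 18 (AC 1 (C
  11 (B 13 (C 7 (B 14 (B 5 (C 15 (X 17))))))) (B 11 (C 15 (B 7 (C 13 (X 24)))))))) (AB 11 (AC 18
  (AC 10 (BC 15 (C 1 (A 17 (X 23))) (C 24 (C 13 (B 7 (C 1 (A 17 (X 23))))))) (AC 17 (BC 13 (C 1 (C
  15 (C 7 (C 14 (X 24))))) (C 5 (AB 1 (C 23 (X 24)) (B 14 (C 7 (X 15)))))) (C 21 (AC 13 (C 15 (C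
  20 (C 7 (X 14)))) (B 15 (C 1 (B 7 (B 14 (C 19 (X 24)))))))))) (BC 14 (C 24 (B 28 (B 21 (B 27 (C
  5 (X 23)))))) (C 24 (AC 10 (C 20 (C 28 (C 21 (B 13 (C 17 (X 22)))))) (C 17 (C 19 (B 5 (C 13 (C
  15 (C 1 (B 7 (X 21)))))))))))) (Split 24 (BC 14 (Split 15 (C 1 (B 13 (B 5 (X 10)))) (BC 23 (C 27
  (B 18 (B 5 (B 10 (A 13 (B 7 (B 17 (C 19 (X 20))))))))) (C 25 (B 27 (B 18 (B 1 (X 17)))))) (B 5
  (A 7 (A 13 (B 18 (C 21 (C 25 (X 27)))))))) (C 13 (A 18 (B 1 (B 5 (X 25)))))) (C 14 (B 13 (A 18
  (B 1 (X 10))))) (C 1 (A 18 (B 13 (B 5 (A 14 (C 15 (X 23))))))))))) (BC 5 (AC 1 (BC 11 (C 13 (A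
  19 (B 17 (B 21 (B 20 (B 15 (C 7 (X 24)))))))) (C 13 (A 14 (B 15 (B 17 (B 10 (X 20))))))) (C 15
  (Split 14 (B 13 (C 11 (C 19 (C 23 (B 20 (C 7 (X 24))))))) (B 10 (A 13 (C 7 (X 24)))) (C 2 (C 6
  (A 10 (B 11 (X 13)))))))) (AC 1 (C 2 (AC 11 (C 10 (A 15 (AB 7 (B 13 (C 14 (A 17 (B 20 (B 6 (X
  18)))))) (B 13 (C 14 (X 24)))))) (B 13 (B 15 (C 14 (BC 7 (C 10 (C 22 (B 19 (C 24 (X 26))))) (C
  10 (C 18 (C 6 (B 19 (X 22))))))))))) (C 13 (B 11 (C 18 (Split 15 (C 17 (C 20 (B 6 (X 10)))) (B 2
  (C 6 (A 7 (C 10 (X 20))))) (C 6 (B 10 (C 17 (C 2 (X 24))))))))))) cert22"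

section \<open>Positions with 8 and 9 in one class and 12 in another\<close>

text \<open>Position \<open>{1,11,14} / {7,12} / {8,9}\<close>. The front class excludes 15 by
  \<open>3*11^2 + 15^2 = 3*14^2\<close>.\<close>

definition cert24 :: cert where
  "cert24 =
  BC 15 (Split 24 (BC 18 (C 16 (B 2 (C 23 (C 19 (B 17 (B 3 (X 29))))))) (C 27 (AB 2 (Split 4 (B 25
  (C 32 (B 17 (B 3 (X 26))))) (B 5 (C 22 (C 3 (X 21)))) (C 32 (AB 3 (C 6 (X 16)) (B 22 (C 5 (X
  6)))))) (B 5 (C 6 (B 16 (BC 3 (C 22 (C 4 (X 25))) (B 4 (X 25))))))))) (Split 6 (BC 2 (C 20 (AC 3
  (B 17 (X 25)) (B 19 (C 17 (B 4 (X 25)))))) (C 5 (B 20 (AC 3 (C 10 (C 4 (X 17))) (C 19 (C 4 (X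
  23))))))) (C 2 (C 5 (A 16 (B 4 (C 3 (B 17 (C 10 (B 18 (X 25))))))))) (C 2 (C 3 (B 4 (B 10 (C 13
  (X 17))))))) (Split 18 (BC 5 (C 3 (A 6 (A 10 (C 13 (X 20))))) (C 6 (B 16 (B 3 (B 25 (B 30 (B 27
  (C 4 (A 17 (C 13 (X 20))))))))))) (C 16 (AC 2 (C 3 (X 6)) (B 6 (C 5 (C 10 (X 13)))))) (C 16 (C
  20 (C 4 (B 3 (B 6 (X 21)))))))) (BC 17 (BC 24 (C 3 (AC 16 (BC 4 (C 5 (X 6)) (B 21 (B 25 (C 6 (X
  27))))) (B 21 (B 25 (C 27 (C 18 (C 6 (X 10)))))))) (BC 18 (BC 20 (C 16 (B 2 (C 13 (C 21 (B 25 (C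
  5 (C 3 (X 10)))))))) (C 2 (A 19 (C 25 (B 10 (C 3 (X 29))))))) (BC 27 (B 3 (C 21 (C 16 (C 4 (B 5
  (C 2 (X 20))))))) (Split 16 (C 21 (C 25 (AB 4 (C 22 (C 5 (X 23))) (C 13 (C 6 (C 3 (C 2 (X
  32)))))))) (C 3 (AC 2 (B 4 (C 6 (C 5 (B 10 (X 13))))) (C 22 (C 4 (X 28))))) (C 4 (C 23 (B 20 (C
  3 (C 5 (X 6)))))))))) (BC 19 (Split 18 (BC 5 (C 10 (A 13 (B 3 (X 6)))) (C 6 (A 21 (B 2 (B 3 (B
  26 (A 27 (C 4 (X 22))))))))) (C 5 (X 6)) (C 20 (C 16 (C 25 (C 10 (B 2 (X 3))))))) (Split 24 (BC
  2 (C 10 (B 5 (B 13 (X 18)))) (C 5 (X 13))) (C 18 (AC 5 (C 2 (A 4 (C 27 (C 3 (B 6 (C 10 (X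
  21))))))) (C 21 (B 27 (C 4 (X 22)))))) (B 25 (Split 20 (C 3 (A 21 (C 27 (B 6 (X 18))))) (B 4 (C
  3 (A 21 (B 5 (C 27 (C 6 (X 18))))))) (B 16 (B 3 (A 21 (C 27 (C 10 (C 6 (X 18))))))))))))"

text \<open>Position \<open>{7,12,14} / {1} / {8,9}\<close>. The front class excludes 3 by
  \<open>3^2 + 3*12^2 = 7^2 + 2*14^2\<close>.\<close>

definition cert25 :: cert where
  "cert25 =
  BC 3 (BC 2 (BC 6 (AC 24 (Split 19 (C 11 (C 15 (B 4 (X 18)))) (C 17 (C 15 (BC 4 (B 5 (C 13 (C 10
  (X 18)))) (C 18 (X 27))))) (C 17 (B 4 (C 5 (X 25))))) (BC 16 (C 23 (AC 4 (C 10 (C 17 (B 5 (B 11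
  (X 13))))) (C 5 (B 11 (C 15 (X 18)))))) (B 4 (C 5 (A 20 (B 21 (X 22))))))) (B 4 (C 10 (C 17 (B
  13 (B 11 (B 15 (X 16)))))))) (AB 11 (C 4 (C 6 (A 16 (B 10 (B 5 (X 15)))))) (Split 13 (C 16 (C 4
  (C 5 (B 20 (B 18 (A 23 (B 21 (C 24 (X 25))))))))) (C 4 (C 6 (A 16 (B 5 (X 10))))) (B 5 (B 16 (C
  4 (C 6 (B 10 (BC 17 (B 20 (B 18 (C 15 (X 24)))) (C 19 (C 20 (X 24)))))))))))) (Split 24 (C 21
  (AC 16 (C 25 (B 17 (C 11 (C 4 (C 6 (B 13 (C 2 (C 5 (X 18))))))))) (B 18 (X 23)))) (AC 6 (BC 2 (C
  4 (A 5 (A 10 (B 15 (B 11 (B 18 (B 20 (X 21)))))))) (AC 5 (AC 18 (C 25 (B 20 (B 10 (B 4 (B 15 (X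
  22)))))) (B 21 (C 16 (B 17 (C 4 (X 22)))))) (B 4 (A 11 (B 15 (B 10 (B 18 (B 20 (X 21)))))))))
  (Split 5 (C 2 (C 4 (C 16 (A 17 (C 22 (B 25 (X 27))))))) (B 17 (AC 2 (C 16 (B 11 (X 18))) (B 10
  (B 13 (B 11 (X 16)))))) (B 2 (C 4 (B 16 (X 17)))))) (C 17 (Split 15 (B 6 (C 18 (B 21 (B 10 (B 4
  (C 2 (X 27))))))) (C 25 (C 20 (C 6 (A 21 (C 10 (B 4 (C 2 (C 5 (X 11))))))))) (C 11 (A 19 (BC 5
  (B 4 (A 10 (C 2 (X 6)))) (C 13 (C 2 (A 4 (C 6 (C 10 (C 16 (X 18)))))))))))))"

text \<open>Position \<open>{1,8,9} / {7,12} / {}\<close>. The front class excludes 4 by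
  \<open>3*4^2 + 9^2 = 1^2 + 2*8^2\<close>.\<close>

definition cert26 :: cert where
  "cert26 =
  BC 4 (C 6 (AC 16 (AB 3 (AB 15 (AC 17 (C 11 (C 5 (B 13 (C 10 (C 14 (B 19 (X 21))))))) (C 18 (C 24
  (B 19 (C 2 (X 22)))))) (BC 13 (C 11 (A 19 (B 17 (C 5 (X 20))))) (C 19 (AC 5 (B 11 (C 18 (X 21)))
  (B 14 (C 10 (C 2 (X 18)))))))) (B 14 (C 2 (B 5 (C 10 (C 11 (A 18 (C 17 (C 15 (B 13 (X
  20))))))))))) (B 17 (AC 2 (C 24 (B 28 (AC 11 (B 23 (B 20 (B 3 (X 14)))) (B 18 (C 5 (X 21))))))
  (B 3 (A 13 (B 20 (B 15 (C 26 (C 30 (C 19 (B 24 (X 28))))))))))))) (AC 14 (AB 11 (C 15 (Split 16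
  (B 3 (BC 2 (C 5 (X 10)) (C 5 (X 10)))) (B 3 (C 18 (C 17 (Split 24 (B 2 (X 5)) (C 21 (C 25 (X
  27))) (B 27 (C 22 (C 20 (C 23 (C 2 (X 25)))))))))) (BC 2 (C 3 (B 13 (C 5 (X 19)))) (C 3 (A 6 (B
  17 (C 18 (B 10 (C 24 (B 27 (B 23 (X 28)))))))))))) (BC 3 (C 5 (Split 18 (B 6 (B 15 (C 2 (C 10 (X
  16))))) (C 13 (C 16 (B 2 (C 21 (C 10 (B 6 (X 15))))))) (C 13 (C 15 (B 6 (A 10 (X 20))))))) (AC 5
  (C 6 (A 15 (C 13 (B 10 (X 16))))) (AB 15 (BC 10 (B 6 (C 19 (C 13 (X 20)))) (C 13 (X 20))) (BC 16
  (C 18 (B 17 (A 25 (C 6 (A 27 (B 20 (C 21 (X 24)))))))) (C 2 (C 6 (B 18 (B 13 (X 23)))))))))) (B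
  3 (Split 13 (C 11 (C 5 (B 2 (C 10 (A 16 (C 6 (X 15))))))) (C 5 (B 2 (C 6 (A 10 (X 11))))) (C 5
  (B 2 (C 10 (A 16 (B 11 (C 18 (C 6 (A 19 (X 21))))))))))))"

text \<open>Position \<open>{12,24} / {8,9,21} / {7,14}\<close>. The triple 12, 18, 24 excludes 18
  from the front class.\<close>

definition cert27 :: cert where
  "cert27 =
  BC 18 (BC 27 (C 3 (A 15 (BC 11 (C 16 (X 28)) (C 16 (C 4 (X 20)))))) (BC 22 (Split 20 (BC 6 (C 11
  (B 13 (B 1 (C 5 (C 29 (C 28 (B 4 (B 2 (X 10))))))))) (Split 16 (C 2 (A 4 (B 3 (X 19)))) (BC 2 (C
  4 (A 17 (B 15 (X 19)))) (C 26 (B 10 (B 28 (B 4 (B 3 (X 19))))))) (B 19 (B 1 (A 13 (B 3 (B 11 (B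
  15 (X 23))))))))) (C 13 (A 23 (B 6 (B 3 (X 15))))) (AC 10 (C 6 (A 15 (B 4 (C 16 (C 2 (X 28))))))
  (C 28 (B 16 (C 3 (B 5 (B 6 (A 23 (X 26))))))))) (BC 26 (B 10 (C 2 (C 6 (A 16 (C 5 (X 15)))))) (C
  28 (C 10 (B 2 (X 6))))))) (BC 16 (BC 20 (Split 6 (C 4 (AC 11 (C 17 (C 1 (X 15))) (B 13 (X 27))))
  (C 22 (C 10 (B 4 (C 1 (X 19))))) (B 4 (C 3 (A 10 (C 22 (C 26 (C 1 (B 2 (C 5 (X 32))))))))))
  (Split 25 (C 4 (C 11 (B 13 (B 3 (C 5 (B 15 (B 17 (C 19 (C 2 (X 22)))))))))) (C 11 (C 4 (C 6 (B
  15 (C 2 (C 17 (X 19))))))) (C 11 (B 13 (A 29 (BC 1 (C 5 (B 3 (C 2 (A 4 (C 17 (X 19)))))) (C 3 (C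
  4 (C 5 (C 10 (X 22))))))))))) (BC 11 (Split 17 (C 2 (AC 10 (C 4 (B 25 (C 1 (B 19 (C 15 (X
  29)))))) (B 6 (B 4 (B 25 (C 5 (C 20 (C 15 (C 1 (X 19)))))))))) (C 4 (A 15 (X 25))) (B 2 (C 19 (C
  4 (C 23 (C 1 (C 5 (X 6)))))))) (C 13 (Split 3 (B 2 (C 19 (X 25))) (C 20 (C 5 (X 25))) (B 25 (C 5
  (B 1 (A 2 (B 6 (C 4 (C 10 (X 19))))))))))))"

text \<open>Position \<open>{12,21,24} / {7,14} / {8,9}\<close>. Again 12, 18, 24 excludes 18 from
  the front class.\<close>

definition cert28 :: cert where
  "cert28 =
  BC 18 (BC 16 (BC 4 (BC 17 (BC 1 (C 15 (C 11 (B 27 (AC 2 (C 13 (X 20)) (B 19 (B 10 (X 20)))))))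
  (C 15 (B 2 (C 5 (X 10))))) (B 19 (BC 2 (C 6 (X 22)) (C 6 (A 22 (B 11 (C 13 (B 3 (B 1 (B 10 (X
  26))))))))))) (AC 20 (C 23 (Split 3 (C 5 (C 13 (C 2 (C 1 (X 17))))) (B 19 (A 25 (C 11 (B 13 (B 5
  (X 10)))))) (B 5 (C 32 (Split 13 (C 2 (X 22)) (C 6 (C 2 (A 22 (X 27)))) (C 1 (C 2 (B 11 (X
  19))))))))) (B 27 (B 29 (C 1 (C 17 (B 13 (C 3 (X 5))))))))) (Split 11 (BC 13 (C 15 (A 20 (B 17
  (AC 1 (B 3 (B 2 (C 5 (X 10)))) (B 5 (X 28)))))) (C 17 (C 4 (B 5 (C 2 (B 6 (B 3 (X 20)))))))) (BC
  4 (C 6 (A 25 (AC 1 (C 5 (C 15 (B 17 (B 10 (X 20))))) (C 20 (A 27 (C 19 (C 2 (X 17)))))))) (Split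
  1 (C 15 (C 17 (C 2 (C 6 (X 10))))) (C 27 (A 29 (C 15 (X 19)))) (B 6 (C 2 (A 13 (B 15 (A 17 (X
  20)))))))) (C 23 (AC 13 (C 20 (B 25 (C 5 (B 1 (A 2 (C 3 (A 4 (X 29)))))))) (B 4 (C 5 (B 1 (A 2
  (C 3 (C 15 (X 17))))))))))) (C 27 (BC 22 (BC 4 (Split 11 (Split 20 (BC 13 (C 19 (B 16 (B 3 (X
  28)))) (C 19 (B 6 (C 10 (C 5 (B 2 (C 16 (X 32)))))))) (C 6 (A 19 (C 1 (A 10 (C 17 (C 15 (X
  26))))))) (C 28 (C 5 (A 16 (B 29 (C 23 (C 26 (B 10 (C 3 (X 6)))))))))) (BC 13 (C 25 (B 16 (AB 5
  (B 15 (C 20 (C 1 (C 17 (X 19))))) (C 19 (X 20))))) (C 5 (B 15 (B 17 (C 19 (C 6 (C 20 (X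
  23)))))))) (BC 13 (C 20 (C 19 (B 25 (C 2 (X 3))))) (C 20 (X 25)))) (Split 26 (C 10 (C 28 (B 5 (A
  16 (B 23 (C 19 (B 3 (X 15)))))))) (C 28 (C 10 (B 2 (A 17 (C 11 (X 25)))))) (B 10 (C 2 (C 5 (X
  17)))))) (BC 26 (BC 10 (C 2 (C 6 (A 16 (B 1 (B 4 (X 20)))))) (Split 11 (C 2 (C 16 (AB 1 (B 6 (X
  13)) (B 4 (X 25))))) (C 6 (B 16 (B 13 (C 2 (B 3 (C 1 (C 4 (X 19)))))))) (C 13 (B 1 (B 6 (C 5 (C
  2 (C 4 (A 16 (X 29)))))))))) (C 28 (Split 2 (C 6 (C 10 (B 1 (C 16 (B 13 (B 15 (C 3 (X 4))))))))
  (C 10 (C 4 (A 6 (B 5 (X 15))))) (C 10 (C 16 (C 13 (B 1 (X 15))))))))))"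

text \<open>Position \<open>{12,21} / {7,14} / {8,9}\<close>. If 24 joins 14, then 2 is expelled by
  \<open>3*2^2 + 24^2 = 3*14^2\<close>.\<close>

definition cert29 :: cert where
  "cert29 =
  Split 24 cert28 (BC 2 (Split 6 (BC 18 (C 4 (A 16 (A 19 (B 23 (C 25 (B 27 (C 20 (C 11 (C 3 (X
  5)))))))))) (BC 27 (B 25 (C 32 (B 16 (B 3 (A 4 (X 15)))))) (AB 16 (B 19 (Split 11 (B 4 (C 15 (B
  13 (B 25 (C 1 (X 20)))))) (C 17 (C 22 (C 4 (X 10)))) (C 13 (C 15 (X 20))))) (B 23 (C 10 (A 28
  (AB 3 (C 20 (C 1 (X 17))) (C 5 (B 4 (X 19)))))))))) (Split 15 (BC 5 (C 11 (A 16 (C 13 (C 20 (B 3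
  (B 23 (C 18 (X 27)))))))) (C 4 (B 16 (C 3 (A 10 (X 13)))))) (C 18 (C 27 (B 19 (AC 11 (C 25 (C 13
  (C 1 (X 20)))) (B 5 (C 13 (B 20 (C 22 (X 29))))))))) (C 11 (B 5 (C 20 (C 4 (X 17)))))) (BC 10 (C
  4 (C 18 (BC 1 (B 17 (C 15 (C 13 (X 19)))) (C 3 (C 5 (A 11 (X 22))))))) (Split 15 (C 1 (B 3 (B 4
  (C 11 (X 13))))) (C 17 (C 1 (A 19 (B 11 (B 4 (B 3 (C 5 (X 20)))))))) (C 18 (C 19 (C 26 (B 3 (B 4
  (C 5 (X 17)))))))))) (BC 16 (BC 18 (Split 15 (BC 11 (C 17 (B 19 (B 5 (X 13)))) (C 13 (B 19 (B 5
  (B 6 (B 1 (X 17))))))) (C 5 (C 13 (B 1 (X 11)))) (C 27 (Split 20 (B 6 (AC 4 (C 11 (X 25)) (B 11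
  (X 13)))) (B 5 (C 25 (C 3 (C 11 (B 19 (X 30)))))) (C 19 (C 4 (B 10 (B 3 (X 5)))))))) (B 6 (B 5
  (C 15 (B 1 (X 11)))))) (B 25 (B 22 (Split 13 (C 5 (B 6 (C 15 (C 1 (X 17))))) (C 4 (C 18 (B 6 (X
  15)))) (C 19 (B 4 (C 18 (B 6 (X 20)))))))))) (BC 16 (C 25 (Split 15 (C 20 (B 4 (C 5 (C 2 (B 10
  (B 11 (C 3 (X 13)))))))) (BC 18 (AC 4 (C 17 (B 19 (C 2 (C 5 (X 20))))) (B 20 (B 19 (C 13 (C 5 (X
  17)))))) (C 27 (AB 4 (C 6 (C 2 (C 17 (B 19 (X 20))))) (B 20 (C 11 (X 23)))))) (BC 23 (AB 20 (C 3
  (C 27 (BC 1 (C 18 (B 11 (C 13 (X 19)))) (C 18 (B 6 (B 10 (X 17))))))) (B 4 (A 19 (C 3 (B 5 (AB 1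
  (C 27 (C 6 (X 18))) (B 2 (C 18 (X 27))))))))) (C 3 (A 11 (C 4 (C 6 (C 13 (X 20))))))))) (Split 6
  (C 25 (AC 1 (C 15 (B 11 (B 5 (X 18)))) (B 15 (B 18 (B 5 (X 10)))))) (C 18 (Split 11 (C 4 (A 13
  (A 25 (B 3 (C 15 (X 27)))))) (C 15 (C 3 (A 10 (B 1 (X 2))))) (B 3 (C 15 (C 27 (C 19 (B 4 (A 17
  (B 1 (X 22)))))))))) (C 18 (Split 19 (BC 3 (C 27 (AB 5 (B 23 (B 11 (A 13 (X 26)))) (B 11 (A 13
  (C 20 (C 22 (X 23))))))) (C 10 (A 11 (B 5 (X 23))))) (C 10 (B 3 (B 5 (A 27 (B 23 (C 22 (X
  26))))))) (C 27 (B 3 (B 5 (A 10 (C 11 (X 15))))))))))"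

definition cert30 :: cert where
  "cert30 =
  BC 2 (AC 18 (BC 17 (C 19 (Split 3 (C 1 (C 6 (C 20 (C 4 (B 10 (X 13)))))) (B 16 (AC 1 (C 5 (A 13
  (C 20 (X 28)))) (C 23 (C 27 (C 4 (B 10 (C 6 (X 20)))))))) (B 1 (C 4 (X 6))))) (C 19 (AC 3 (B 16
  (X 20)) (B 15 (C 1 (X 4)))))) (BC 27 (AB 22 (BC 1 (BC 4 (C 6 (A 15 (A 17 (C 16 (X 28))))) (C 6
  (B 3 (C 13 (X 25))))) (Split 3 (C 25 (C 13 (B 6 (B 4 (C 16 (X 26)))))) (BC 4 (C 6 (B 10 (B 16 (X
  25)))) (C 6 (B 10 (X 20)))) (C 17 (C 21 (C 25 (AB 4 (C 5 (C 6 (X 20))) (C 6 (X 13)))))))) (Split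
  6 (BC 4 (C 3 (A 19 (B 16 (X 20)))) (C 16 (B 3 (X 19)))) (C 4 (C 28 (C 16 (C 10 (C 20 (B 19 (B 3
  (X 15)))))))) (C 4 (A 10 (C 28 (C 26 (C 16 (C 20 (C 19 (C 1 (C 15 (X 17)))))))))))) (Split 6 (BC
  3 (C 21 (C 16 (C 20 (C 15 (B 28 (B 26 (C 13 (B 1 (C 4 (X 22)))))))))) (C 4 (C 1 (B 10 (B 16 (C
  13 (X 20))))))) (C 3 (C 4 (A 10 (C 16 (C 20 (X 21)))))) (C 3 (B 21 (C 16 (C 4 (C 22 (C 1 (X
  17)))))))))) (BC 16 (AC 5 (Split 10 (C 6 (AC 1 (C 3 (B 4 (B 15 (B 17 (X 26))))) (B 3 (A 4 (B 13
  (X 19)))))) (C 1 (A 3 (B 4 (C 6 (C 13 (A 17 (C 20 (B 15 (X 18))))))))) (C 3 (B 1 (A 4 (C 6 (C 15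
  (C 17 (B 18 (X 21))))))))) (AB 6 (C 4 (C 3 (BC 17 (B 10 (C 19 (A 22 (B 13 (B 15 (C 18 (X
  20))))))) (C 22 (B 18 (A 27 (C 1 (X 13)))))))) (Split 15 (Split 3 (BC 17 (AC 18 (C 10 (B 1 (B 27
  (B 22 (X 31))))) (B 27 (B 28 (B 26 (B 10 (B 1 (B 4 (B 19 (X 22))))))))) (C 19 (A 22 (B 18 (B 1
  (X 27)))))) (C 4 (A 10 (B 17 (A 19 (B 32 (B 23 (B 20 (B 18 (B 22 (X 25)))))))))) (C 10 (A 17 (B
  18 (B 20 (X 27)))))) (C 4 (A 10 (A 20 (B 18 (C 19 (B 13 (X 17))))))) (C 20 (AB 18 (B 10 (A 26 (C
  21 (C 19 (C 22 (X 27)))))) (B 28 (C 21 (B 17 (X 27))))))))) (Split 27 (Split 25 (B 22 (AC 13 (C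
  15 (A 20 (C 5 (B 4 (C 3 (C 1 (X 17))))))) (C 17 (C 19 (C 20 (B 1 (X 3))))))) (C 21 (C 5 (X 22)))
  (C 3 (A 21 (C 18 (C 1 (B 5 (X 26))))))) (B 18 (A 22 (C 5 (C 13 (B 4 (B 3 (B 1 (C 6 (X
  15))))))))) (C 3 (AC 18 (C 21 (B 15 (C 28 (C 4 (X 20))))) (C 1 (B 17 (B 10 (B 6 (C 15 (X
  26))))))))))"

text \<open>Position \<open>{8,9,24} / {7,11} / {12,14}\<close>. The triple 8, 16, 24 excludes 16
  from the front class.\<close>

definition cert31 :: cert where
  "cert31 =
  BC 16 (BC 3 (BC 18 (C 1 (A 21 (C 2 (A 28 (B 13 (C 4 (A 5 (B 6 (X 10))))))))) (C 6 (B 15 (B 21 (X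
  25))))) (Split 15 (BC 18 (BC 1 (C 2 (C 5 (A 6 (B 4 (X 13))))) (B 4 (B 22 (C 28 (B 21 (C 5 (C 6
  (X 10)))))))) (C 5 (AB 4 (C 6 (B 10 (A 23 (B 27 (X 30))))) (B 22 (C 6 (B 1 (A 10 (A 23 (B 27 (X
  30)))))))))) (B 25 (C 21 (B 13 (B 1 (X 5))))) (Split 22 (BC 21 (C 25 (A 28 (C 27 (C 18 (C 1 (A 6
  (B 10 (X 26)))))))) (C 28 (A 29 (AB 1 (C 2 (C 4 (X 17))) (B 17 (A 25 (C 2 (C 5 (X 10))))))))) (C
  17 (A 21 (B 1 (C 2 (A 4 (X 18)))))) (C 21 (B 25 (C 27 (C 18 (C 1 (A 6 (C 5 (C 10 (X
  20)))))))))))) (BC 18 (BC 3 (C 5 (AB 6 (C 4 (B 20 (C 22 (B 2 (X 27))))) (B 10 (BC 15 (B 23 (A 25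
  (B 30 (B 27 (C 20 (B 4 (B 1 (X 22)))))))) (B 26 (C 27 (B 21 (X 23)))))))) (C 10 (B 6 (B 5 (C 1
  (C 4 (X 17))))))) (AC 4 (BC 22 (Split 6 (B 32 (B 23 (BC 3 (C 2 (C 5 (X 17))) (C 15 (C 1 (C 5 (X
  20))))))) (C 2 (C 5 (C 17 (C 3 (B 1 (X 15)))))) (C 2 (C 3 (C 17 (C 15 (C 1 (X 19))))))) (B 26 (C
  28 (B 6 (C 2 (C 5 (X 17))))))) (B 20 (AC 1 (B 26 (C 2 (C 6 (X 22)))) (B 5 (C 26 (C 2 (C 6 (X
  22)))))))))"

text \<open>Position \<open>{12,14,15} / {8,9,11} / {7}\<close>. If 4 joins the front class,
  \<open>3*6^2 + 14^2 = 4^2 + 2*12^2\<close> expels 6.\<close>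

definition cert32 :: cert where
  "cert32 =
  Split 4 (BC 6 (C 1 (A 3 (C 2 (B 13 (C 16 (C 20 (C 21 (A 22 (X 24))))))))) (AC 1 (C 3 (B 13 (A 16
  (AB 19 (B 21 (X 27)) (C 22 (C 24 (X 25))))))) (B 3 (C 5 (BC 10 (C 13 (B 16 (A 19 (B 20 (X
  27))))) (C 13 (X 20))))))) (BC 5 (C 3 (A 6 (B 1 (X 2)))) (AC 6 (C 3 (B 18 (AB 1 (B 2 (C 24 (AB
  10 (C 13 (X 22)) (C 20 (C 22 (X 26)))))) (B 2 (C 17 (B 13 (X 22))))))) (B 2 (A 18 (C 23 (BC 1 (C
  3 (A 24 (X 25))) (C 3 (C 10 (C 25 (C 20 (X 21))))))))))) (Split 3 (BC 2 (AC 1 (C 5 (C 13 (AB 19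
  (B 24 (B 16 (B 6 (C 18 (X 25))))) (B 21 (X 24))))) (B 5 (C 6 (C 10 (B 13 (X 20)))))) (C 5 (C 6
  (X 10)))) (Split 6 (BC 5 (Split 25 (C 18 (AC 24 (B 10 (A 23 (C 30 (B 27 (B 16 (B 19 (C 1 (X
  20)))))))) (C 27 (B 13 (C 20 (B 16 (C 17 (C 19 (X 22))))))))) (BC 20 (C 21 (B 16 (B 24 (B 23 (C
  27 (BC 2 (C 18 (X 30)) (C 10 (B 18 (X 30))))))))) (C 16 (A 21 (B 2 (X 18))))) (B 18 (A 22 (C 19
  (C 23 (C 16 (B 1 (X 28)))))))) (C 2 (A 10 (AB 18 (C 13 (C 19 (B 16 (X 17)))) (B 22 (C 24 (B 25
  (X 27)))))))) (C 5 (C 2 (C 1 (B 10 (B 13 (C 22 (B 18 (B 19 (X 24))))))))) (AC 18 (BC 20 (C 13 (A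
  19 (X 27))) (C 21 (B 25 (X 27)))) (AC 10 (C 13 (B 1 (A 2 (C 19 (C 17 (B 16 (X 20))))))) (B 13
  (AB 1 (B 2 (C 20 (A 24 (C 19 (X 22))))) (B 2 (C 19 (B 17 (B 5 (A 20 (C 24 (X 25)))))))))))) (BC
  5 (C 6 (Split 21 (B 17 (AC 2 (C 18 (B 22 (X 27))) (B 10 (X 18)))) (B 13 (C 20 (B 28 (C 16 (C 2
  (X 18)))))) (C 18 (A 23 (B 2 (B 10 (C 13 (X 20)))))))) (C 6 (A 13 (C 10 (C 2 (C 1 (A 17 (C 24 (B
  19 (X 20)))))))))))"

text \<open>Position \<open>{12,14} / {7} / {8,9}\<close>. The front class excludes 11 by
  \<open>4*11^2 = 2*12^2 + 14^2\<close>.\<close>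

definition cert33 :: cert where
  "cert33 =
  BC 11 (Split 24 (BC 17 (AC 18 (Split 2 (C 25 (AC 23 (C 16 (C 32 (C 30 (AC 1 (B 3 (X 22)) (C 15
  (C 3 (C 6 (B 10 (B 5 (C 4 (C 19 (C 21 (X 28))))))))))))) (B 13 (A 19 (B 1 (BC 5 (B 10 (C 3 (X
  15))) (B 4 (C 3 (X 15))))))))) (C 16 (C 23 (B 25 (C 4 (B 6 (C 3 (X 30))))))) (C 6 (A 16 (BC 3 (C
  10 (B 25 (C 20 (B 13 (C 15 (C 21 (X 28))))))) (C 10 (C 13 (B 15 (X 19)))))))) (AC 19 (Split 21
  (B 25 (C 10 (B 3 (A 26 (B 6 (C 5 (X 16))))))) (C 6 (AC 10 (C 16 (C 3 (X 5))) (B 16 (C 15 (X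
  22))))) (C 27 (AC 28 (C 22 (C 10 (C 6 (B 4 (B 13 (X 20)))))) (C 26 (C 23 (B 6 (C 2 (X 25))))))))
  (BC 13 (C 25 (C 10 (C 2 (C 5 (X 6))))) (C 5 (C 4 (C 27 (B 2 (C 10 (C 6 (A 16 (B 3 (C 15 (X
  21))))))))))))) (Split 16 (C 25 (AB 18 (C 15 (B 1 (B 3 (B 19 (X 20))))) (BC 1 (C 26 (B 10 (X
  22))) (C 15 (B 4 (B 3 (B 5 (X 20)))))))) (C 3 (Split 1 (C 2 (C 6 (C 15 (X 22)))) (B 15 (C 18 (A
  22 (B 2 (C 4 (C 5 (B 6 (X 13)))))))) (B 18 (C 6 (X 15))))) (B 18 (C 26 (AC 1 (C 15 (B 19 (B 3 (C
  5 (C 4 (C 6 (C 10 (X 22)))))))) (B 19 (B 3 (C 5 (X 13))))))))) cert30 cert31) (BC 15 cert32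
  (Split 16 (Split 4 (BC 6 (C 1 (A 3 (A 10 (C 13 (C 18 (X 20)))))) (C 10 (B 5 (B 3 (B 1 (C 13 (C
  18 (X 24)))))))) (C 3 (A 6 (C 1 (A 2 (X 5))))) (C 6 (B 3 (C 1 (A 2 (B 10 (B 13 (C 17 (X
  19))))))))) (BC 24 (Split 19 (C 13 (C 5 (B 1 (C 2 (X 3))))) (C 5 (C 13 (B 25 (AB 2 (C 1 (C 6 (C
  4 (X 18)))) (B 17 (X 23)))))) (B 17 (B 2 (C 5 (B 1 (C 3 (B 4 (B 10 (X 13))))))))) (C 2 (AC 22 (B
  13 (AB 3 (B 20 (C 1 (X 5))) (C 18 (C 1 (X 20))))) (B 18 (C 3 (B 25 (B 20 (B 6 (A 13 (C 1 (C 4 (C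
  5 (X 28))))))))))))) (BC 20 (BC 1 (C 5 (C 4 (C 10 (B 13 (B 3 (B 2 (C 6 (AB 17 (B 18 (X 19)) (B
  18 (C 21 (X 25))))))))))) (B 4 (C 5 (B 3 (C 13 (X 18)))))) (AC 4 (C 18 (AC 1 (C 24 (B 2 (B 3 (B
  5 (B 6 (C 10 (X 19))))))) (B 5 (C 19 (C 10 (C 6 (B 3 (B 2 (X 17))))))))) (Split 17 (BC 1 (C 3 (X
  5)) (C 5 (B 3 (C 2 (C 6 (B 13 (X 18))))))) (B 18 (C 22 (BC 2 (B 3 (B 5 (X 21))) (C 24 (C 3 (X
  5)))))) (B 21 (C 5 (B 3 (C 1 (X 2))))))))))"

text \<open>Position \<open>{7} / {8,9} / {12}\<close>. The second class excludes 14 by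
  \<open>4*9^2 = 2*8^2 + 14^2\<close>.\<close>

definition cert34 :: cert where
  "cert34 =
  AC 14 (BC 21 (Split 24 (BC 16 (Split 6 (C 15 (A 25 (AB 3 (C 18 (B 1 (B 2 (C 4 (X 20))))) (C 20
  (C 5 (B 10 (B 2 (X 11)))))))) (C 18 (AC 3 (C 15 (B 10 (B 1 (X 2)))) (B 10 (B 2 (B 1 (X 13))))))
  (C 18 (BC 3 (AC 13 (C 5 (A 23 (B 15 (A 27 (X 30))))) (AB 15 (B 5 (A 10 (B 1 (C 4 (X 11)))))
  (Split 22 (B 23 (B 30 (B 27 (B 5 (C 11 (X 20)))))) (B 27 (B 30 (B 10 (B 5 (C 19 (B 11 (X
  25))))))) (BC 27 (C 30 (B 23 (B 4 (B 26 (B 32 (C 2 (B 20 (C 10 (B 5 (X 25)))))))))) (C 28 (C 19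
  (B 20 (C 1 (X 32))))))))) (C 10 (A 15 (B 5 (X 13))))))) (BC 4 (C 20 (AC 13 (C 3 (B 5 (B 6 (A 15
  (C 18 (C 25 (C 27 (X 30)))))))) (B 5 (B 3 (B 1 (B 15 (B 23 (C 18 (B 10 (C 27 (X 30)))))))))))
  (AB 3 (C 20 (C 5 (A 11 (B 1 (A 2 (X 10)))))) (AB 15 (BC 5 (AB 13 (C 18 (C 6 (C 25 (B 27 (B 30 (C
  2 (X 20))))))) (B 23 (C 18 (B 1 (C 6 (B 10 (A 25 (B 30 (B 27 (X 32)))))))))) (C 18 (A 20 (C 13
  (B 1 (X 23)))))) (C 5 (C 1 (X 2))))))) (BC 2 (C 25 (Split 18 (C 6 (B 5 (C 11 (C 4 (C 15 (X
  20)))))) (BC 5 (AC 10 (C 15 (C 11 (B 13 (C 4 (X 16))))) (B 17 (B 6 (B 16 (X 20))))) (C 6 (A 15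
  (B 20 (B 3 (B 16 (C 4 (C 10 (X 22))))))))) (B 6 (A 16 (C 4 (B 11 (C 13 (B 1 (X 19)))))))))
  (Split 18 (Split 11 (C 25 (AC 6 (C 4 (A 10 (X 16))) (B 5 (B 4 (B 15 (B 10 (X 16))))))) (C 6 (C 3
  (C 4 (A 10 (C 15 (A 16 (X 25))))))) (C 16 (AB 6 (B 10 (C 5 (C 13 (B 15 (X 20))))) (B 10 (C 3 (X
  15)))))) (BC 4 (C 6 (X 10)) (C 6 (B 16 (B 11 (C 5 (B 1 (X 19))))))) (BC 6 (Split 11 (C 3 (A 15
  (C 4 (X 5)))) (C 4 (A 16 (C 10 (A 15 (X 20))))) (B 3 (A 15 (AB 10 (C 22 (C 13 (B 19 (X 20)))) (C
  19 (X 26)))))) (Split 16 (C 10 (A 15 (C 5 (C 4 (B 20 (C 11 (B 1 (X 22)))))))) (C 11 (B 5 (C 13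
  (C 1 (X 20))))) (C 22 (C 4 (C 15 (C 20 (B 11 (C 13 (X 19))))))))))) cert27) cert29) cert33"

section \<open>Positions with 8, 9 and 12 in three different classes\<close>

text \<open>Position \<open>{6,8,16} / {4,12} / {9}\<close>. The triple 8, 16, 24 excludes 24 from
  the front class.\<close>

definition cert35 :: cert where
  "cert35 =
  BC 24 (AC 26 (C 2 (A 10 (A 22 (BC 3 (C 13 (A 27 (C 15 (B 5 (A 11 (B 19 (C 14 (B 7 (X 28)))))))))
  (C 13 (B 21 (C 5 (C 1 (X 17))))))))) (AC 18 (C 28 (Split 21 (BC 13 (C 14 (B 2 (B 1 (B 7 (X
  11))))) (C 11 (A 19 (B 2 (B 7 (X 10)))))) (C 2 (C 3 (C 10 (C 1 (C 15 (X 19)))))) (B 27 (BC 2 (C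
  10 (C 32 (B 5 (B 13 (X 29))))) (B 32 (B 5 (B 29 (B 13 (C 1 (B 15 (C 3 (A 11 (X 17)))))))))))))
  (B 28 (AC 2 (Split 23 (C 10 (B 22 (B 20 (B 14 (BC 5 (C 13 (X 17)) (B 15 (C 3 (C 11 (X
  21))))))))) (C 5 (B 21 (C 3 (C 1 (X 10))))) (C 5 (C 17 (C 10 (B 22 (B 14 (X 20))))))) (B 10 (A
  14 (C 17 (B 3 (C 13 (X 15)))))))))) (AC 2 (BC 17 (BC 13 (C 22 (AB 15 (C 19 (BC 7 (C 18 (C 1 (C 3
  (C 10 (X 26))))) (C 21 (C 14 (C 18 (C 11 (X 23))))))) (Split 11 (B 26 (AC 21 (C 23 (C 5 (C 10 (C
  3 (B 14 (X 20)))))) (B 3 (A 19 (X 23))))) (C 3 (A 14 (C 7 (C 1 (B 10 (X 18)))))) (C 3 (A 14 (X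
  21)))))) (C 15 (C 21 (C 3 (C 11 (C 14 (X 18))))))) (BC 7 (C 23 (Split 21 (B 19 (C 13 (B 5 (X
  11)))) (C 22 (A 26 (C 15 (B 27 (B 14 (B 3 (X 13))))))) (C 10 (C 11 (B 1 (C 5 (X 22))))))) (C 19
  (C 13 (C 14 (C 5 (X 11))))))) (B 10 (B 26 (BC 3 (Split 11 (C 20 (C 18 (AB 7 (B 15 (X 17)) (B 15
  (X 19))))) (C 18 (C 14 (B 13 (B 7 (X 20))))) (C 21 (B 23 (B 18 (B 15 (C 13 (X 28))))))) (Split
  15 (BC 1 (C 7 (X 11)) (C 17 (B 5 (X 13)))) (C 13 (C 19 (AC 5 (B 20 (C 11 (X 18))) (C 11 (B 7 (B
  1 (X 18))))))) (B 20 (C 5 (C 11 (B 7 (B 1 (A 13 (C 14 (X 17)))))))))))))"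

text \<open>Position \<open>{2,10,12} / {4,9} / {6,8}\<close>. The front class excludes 18 by
  \<open>2*2^2 + 10^2 + 18^2 = 3*12^2\<close>.\<close>

definition cert36 :: cert where
  "cert36 =
  BC 18 (Split 13 (Split 1 (BC 16 (C 20 (A 22 (B 14 (X 26)))) (C 26 (B 20 (AB 3 (B 5 (X 11)) (B 7
  (X 19)))))) (C 3 (A 5 (C 7 (X 11)))) (C 3 (B 19 (B 27 (B 21 (AB 5 (C 24 (C 11 (X 17))) (C 11 (X
  28)))))))) (BC 5 (C 7 (A 11 (C 14 (C 1 (C 15 (C 3 (C 16 (X 17)))))))) (AC 15 (C 11 (A 17 (C 14
  (X 20)))) (B 17 (Split 22 (B 11 (C 24 (C 14 (B 20 (C 3 (X 16)))))) (B 7 (C 3 (B 1 (C 11 (C 14 (X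
  24)))))) (B 1 (C 11 (X 24))))))) (Split 1 (BC 3 (C 14 (X 24)) (C 7 (B 14 (B 11 (X 24))))) (C 7
  (C 3 (C 11 (B 5 (C 16 (B 15 (C 17 (X 20)))))))) (C 7 (C 5 (B 17 (B 3 (B 11 (C 24 (C 14 (B 15 (B
  20 (X 27)))))))))))) (BC 24 (C 26 (Split 13 (C 14 (A 17 (C 3 (B 19 (A 22 (C 7 (B 1 (C 11 (C 20
  (B 21 (X 23))))))))))) (BC 7 (C 5 (A 14 (B 11 (A 15 (C 16 (C 1 (C 3 (B 19 (X 23))))))))) (C 15
  (B 17 (B 11 (B 5 (A 14 (C 1 (C 3 (X 16))))))))) (B 17 (C 7 (C 15 (C 1 (X 3))))))) (Split 3 (BC
  15 (C 1 (B 5 (C 11 (X 17)))) (C 5 (A 13 (B 25 (AB 1 (C 7 (A 17 (C 11 (C 14 (X 26))))) (B 21 (C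
  17 (B 11 (B 7 (X 14)))))))))) (BC 1 (C 15 (A 17 (C 7 (C 5 (X 11))))) (C 11 (C 5 (B 7 (X 17)))))
  (Split 15 (B 26 (C 22 (B 20 (B 1 (B 7 (B 5 (C 23 (B 17 (C 13 (C 11 (C 19 (X 21)))))))))))) (C 1
  (Split 13 (C 17 (X 25)) (C 11 (C 17 (A 19 (B 21 (X 23))))) (C 11 (C 5 (A 16 (X 17)))))) (C 1 (X
  7)))))"

text \<open>Position \<open>{2,12} / {4,9} / {6,8}\<close>. The Pythagorean triple 6, 8, 10 keeps 10
  out of the third class.\<close>

definition cert37 :: cert where
  "cert37 =
  AB 10 cert36 (Split 24 (BC 26 (BC 20 (Split 3 (BC 11 (C 13 (C 7 (B 14 (C 1 (X 17))))) (C 1 (B 23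
  (AB 5 (B 14 (X 16)) (B 13 (C 7 (X 17))))))) (C 1 (A 15 (B 14 (X 16)))) (C 1 (BC 7 (B 14 (C 5 (X
  13))) (C 23 (C 22 (B 5 (X 16))))))) (Split 16 (B 22 (Split 3 (B 25 (C 15 (B 1 (C 11 (B 5 (C 13
  (X 14))))))) (BC 1 (C 5 (X 7)) (C 7 (B 11 (B 5 (X 13))))) (B 18 (AC 1 (C 5 (X 23)) (B 11 (X
  15)))))) (B 22 (C 14 (X 18))) (BC 13 (C 7 (A 25 (C 17 (C 1 (X 11))))) (C 5 (AC 11 (B 14 (C 1 (X
  15))) (C 15 (C 14 (X 22)))))))) (C 22 (C 16 (B 18 (AC 13 (C 5 (AC 1 (C 11 (C 3 (C 15 (B 14 (X
  17))))) (B 15 (C 14 (X 17))))) (B 7 (B 25 (B 20 (B 14 (C 1 (X 17))))))))))) (BC 17 (C 14 (A 18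
  (Split 11 (C 15 (C 7 (B 1 (B 3 (B 5 (C 13 (C 16 (X 25)))))))) (C 16 (AC 3 (C 5 (A 13 (C 1 (X
  20)))) (B 7 (X 15)))) (BC 5 (B 15 (C 26 (C 7 (X 13)))) (C 7 (X 13)))))) (Split 11 (C 14 (C 1 (C
  7 (B 13 (B 5 (C 3 (X 18))))))) (C 13 (C 5 (A 14 (A 19 (C 21 (C 23 (B 15 (BC 7 (C 18 (X 26)) (B 3
  (C 1 (X 20))))))))))) (B 14 (C 15 (B 7 (B 3 (C 1 (X 20)))))))) (BC 16 (C 13 (C 5 (B 18 (Split 1
  (C 22 (C 21 (B 3 (B 11 (B 14 (X 19)))))) (C 11 (C 3 (X 15))) (B 23 (C 20 (B 15 (B 3 (X
  7))))))))) (C 18 (A 22 (B 13 (C 3 (A 11 (C 5 (X 23)))))))))"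

text \<open>Position \<open>{4,12} / {6,8} / {9}\<close>. The triple 4, 12, 16 excludes 16 from the
  front class.\<close>

definition cert38 :: cert where
  "cert38 =
  BC 16 cert35 (AB 2 (AB 10 (BC 11 (C 3 (B 1 (B 5 (C 7 (B 13 (X 19)))))) (C 1 (B 3 (B 5 (C 13 (C 7
  (C 14 (X 15)))))))) (Split 24 (BC 26 (Split 7 (C 18 (A 22 (C 20 (B 14 (A 15 (B 13 (X 17)))))))
  (C 17 (B 13 (C 15 (C 3 (A 5 (X 11)))))) (C 13 (B 21 (B 17 (C 14 (C 5 (B 3 (B 1 (X 11))))))))) (C
  18 (A 22 (B 28 (Split 5 (C 27 (B 3 (X 29))) (BC 7 (C 13 (X 21)) (C 17 (B 13 (X 15)))) (B 3 (C 1
  (B 7 (X 13))))))))) (Split 1 (BC 7 (C 17 (B 13 (X 15))) (C 13 (B 15 (B 17 (B 14 (C 5 (X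
  11))))))) (C 3 (A 7 (C 5 (C 13 (A 14 (C 15 (X 17))))))) (C 3 (C 11 (BC 7 (C 14 (B 15 (C 13 (C 20
  (X 22))))) (C 14 (B 15 (X 17))))))) (BC 13 (BC 15 (AC 11 (C 5 (C 14 (B 3 (B 1 (X 18))))) (C 17
  (B 22 (B 18 (B 1 (C 5 (X 20))))))) (C 5 (A 11 (C 25 (C 20 (AB 1 (B 3 (X 18)) (B 3 (X 18))))))))
  (BC 1 (C 3 (B 5 (B 14 (X 15)))) (C 3 (A 5 (C 7 (C 11 (X 18))))))))) (B 10 (Split 24 (Split 13
  (Split 11 (C 3 (C 1 (B 7 (B 5 (X 14))))) (C 1 (A 7 (X 14))) (C 1 (B 7 (B 14 (B 5 (X 15)))))) (C
  5 (A 7 (C 3 (B 11 (X 15))))) (C 7 (C 17 (C 1 (X 11))))) (BC 28 (C 18 (B 26 (B 17 (B 3 (C 11 (X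
  13)))))) (Split 1 (C 3 (C 11 (X 21))) (BC 15 (C 17 (B 11 (B 3 (X 14)))) (C 7 (C 13 (B 5 (C 3 (X
  21)))))) (B 14 (B 18 (C 21 (C 5 (X 11))))))) (BC 13 (BC 1 (B 3 (C 11 (C 5 (X 14)))) (C 7 (C 17
  (B 3 (C 5 (X 14)))))) (B 5 (AC 3 (C 7 (X 11)) (B 11 (B 15 (B 7 (C 14 (C 1 (X 17))))))))))))"

text \<open>Position \<open>{9,16} / {8,14,18} / {6,12}\<close>. The second class excludes 2 by
  \<open>2*2^2 + 8^2 + 18^2 = 2^2 + 2*14^2\<close>.\<close>

definition cert39 :: cert where
  "cert39 =
  AC 2 (AC 10 (BC 11 (C 5 (Split 4 (B 1 (A 3 (C 7 (X 15)))) (B 3 (C 7 (C 13 (C 19 (B 1 (X 29))))))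
  (C 13 (C 19 (B 1 (X 29)))))) (Split 19 (C 1 (A 5 (B 3 (C 15 (C 7 (A 13 (X 20))))))) (C 7 (C 28
  (AB 1 (B 5 (B 3 (B 4 (C 13 (C 15 (X 23)))))) (B 3 (B 4 (A 5 (C 13 (C 15 (X 23))))))))) (C 13 (B
  7 (C 22 (AB 1 (B 5 (B 3 (B 4 (X 23)))) (B 3 (B 4 (A 5 (X 23)))))))))) (Split 24 (B 28 (Split 7
  (C 20 (B 22 (B 26 (X 32)))) (C 19 (C 13 (B 1 (X 29)))) (C 21 (B 19 (C 13 (B 1 (B 11 (X
  22)))))))) (Split 15 (B 28 (C 30 (B 32 (AB 1 (B 3 (A 7 (B 5 (B 11 (X 13))))) (B 3 (B 7 (B 21 (B
  13 (X 25))))))))) (BC 5 (C 13 (B 19 (B 11 (C 3 (X 22))))) (C 11 (B 20 (B 13 (C 22 (C 3 (X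
  23))))))) (C 17 (C 13 (B 1 (A 5 (C 7 (X 22))))))) (BC 20 (C 30 (B 32 (B 28 (BC 21 (C 19 (C 13 (B
  3 (A 15 (X 25))))) (C 25 (C 27 (B 22 (B 1 (X 7))))))))) (C 30 (B 28 (BC 5 (C 7 (X 25)) (C 21 (B
  19 (B 7 (C 4 (X 11))))))))))) (BC 4 (Split 15 (BC 23 (C 13 (C 19 (B 21 (C 1 (X 7))))) (C 25
  (Split 24 (B 5 (A 7 (C 11 (C 3 (X 22))))) (B 22 (B 1 (X 17))) (BC 1 (C 3 (X 5)) (C 20 (X
  21)))))) (BC 13 (B 10 (C 5 (C 11 (B 7 (C 3 (B 19 (B 21 (B 17 (C 20 (X 22)))))))))) (C 19 (C 25
  (BC 7 (C 20 (C 5 (X 24))) (C 20 (C 21 (C 23 (X 27)))))))) (BC 1 (C 13 (B 5 (X 11))) (C 5 (X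
  13)))) (BC 24 (C 28 (Split 15 (C 17 (C 7 (A 19 (B 13 (X 25))))) (BC 7 (C 20 (B 26 (B 11 (B 17 (C
  1 (X 5)))))) (C 11 (A 17 (B 13 (C 3 (B 1 (X 26))))))) (B 17 (C 1 (B 5 (X 13)))))) (BC 7 (AC 23
  (Split 13 (BC 3 (C 11 (X 15)) (C 11 (B 15 (X 20)))) (C 5 (C 1 (C 11 (C 15 (X 20))))) (C 5 (A 11
  (C 1 (X 15))))) (C 21 (B 27 (AC 3 (B 11 (C 20 (B 13 (X 28)))) (C 13 (X 20)))))) (BC 1 (C 3 (B 11
  (C 5 (X 13)))) (C 3 (X 15))))))"

text \<open>Position \<open>{9,10} / {6,12,14} / {8,18}\<close>. The second class excludes 2 by
  \<open>2^2 + 6^2 + 2*14^2 = 3*12^2\<close>.\<close>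

definition cert40 :: cert where
  "cert40 =
  AC 2 (AC 4 (C 11 (AC 13 (C 3 (B 1 (BC 15 (C 22 (B 21 (X 27))) (C 20 (B 16 (X 25)))))) (B 5 (B 3
  (B 1 (BC 15 (B 19 (C 22 (C 21 (X 27)))) (C 20 (B 16 (X 22))))))))) (AC 3 (B 11 (C 1 (C 7 (BC 17
  (C 24 (C 19 (C 16 (C 5 (B 13 (C 15 (C 20 (X 21)))))))) (C 24 (B 5 (X 22))))))) (Split 27 (C 22
  (C 21 (A 24 (B 1 (B 11 (C 16 (C 17 (X 20)))))))) (C 7 (B 11 (B 1 (B 5 (BC 19 (C 20 (C 16 (X
  24))) (C 20 (C 17 (C 15 (X 16))))))))) (B 22 (BC 1 (C 5 (B 23 (B 20 (X 24)))) (C 15 (B 20 (B 11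
  (X 24))))))))) (AB 4 (BC 26 (C 24 (B 20 (A 22 (C 11 (C 15 (A 17 (C 16 (C 5 (A 13 (X 21))))))))))
  (C 16 (A 20 (B 30 (AB 3 (C 5 (C 17 (B 11 (C 15 (C 22 (X 27)))))) (C 11 (C 15 (B 5 (C 17 (B 21 (C
  13 (X 25)))))))))))) (AC 16 (BC 5 (BC 17 (B 11 (Split 24 (C 1 (C 7 (B 20 (X 26)))) (C 22 (C 20
  (B 1 (X 7)))) (C 22 (B 27 (C 15 (B 1 (C 7 (X 20)))))))) (Split 3 (C 30 (C 20 (A 26 (B 7 (B 1 (X
  11)))))) (C 11 (C 7 (B 1 (C 15 (X 20))))) (C 11 (A 21 (B 19 (C 20 (X 26))))))) (C 13 (C 15 (B 11
  (C 17 (X 25)))))) (BC 26 (Split 15 (C 11 (C 17 (B 19 (X 20)))) (C 19 (AC 7 (C 11 (B 5 (C 3 (C 22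
  (X 25))))) (B 11 (C 17 (X 24))))) (C 19 (C 1 (A 17 (B 13 (C 3 (X 20))))))) (C 28 (BC 15 (BC 1 (C
  3 (X 17)) (C 3 (C 5 (A 11 (B 7 (A 20 (C 17 (X 21)))))))) (C 23 (AC 5 (C 7 (B 11 (C 1 (C 3 (B 13
  (B 17 (C 20 (B 19 (C 21 (X 27)))))))))) (B 7 (A 11 (B 19 (C 17 (C 3 (X 13)))))))))))))"

text \<open>Position \<open>{6,12,25} / {8,13,18} / {9,14}\<close>.\<close>

definition cert41 :: cert where
  "cert41 =
  Split 7 (BC 22 (C 4 (A 11 (C 10 (C 5 (A 17 (B 2 (X 15))))))) (C 24 (C 19 (Split 3 (C 10 (A 16 (C
  1 (X 11)))) (C 4 (A 11 (C 10 (C 5 (X 17))))) (C 17 (B 1 (X 4))))))) (BC 20 (C 15 (A 16 (Split 24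
  (C 3 (C 1 (A 4 (X 5)))) (C 11 (C 3 (B 2 (A 10 (C 5 (X 17)))))) (C 11 (A 19 (C 1 (C 4 (C 2 (X
  10))))))))) (AC 15 (BC 4 (C 10 (C 27 (Split 24 (B 3 (C 1 (B 2 (X 22)))) (C 11 (C 22 (B 32 (C 23
  (B 5 (A 19 (B 2 (C 21 (X 26))))))))) (C 11 (C 1 (B 3 (X 19))))))) (B 16 (Split 1 (C 2 (C 19 (B
  11 (B 3 (X 24))))) (C 5 (C 3 (B 2 (X 19)))) (B 21 (C 24 (C 11 (A 28 (B 26 (B 10 (B 5 (C 3 (X
  17)))))))))))) (AB 16 (BC 24 (C 2 (B 30 (B 3 (B 4 (C 10 (X 11)))))) (C 30 (C 10 (B 11 (C 4 (X
  21)))))) (Split 10 (BC 19 (C 1 (A 17 (B 24 (B 11 (C 26 (X 27)))))) (C 24 (B 1 (A 11 (C 27 (AC 2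
  (C 22 (C 17 (X 26))) (C 5 (X 26)))))))) (C 5 (A 19 (C 27 (AC 3 (C 24 (X 26)) (B 22 (B 2 (A 24 (C
  23 (X 32))))))))) (B 4 (C 5 (A 19 (C 1 (A 11 (C 17 (C 3 (B 21 (X 22))))))))))))) (BC 4 (C 21 (AC
  2 (C 15 (X 16)) (B 16 (C 5 (C 1 (X 11)))))) (Split 16 (C 21 (AC 22 (C 17 (A 23 (A 28 (B 10 (C 1
  (X 19)))))) (B 24 (C 27 (B 19 (C 1 (A 17 (X 28)))))))) (C 15 (C 20 (B 2 (A 17 (X 24))))) (B 21
  (C 20 (C 3 (X 5))))))"

text \<open>Position \<open>{6,12,13} / {9,14} / {8,18}\<close>. The front class excludes 11 by
  \<open>3*11^2 + 12^2 = 3*13^2\<close>.\<close>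

definition cert42 :: cert where
  "cert42 =
  BC 11 (BC 15 (BC 4 (C 2 (A 10 (X 20))) (Split 24 (C 2 (A 10 (C 16 (C 7 (B 3 (B 1 (C 5 (X
  19)))))))) (C 22 (C 19 (A 25 (B 2 (A 5 (B 20 (X 27))))))) (B 2 (B 20 (C 3 (A 16 (A 22 (C 21 (C
  19 (X 23)))))))))) (Split 19 (B 5 (AC 1 (C 2 (C 4 (A 16 (B 21 (C 7 (X 10)))))) (B 2 (C 7 (B 10
  (B 3 (C 16 (B 4 (C 20 (X 23)))))))))) (B 5 (BC 1 (C 20 (B 16 (B 10 (X 17)))) (C 10 (C 7 (B 3 (C
  16 (X 20))))))) (C 1 (A 17 (C 24 (C 16 (B 2 (X 4)))))))) (AC 5 (BC 22 (Split 21 (BC 4 (C 23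
  (Split 16 (B 10 (B 15 (B 7 (B 17 (C 1 (X 3)))))) (B 10 (A 15 (C 3 (B 1 (A 17 (B 24 (X 28)))))))
  (B 25 (AC 1 (C 28 (B 17 (X 24))) (B 15 (X 20)))))) (C 7 (B 15 (B 17 (B 10 (C 3 (C 1 (X
  20)))))))) (Split 4 (C 23 (Split 24 (C 16 (B 20 (B 15 (B 17 (C 10 (C 1 (C 3 (C 7 (B 19 (X
  28)))))))))) (B 7 (AC 2 (C 16 (B 10 (X 28))) (B 15 (X 16)))) (B 15 (A 16 (X 19))))) (C 3 (A 16
  (B 17 (B 19 (X 20))))) (B 7 (BC 15 (C 16 (X 20)) (C 20 (A 24 (C 2 (C 16 (C 23 (B 3 (X
  25)))))))))) (C 7 (BC 15 (C 24 (C 26 (X 28))) (C 24 (C 2 (X 20)))))) (BC 19 (C 24 (Split 2 (C 15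
  (A 21 (C 26 (X 28)))) (BC 3 (C 4 (B 7 (B 16 (X 25)))) (C 17 (B 21 (B 7 (B 4 (X 16)))))) (B 27 (B
  3 (X 15))))) (C 24 (C 1 (A 7 (AC 3 (B 17 (C 2 (X 4))) (B 10 (X 16)))))))) (Split 16 (BC 1 (C 15
  (X 20)) (C 2 (A 10 (B 20 (B 15 (C 19 (C 4 (X 17)))))))) (BC 21 (C 24 (A 28 (B 2 (A 10 (B 1 (C 3
  (X 7))))))) (C 10 (C 4 (C 15 (C 2 (B 1 (X 3))))))) (Split 21 (Split 22 (BC 7 (C 2 (A 4 (X 20)))
  (C 24 (B 2 (B 17 (B 1 (B 15 (X 20))))))) (C 19 (A 20 (B 2 (X 27)))) (C 4 (X 10))) (C 7 (C 24 (BC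
  4 (C 22 (B 10 (X 20))) (C 10 (X 22))))) (C 20 (B 7 (C 15 (C 17 (C 10 (C 22 (C 24 (B 3 (X
  19))))))))))))"

text \<open>Position \<open>{9,14} / {8,18} / {6,12}\<close>. The front class excludes 13 by
  \<open>9^2 + 3*13^2 = 3*14^2\<close>.\<close>

definition cert43 :: cert where
  "cert43 =
  BC 13 (BC 25 (Split 16 (BC 15 (C 1 (C 7 (B 2 (X 4)))) (AC 20 (Split 4 (C 1 (A 22 (C 7 (A 10 (X
  11))))) (BC 19 (C 1 (A 27 (A 30 (C 2 (C 3 (X 11)))))) (C 24 (B 1 (C 2 (B 5 (C 3 (B 11 (X
  27)))))))) (B 22 (B 23 (C 5 (B 10 (C 11 (B 1 (X 2)))))))) (BC 7 (B 1 (C 4 (A 11 (B 2 (C 3 (X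
  10)))))) (C 17 (A 21 (C 22 (B 4 (B 2 (X 23))))))))) (Split 4 (BC 21 (C 24 (A 28 (B 10 (X 22))))
  (AC 22 (C 17 (A 23 (B 24 (B 10 (X 28))))) (B 24 (AB 2 (B 17 (X 28)) (C 27 (C 19 (C 1 (X
  28)))))))) (C 7 (A 24 (BC 1 (B 10 (X 28)) (C 11 (C 2 (X 15)))))) (C 2 (A 7 (B 24 (B 28 (C 32 (AC
  1 (C 15 (X 27)) (B 5 (X 15))))))))) (Split 19 (Split 15 (BC 21 (C 7 (B 20 (B 4 (C 3 (C 10 (X
  22)))))) (C 1 (A 20 (B 28 (B 7 (B 2 (X 5))))))) (C 20 (B 17 (B 4 (B 1 (A 2 (C 3 (X 24))))))) (C
  2 (A 4 (X 17)))) (C 4 (C 22 (BC 2 (C 20 (C 3 (B 24 (C 5 (X 10))))) (C 24 (B 10 (C 3 (B 20 (C 7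
  (C 11 (A 15 (X 17))))))))))) (C 2 (C 24 (Split 7 (BC 1 (C 3 (X 11)) (C 10 (B 3 (B 4 (X 11)))))
  (C 4 (A 20 (C 21 (C 22 (X 27))))) (C 10 (A 20 (C 15 (C 17 (C 22 (C 21 (C 27 (C 4 (C 1 (A 5 (X
  11)))))))))))))))) cert41) cert42"

text \<open>Position \<open>{3,6,12,27} / {9,18,24} / {8}\<close>.\<close>

definition cert44 :: cert where
  "cert44 =
  Split 14 (BC 22 (BC 17 (C 26 (A 30 (C 16 (B 10 (A 11 (B 20 (B 4 (X 23)))))))) (AB 7 (B 21 (B 10
  (C 15 (B 23 (A 30 (C 2 (X 20))))))) (B 21 (X 23)))) (AB 30 (C 2 (B 23 (B 7 (B 11 (A 21 (B 5 (B 1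
  (A 4 (B 10 (X 20)))))))))) (BC 17 (C 15 (B 21 (B 7 (X 23)))) (C 1 (A 2 (AB 4 (B 21 (B 11 (X
  15))) (B 10 (X 15)))))))) (BC 4 (C 2 (A 5 (A 13 (A 16 (C 21 (C 15 (C 22 (X 30)))))))) (AC 5 (AB
  21 (C 13 (A 16 (B 2 (X 23)))) (BC 20 (C 15 (B 30 (B 10 (X 25)))) (C 7 (A 13 (B 15 (B 2 (A 23 (X
  30)))))))) (B 13 (A 16 (C 21 (C 15 (C 10 (A 20 (X 30))))))))) (AC 21 (BC 7 (BC 16 (C 5 (A 11 (B
  1 (B 2 (B 4 (C 15 (X 17))))))) (B 28 (BC 20 (C 1 (A 5 (X 11))) (B 29 (C 13 (C 1 (A 5 (X
  23)))))))) (BC 16 (C 11 (C 5 (C 4 (B 13 (X 19))))) (BC 19 (C 20 (C 13 (B 11 (C 2 (B 4 (A 10 (X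
  23))))))) (C 4 (B 5 (C 11 (AB 1 (C 10 (C 13 (X 20))) (C 13 (C 10 (X 17)))))))))) (BC 15 (BC 11
  (C 17 (AB 5 (C 4 (A 7 (C 13 (X 22)))) (C 19 (C 1 (X 13))))) (C 5 (C 13 (X 19)))) (C 30 (Split 2
  (BC 22 (Split 7 (BC 4 (C 20 (B 10 (A 11 (B 23 (B 1 (C 19 (X 29))))))) (C 11 (X 25))) (C 23 (C 26
  (C 1 (B 29 (B 11 (C 25 (B 4 (B 19 (X 20))))))))) (C 25 (C 11 (B 13 (C 4 (B 5 (X 20))))))) (C 26
  (C 17 (B 28 (BC 1 (B 29 (B 4 (C 19 (X 20)))) (C 5 (C 29 (B 4 (X 20))))))))) (BC 4 (C 20 (B 11 (B
  25 (X 28)))) (C 11 (X 25))) (BC 20 (C 28 (AC 4 (B 7 (C 10 (B 22 (X 23)))) (B 10 (C 11 (X 25)))))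
  (C 7 (A 23 (C 16 (B 5 (A 29 (C 17 (B 4 (X 28)))))))))))))"

text \<open>Position \<open>{6,12,24,27} / {9,18} / {8}\<close>. Three times
  \<open>2*7^2 + 8^2 = 2*9^2\<close> excludes 21 from the front class.\<close>

definition cert45 :: cert where
  "cert45 =
  BC 21 (C 3 (A 15 (Split 11 (BC 4 (C 13 (B 5 (B 7 (X 14)))) (C 7 (X 14))) (C 17 (BC 1 (C 10 (B 19
  (C 7 (X 20)))) (C 2 (C 4 (X 7))))) (BC 7 (C 13 (B 14 (B 16 (X 28)))) (C 14 (A 16 (B 13 (C 4 (X
  19))))))))) (AC 3 (BC 25 (BC 4 (C 2 (A 11 (B 7 (A 15 (B 10 (C 1 (X 17))))))) (AC 11 (C 2 (A 10
  (C 5 (C 1 (X 7))))) (BC 5 (B 7 (B 10 (X 15))) (C 13 (A 23 (C 15 (B 7 (B 1 (X 10))))))))) (Split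
  16 (B 15 (AC 7 (C 14 (X 28)) (B 14 (C 11 (B 1 (X 20)))))) (Split 4 (BC 13 (C 14 (X 19)) (C 5 (A
  11 (A 19 (B 14 (B 2 (X 17))))))) (C 5 (C 13 (C 23 (C 11 (B 1 (X 28)))))) (C 5 (A 23 (C 14 (B 28
  (C 1 (A 11 (C 10 (X 19))))))))) (BC 4 (C 19 (C 5 (B 13 (C 11 (B 2 (X 10)))))) (C 2 (A 11 (B 15
  (C 17 (C 1 (B 5 (X 13)))))))))) (Split 4 (BC 1 (C 13 (B 5 (A 19 (C 11 (X 23))))) (C 19 (C 17 (B
  7 (C 11 (X 14)))))) (BC 19 (Split 5 (B 15 (C 13 (C 11 (BC 14 (B 17 (C 20 (X 29))) (C 28 (B 2 (A
  16 (C 23 (C 1 (B 7 (C 10 (X 20)))))))))))) (C 13 (C 15 (BC 10 (B 16 (C 7 (X 14))) (B 23 (C 16 (X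
  22)))))) (C 13 (C 15 (B 10 (B 23 (C 1 (A 16 (B 17 (X 20))))))))) (BC 13 (C 15 (A 16 (B 7 (X
  28)))) (C 14 (B 7 (B 16 (A 20 (C 25 (C 11 (X 28))))))))) (BC 28 (C 16 (AB 2 (B 5 (C 1 (C 17 (C 7
  (X 15))))) (B 15 (C 1 (X 17))))) (C 7 (A 14 (B 16 (C 13 (C 11 (C 2 (X 25))))))))))"

text \<open>Position \<open>{8,14,16,27} / {9,18,23} / {6,12}\<close>. The triple 8, 16, 24 excludes
  24 from the front class.\<close>

definition cert46 :: cert where
  "cert46 =
  BC 24 (Split 19 (BC 13 (C 3 (A 15 (A 28 (B 17 (B 2 (B 1 (X 26))))))) (C 11 (B 15 (B 2 (B 17 (X
  26)))))) (BC 4 (C 11 (A 15 (C 2 (C 17 (B 10 (C 3 (X 20))))))) (C 7 (B 11 (X 15)))) (BC 17 (C 1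
  (C 3 (Split 20 (B 11 (A 25 (X 30))) (B 2 (X 11)) (C 10 (C 25 (X 31)))))) (B 2 (C 15 (C 4 (X
  21)))))) (Split 19 (Split 21 (BC 10 (AC 17 (C 2 (A 28 (C 15 (C 26 (C 5 (B 1 (X 13))))))) (Split
  15 (B 13 (B 28 (B 1 (A 2 (C 3 (B 4 (B 20 (X 29)))))))) (B 1 (A 5 (A 13 (C 20 (C 4 (X 29)))))) (B
  31 (C 4 (AB 5 (B 26 (X 28)) (C 29 (C 20 (C 11 (B 2 (B 1 (C 3 (X 30)))))))))))) (C 28 (B 13 (B 5
  (C 20 (C 4 (X 11))))))) (C 13 (AC 5 (C 29 (B 7 (A 11 (B 28 (C 2 (C 1 (B 4 (B 3 (C 25 (X
  31)))))))))) (B 11 (B 28 (B 31 (C 4 (B 3 (B 1 (X 2))))))))) (C 1 (C 3 (A 15 (B 26 (C 2 (C 7 (B 5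
  (A 13 (C 4 (X 29))))))))))) (BC 29 (C 7 (A 11 (B 20 (C 10 (C 3 (X 21)))))) (Split 22 (C 4 (B 7
  (B 11 (X 21)))) (C 5 (AC 1 (C 2 (A 4 (X 11))) (B 7 (B 3 (X 4))))) (B 26 (B 21 (B 7 (B 4 (B 11 (C
  10 (X 31))))))))) (BC 28 (BC 22 (C 20 (C 11 (B 7 (X 13)))) (AC 2 (B 1 (C 7 (C 20 (C 13 (C 5 (X
  29)))))) (B 4 (C 13 (C 5 (B 7 (X 29))))))) (C 13 (C 31 (BC 4 (B 21 (C 3 (X 32))) (B 5 (A 11 (C
  29 (C 1 (B 15 (C 21 (C 7 (X 26)))))))))))))"

text \<open>Position \<open>{6,12,23} / {8,14,27} / {9,18}\<close>. The front class excludes 13 by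
  \<open>3*12^2 + 13^2 = 2*6^2 + 23^2\<close>.\<close>

definition cert47 :: cert where
  "cert47 =
  BC 13 (Split 21 (BC 16 (C 4 (A 7 (B 1 (B 19 (X 20))))) (C 28 (AB 1 (B 7 (B 20 (X 24))) (B 11 (B
  7 (X 15)))))) (BC 11 (Split 16 (C 26 (C 28 (B 19 (B 24 (C 4 (C 20 (X 22))))))) (C 3 (A 19 (C 4
  (B 20 (X 22))))) (C 28 (B 19 (AC 2 (B 3 (C 7 (C 20 (X 22)))) (B 26 (C 24 (C 5 (A 10 (C 20 (X
  22)))))))))) (Split 7 (C 2 (C 24 (BC 5 (C 26 (B 16 (B 22 (X 29)))) (C 29 (C 4 (X 28)))))) (BC 1
  (C 16 (B 28 (B 26 (C 5 (C 3 (X 24)))))) (C 26 (X 28))) (B 22 (A 26 (C 20 (C 16 (B 24 (X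
  28)))))))) (BC 15 (BC 2 (C 7 (B 4 (X 11))) (C 4 (X 16))) (BC 22 (Split 20 (BC 11 (C 2 (A 10 (B 3
  (B 19 (C 4 (X 7)))))) (C 19 (X 29))) (C 10 (B 3 (C 25 (C 11 (X 28))))) (C 3 (C 32 (AB 7 (B 19 (X
  28)) (C 5 (C 2 (A 4 (X 11)))))))) (Split 20 (B 3 (AC 2 (C 4 (A 7 (X 19))) (B 7 (B 4 (X 11)))))
  (C 29 (C 5 (B 16 (C 4 (X 7))))) (C 29 (B 7 (B 4 (C 11 (X 19))))))))) (BC 19 (BC 29 (Split 24 (C
  11 (AC 3 (C 5 (B 16 (C 1 (X 17)))) (B 16 (A 22 (B 5 (C 7 (X 21))))))) (C 5 (C 15 (B 17 (B 7 (B 1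
  (AB 2 (C 16 (C 3 (X 20))) (C 3 (C 11 (X 28))))))))) (B 2 (B 1 (C 16 (B 5 (C 3 (X 21))))))) (C 17
  (A 25 (C 4 (C 15 (C 11 (C 21 (X 22)))))))) (Split 16 (BC 21 (C 4 (B 7 (C 2 (C 15 (X 22))))) (C
  11 (AC 2 (B 4 (X 7)) (B 22 (C 4 (B 7 (X 29))))))) (BC 1 (C 15 (A 17 (C 22 (C 4 (C 5 (X 20))))))
  (C 7 (B 15 (C 22 (B 20 (X 24)))))) (C 20 (BC 1 (C 3 (C 4 (C 21 (X 22)))) (C 22 (B 3 (X 10)))))))"

text \<open>Position \<open>{9,14,18} / {8,27} / {6,12}\<close>. The front class excludes 16 by
  \<open>2*14^2 + 16^2 = 2*18^2\<close>.\<close>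

definition cert48 :: cert where
  "cert48 =
  BC 16 (BC 24 (BC 13 (AC 4 (C 3 (AB 22 (B 23 (B 5 (C 11 (B 15 (B 19 (C 17 (C 1 (X 2)))))))) (B 5
  (C 7 (B 19 (X 21)))))) (B 2 (B 3 (B 5 (B 22 (X 23)))))) (C 5 (B 22 (B 23 (C 7 (B 11 (C 3 (A 19
  (B 10 (B 21 (C 15 (X 20)))))))))))) (AB 13 (Split 22 (BC 26 (C 5 (B 23 (AC 4 (B 15 (X 19)) (C 21
  (C 3 (A 7 (X 15))))))) (C 28 (B 31 (B 11 (B 5 (C 4 (B 19 (X 21)))))))) (C 5 (X 23)) (C 19 (B 11
  (C 20 (C 15 (C 3 (C 4 (X 21)))))))) (BC 15 (Split 4 (BC 1 (C 25 (A 32 (B 28 (X 29)))) (C 29 (B 5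
  (X 28)))) (BC 29 (Split 22 (BC 28 (C 11 (A 20 (B 17 (C 1 (A 2 (C 3 (X 25))))))) (C 26 (B 11 (C 5
  (B 19 (B 1 (X 25))))))) (C 7 (C 21 (B 23 (B 5 (B 19 (C 20 (B 11 (C 2 (X 28))))))))) (B 19 (C 20
  (C 5 (X 23))))) (BC 1 (C 32 (C 17 (BC 5 (C 20 (C 10 (A 23 (C 28 (B 2 (B 3 (X 11))))))) (C 20 (A
  22 (C 3 (X 28))))))) (B 19 (A 25 (C 20 (C 5 (C 11 (C 7 (C 22 (X 28)))))))))) (BC 5 (C 7 (BC 19
  (C 21 (A 22 (C 10 (A 17 (B 2 (X 26)))))) (B 10 (C 22 (X 26))))) (C 29 (B 7 (AC 11 (C 20 (C 17 (X
  22))) (C 17 (X 19))))))) (C 21 (AC 11 (C 20 (C 23 (X 32))) (B 20 (C 28 (C 2 (C 19 (C 17 (C 5 (C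
  22 (X 26))))))))))))) (BC 4 (Split 19 (C 2 (AC 24 (C 17 (B 7 (B 25 (B 5 (B 3 (X 26)))))) (B 10
  (A 22 (B 5 (X 31)))))) (C 5 (A 29 (B 7 (B 3 (C 11 (X 20)))))) (B 20 (BC 3 (C 15 (B 7 (C 2 (C 1
  (A 5 (C 10 (X 11))))))) (C 5 (A 7 (B 11 (A 15 (X 17)))))))) (AB 13 (Split 5 (C 20 (C 15 (AB 3 (B
  25 (B 19 (B 21 (X 29)))) (B 21 (X 25))))) (C 3 (A 19 (B 21 (BC 2 (B 15 (C 10 (X 25))) (C 25 (B
  20 (C 22 (X 24)))))))) (C 29 (B 19 (B 15 (B 21 (B 3 (C 7 (A 24 (C 20 (X 25)))))))))) (BC 5 (C 20
  (AC 3 (B 2 (C 25 (B 21 (B 15 (X 24))))) (B 19 (C 7 (B 28 (C 17 (X 26))))))) (C 23 (B 20 (B 7 (C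
  24 (A 29 (BC 1 (C 3 (B 2 (X 21))) (C 2 (X 3)))))))))))"

text \<open>Position \<open>{6,12,14} / {8,27} / {9,18}\<close>. The front class excludes 4 by
  \<open>3*6^2 + 14^2 = 4^2 + 2*12^2\<close>.\<close>

definition cert49 :: cert where
  "cert49 =
  BC 4 (AC 11 (Split 16 (BC 3 (AC 21 (C 25 (A 28 (C 1 (B 17 (C 19 (B 20 (B 15 (X 26)))))))) (B 15
  (BC 7 (C 2 (C 28 (C 17 (A 19 (X 24))))) (C 22 (B 23 (C 13 (C 19 (X 20)))))))) (C 21 (A 24 (B 20
  (X 25))))) (C 20 (A 28 (C 26 (B 2 (C 1 (X 3)))))) (C 28 (B 21 (B 3 (C 7 (B 15 (C 19 (C 5 (A 10
  (B 17 (X 22))))))))))) (AB 2 (BC 17 (C 15 (B 7 (C 5 (C 29 (C 20 (C 23 (C 24 (C 28 (B 1 (B 3 (C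
  10 (X 13)))))))))))) (AC 3 (C 7 (A 20 (C 5 (A 19 (B 16 (X 22)))))) (C 19 (C 13 (B 5 (C 20 (X
  24))))))) (BC 3 (BC 24 (C 16 (C 20 (B 17 (X 21)))) (Split 13 (B 29 (C 5 (B 19 (A 20 (B 10 (X
  22)))))) (C 20 (C 19 (C 1 (C 10 (C 25 (X 31)))))) (B 21 (C 25 (C 20 (X 22)))))) (Split 20 (C 25
  (C 22 (B 17 (A 24 (B 1 (X 19)))))) (C 1 (A 5 (C 24 (B 25 (C 10 (C 15 (C 23 (B 19 (A 29 (B 30 (X
  31))))))))))) (BC 17 (C 21 (C 19 (B 1 (X 22)))) (C 21 (C 22 (X 25)))))))) (AC 11 (C 2 (A 10
  (Split 22 (C 5 (A 24 (C 31 (C 23 (B 20 (X 21)))))) (BC 13 (C 3 (B 5 (B 25 (C 20 (C 1 (X 21))))))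
  (C 5 (B 3 (B 7 (B 29 (B 24 (B 16 (C 17 (X 20))))))))) (B 24 (C 20 (C 15 (X 21))))))) (BC 20
  (Split 21 (B 2 (AC 16 (C 17 (C 19 (B 24 (C 13 (B 3 (X 26)))))) (C 26 (C 28 (C 13 (B 7 (C 10 (C 1
  (X 19))))))))) (BC 3 (C 5 (X 13)) (C 5 (C 7 (C 16 (X 17))))) (C 17 (Split 3 (C 2 (B 10 (C 1 (C 7
  (B 5 (X 16)))))) (C 25 (C 5 (B 7 (B 2 (C 16 (X 19)))))) (C 15 (C 5 (C 7 (X 23))))))) (BC 24 (C
  16 (B 10 (C 21 (C 26 (C 17 (X 23)))))) (Split 17 (C 2 (A 22 (C 1 (B 3 (X 19))))) (C 3 (C 5 (X
  13))) (C 25 (B 3 (C 15 (X 21))))))))"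

text \<open>Position \<open>{6,12,27} / {9,18} / {8}\<close>. If 24 joins 9 and 18, then 3 is
  expelled by \<open>2*3^2 + 2*18^2 = 3^2 + 9^2 + 24^2\<close>.\<close>

definition cert50 :: cert where
  "cert50 =
  Split 24 cert45 (BC 3 cert44 (Split 4 (BC 13 (Split 16 (C 1 (A 5 (B 2 (A 11 (C 19 (C 20 (X
  23))))))) (C 19 (C 1 (B 11 (C 7 (X 20))))) (B 2 (B 1 (C 19 (C 20 (C 11 (X 21))))))) (C 5 (A 11
  (B 1 (B 2 (C 19 (X 23))))))) (BC 11 (BC 5 (C 13 (Split 1 (C 7 (C 10 (B 2 (C 15 (A 16 (X 17))))))
  (C 23 (C 21 (B 15 (B 7 (X 14))))) (B 7 (C 10 (X 16))))) (C 13 (BC 19 (C 17 (C 16 (B 1 (X 20))))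
  (C 22 (C 16 (C 15 (C 7 (X 14)))))))) (C 14 (Split 5 (C 7 (C 1 (B 10 (B 15 (C 2 (X 20)))))) (BC 1
  (C 2 (X 10)) (C 7 (B 10 (B 2 (B 13 (C 17 (X 22))))))) (B 7 (A 13 (BC 1 (C 15 (X 21)) (C 10 (B 2
  (X 16))))))))) (BC 2 (Split 5 (C 7 (C 11 (C 16 (C 13 (C 1 (B 10 (X 20))))))) (C 1 (AC 11 (C 13
  (X 16)) (B 13 (B 7 (X 16))))) (B 14 (B 23 (C 1 (C 16 (B 13 (B 29 (C 19 (B 11 (X 15)))))))))) (C
  14 (A 23 (B 16 (B 7 (BC 1 (C 10 (A 20 (C 15 (X 17)))) (C 5 (B 10 (C 13 (X 19)))))))))))) (BC 16
  (BC 19 (BC 13 (BC 21 (C 4 (A 5 (B 7 (X 11)))) (AC 11 (C 20 (B 4 (B 2 (A 5 (C 10 (X 15)))))) (C 3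
  (C 5 (A 20 (C 2 (B 10 (B 7 (B 4 (C 14 (X 32))))))))))) (AB 4 (BC 5 (C 21 (B 3 (C 11 (X 15)))) (C
  3 (A 22 (B 14 (C 10 (X 11)))))) (B 20 (AB 2 (C 21 (C 3 (X 11))) (C 3 (A 14 (X 22))))))) (AC 4 (C
  2 (BC 14 (C 17 (C 7 (B 25 (B 5 (B 3 (X 15)))))) (B 26 (C 10 (B 11 (C 15 (A 17 (B 3 (X
  13))))))))) (B 20 (Split 21 (B 2 (C 3 (B 7 (B 22 (X 23))))) (C 13 (B 7 (B 22 (C 23 (X 28))))) (C
  13 (C 3 (B 2 (X 25)))))))) (BC 14 (BC 2 (Split 4 (C 32 (C 19 (B 7 (B 11 (B 3 (X 10)))))) (Split
  21 (C 7 (A 28 (C 25 (B 20 (C 3 (X 15)))))) (C 20 (C 29 (C 23 (B 19 (C 7 (B 1 (X 15))))))) (B 3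
  (C 15 (C 5 (X 13))))) (C 7 (C 25 (B 23 (X 29))))) (Split 7 (B 28 (C 21 (B 3 (A 4 (X 15))))) (C
  25 (AB 4 (C 19 (X 32)) (C 20 (X 23)))) (C 25 (C 21 (B 15 (C 3 (C 11 (X 20)))))))) (BC 4 (C 10 (C
  32 (BC 2 (C 22 (B 11 (C 17 (C 19 (X 26))))) (C 11 (A 19 (C 3 (X 20))))))) (Split 3 (C 2 (A 11 (C
  1 (C 10 (X 26))))) (C 20 (C 7 (B 23 (C 19 (X 25))))) (B 2 (AB 10 (C 28 (B 21 (C 22 (C 17 (B 19
  (B 13 (X 20))))))) (C 17 (C 19 (X 21)))))))))"

text \<open>Position \<open>{8,18} / {6,12} / {9}\<close>. If 14 joins 18, then 16 is expelled; if
  it joins 6 and 12, \<open>6^2 + 2*10^2 + 14^2 = 3*12^2\<close> expels 10.\<close>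

definition cert51 :: cert where
  "cert51 =
  Split 14 (BC 16 (C 2 (AC 4 (AB 10 (BC 5 (C 13 (X 19)) (C 11 (B 13 (B 19 (B 1 (C 15 (X 20)))))))
  (Split 15 (C 11 (C 5 (B 7 (B 24 (C 25 (C 3 (C 13 (X 21)))))))) (Split 25 (C 20 (X 24)) (C 23 (C
  27 (B 22 (B 24 (B 21 (C 1 (B 3 (X 11)))))))) (C 23 (B 19 (C 20 (B 22 (C 3 (B 5 (C 7 (C 11 (C 17
  (X 21))))))))))) (B 11 (C 1 (X 13))))) (BC 22 (AC 10 (C 24 (AC 3 (C 27 (C 7 (AB 5 (B 19 (C 11 (X
  13))) (C 11 (X 13))))) (B 13 (C 5 (B 1 (B 11 (C 7 (X 20)))))))) (B 24 (B 28 (Split 3 (C 13 (C 5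
  (X 19))) (C 30 (B 20 (BC 1 (C 15 (B 7 (X 11))) (C 7 (X 11))))) (B 13 (C 5 (X 11))))))) (C 10 (A
  24 (A 28 (C 20 (C 26 (AB 3 (B 17 (X 19)) (B 19 (C 1 (X 5)))))))))))) cert39) (BC 10 (Split 20 (C
  2 (A 4 (B 11 (BC 1 (C 13 (A 15 (C 7 (B 3 (C 5 (A 19 (X 22))))))) (B 3 (C 7 (C 5 (B 15 (X
  16))))))))) (C 16 (A 22 (A 24 (C 26 (C 28 (X 32)))))) (AC 16 (AC 24 (B 4 (A 11 (C 1 (C 3 (B 15
  (X 23)))))) (B 22 (BC 5 (C 7 (A 13 (C 4 (X 15)))) (C 13 (BC 4 (C 23 (B 19 (B 2 (X 11)))) (B 15
  (C 7 (X 25)))))))) (BC 26 (AB 22 (C 11 (C 24 (Split 13 (B 17 (C 2 (A 7 (C 21 (C 25 (X 27))))))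
  (B 17 (C 5 (X 15))) (C 2 (A 4 (C 17 (C 1 (X 3)))))))) (B 24 (BC 30 (Split 15 (BC 3 (C 21 (A 25
  (B 2 (X 4)))) (AC 2 (C 4 (X 25)) (B 21 (B 4 (X 25))))) (BC 1 (C 3 (A 5 (C 2 (X 11)))) (C 3 (B 5
  (C 13 (X 19))))) (BC 1 (C 5 (X 19)) (C 5 (X 17)))) (B 2 (X 32))))) (C 2 (A 28 (AC 22 (B 11 (C 24
  (A 31 (B 13 (C 5 (X 32)))))) (B 24 (BC 21 (C 17 (C 1 (X 15))) (B 11 (B 4 (C 3 (X 17))))))))))))
  cert40) cert43"

text \<open>Position \<open>{3,8,16} / {4,12} / {6,9}\<close>. The triple 8, 16, 24 excludes 24 from
  the front class.\<close>

definition cert52 :: cert where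
  "cert52 =
  BC 24 (Split 21 (Split 14 (BC 2 (C 13 (A 18 (B 27 (A 32 (B 5 (C 17 (X 19))))))) (AC 11 (C 18 (B
  28 (AB 7 (B 27 (B 15 (B 22 (X 25)))) (B 5 (A 13 (C 10 (X 20))))))) (B 5 (C 1 (B 7 (A 13 (A 17 (C
  18 (X 22))))))))) (C 13 (A 18 (B 27 (X 32)))) (C 5 (X 13))) (BC 23 (C 5 (A 17 (C 18 (C 14 (C 2
  (B 1 (B 7 (B 10 (B 11 (C 20 (X 26))))))))))) (AB 18 (AC 5 (C 17 (B 1 (C 2 (A 19 (C 20 (C 13 (X
  32))))))) (C 27 (C 13 (C 19 (B 11 (C 28 (C 14 (B 2 (X 32))))))))) (B 28 (C 10 (B 2 (B 11 (B 5 (X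
  14)))))))) (C 18 (B 28 (C 10 (B 2 (B 14 (C 20 (X 26)))))))) (BC 18 (BC 10 (AC 14 (C 28 (C 32 (B
  19 (B 17 (B 5 (X 13)))))) (Split 17 (C 23 (B 22 (C 21 (X 28)))) (B 2 (C 11 (B 1 (C 5 (X 7)))))
  (C 11 (C 21 (C 7 (C 13 (C 1 (B 15 (B 20 (X 25)))))))))) (C 2 (B 14 (Split 21 (C 17 (C 13 (X
  19))) (C 20 (C 15 (X 28))) (C 11 (C 17 (X 25))))))) (BC 11 (Split 21 (Split 17 (BC 1 (C 7 (B 15
  (B 13 (X 25)))) (C 2 (X 10))) (C 23 (AC 7 (B 15 (A 20 (C 1 (X 5)))) (C 14 (C 13 (B 15 (A 22 (B
  20 (X 27)))))))) (C 15 (B 25 (C 13 (C 2 (X 7)))))) (BC 13 (C 29 (C 19 (AB 20 (B 23 (B 14 (C 22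
  (C 7 (X 15))))) (C 15 (AC 5 (C 7 (C 14 (X 23))) (C 22 (X 23))))))) (Split 7 (C 15 (C 25 (B 5 (X
  20)))) (C 14 (C 15 (X 17))) (C 14 (C 23 (C 15 (C 5 (C 25 (B 17 (X 27))))))))) (C 25 (C 5 (B 23
  (B 17 (B 1 (C 2 (X 20)))))))) (BC 13 (C 5 (A 21 (B 1 (X 19)))) (C 19 (B 17 (B 1 (B 7 (B 5 (C 2
  (X 22))))))))))"

text \<open>Position \<open>{3,4,8} / {6,9} / {12}\<close>. The front class excludes 13 by
  \<open>3^2 + 3*8^2 = 2*4^2 + 13^2\<close>.\<close>

definition cert53 :: cert where
  "cert53 =
  BC 13 (AC 1 (BC 16 (Split 18 (C 14 (C 11 (AB 2 (B 5 (A 22 (B 19 (X 24)))) (B 24 (B 19 (C 17 (C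
  15 (C 7 (X 21))))))))) (C 2 (A 19 (C 15 (B 14 (X 24))))) (C 24 (B 19 (C 17 (BC 2 (B 10 (B 14 (C
  5 (A 11 (A 15 (B 21 (C 7 (B 20 (X 25))))))))) (C 5 (B 15 (C 22 (X 23))))))))) (BC 20 (B 5 (Split
  22 (B 2 (C 15 (C 17 (B 10 (X 19))))) (B 2 (X 11)) (B 18 (C 2 (C 14 (C 17 (X 19))))))) (BC 19 (C
  29 (AB 5 (B 2 (C 18 (C 15 (X 22)))) (B 11 (B 24 (AB 2 (C 14 (C 7 (B 18 (X 22)))) (C 18 (X
  22))))))) (C 24 (C 18 (B 10 (C 22 (B 15 (B 5 (X 26)))))))))) (AB 11 (B 5 (C 14 (Split 18 (C 10
  (C 2 (B 16 (B 22 (C 7 (X 20)))))) (BC 16 (C 19 (B 17 (B 20 (X 21)))) (C 20 (B 19 (X 29)))) (B 16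
  (C 24 (C 21 (X 23))))))) (AB 2 (Split 24 (BC 20 (C 16 (B 19 (B 17 (B 21 (B 27 (X 29)))))) (C 19
  (B 17 (B 29 (C 5 (C 16 (B 7 (C 14 (X 15))))))))) (C 18 (B 22 (B 14 (C 28 (AC 5 (C 10 (X 16)) (C
  23 (C 19 (X 25)))))))) (BC 16 (C 5 (C 7 (B 18 (A 19 (B 10 (X 22)))))) (C 20 (BC 14 (B 5 (C 18 (A
  19 (C 17 (X 21))))) (C 22 (B 21 (C 7 (C 25 (C 10 (B 17 (X 23))))))))))) (AB 5 (C 14 (AC 16 (BC
  15 (C 19 (B 18 (X 24))) (C 18 (B 23 (X 24)))) (B 7 (A 17 (C 15 (X 20)))))) (Split 24 (C 17 (AB 7
  (C 18 (B 10 (B 14 (X 21)))) (C 15 (C 19 (B 16 (X 20)))))) (C 14 (AC 17 (B 10 (C 22 (C 7 (C 15 (C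
  18 (X 20)))))) (B 18 (C 10 (X 22))))) (C 16 (C 20 (C 17 (C 15 (B 14 (X 18))))))))))) (C 5 (A 11
  (AB 1 (B 2 (Split 24 (C 14 (AC 17 (B 10 (C 15 (X 22))) (B 18 (C 10 (X 22))))) (BC 16 (C 18 (X
  22)) (C 19 (B 17 (C 15 (C 21 (C 29 (B 20 (X 27)))))))) (B 16 (C 20 (C 18 (X 22)))))) (BC 19
  (Split 20 (B 2 (C 7 (A 14 (B 10 (B 15 (X 17)))))) (C 16 (B 24 (B 14 (X 18)))) (C 24 (B 18 (BC 2
  (B 14 (C 7 (C 10 (X 16)))) (C 22 (X 26)))))) (BC 16 (C 20 (B 21 (X 28))) (C 20 (C 15 (B 10 (B 14
  (B 22 (X 23)))))))))))"

text \<open>Position \<open>{4,6,9} / {3,8} / {12}\<close>. The front class excludes 5 by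
  \<open>4^2 + 5^2 + 2*6^2 = 2*4^2 + 9^2\<close>.\<close>

definition cert54 :: cert where
  "cert54 =
  BC 5 (BC 1 (C 7 (B 11 (BC 10 (Split 20 (C 15 (C 14 (C 17 (C 2 (B 13 (C 19 (C 22 (X 30))))))))
  (BC 13 (C 14 (X 15)) (C 16 (A 19 (B 17 (B 15 (X 24)))))) (B 15 (B 13 (BC 16 (B 2 (C 14 (X 17)))
  (C 17 (C 2 (C 14 (B 18 (X 25))))))))) (C 2 (A 13 (A 15 (C 14 (C 20 (BC 16 (B 18 (B 22 (X 24)))
  (C 21 (C 18 (X 22)))))))))))) (C 7 (AB 11 (BC 10 (Split 20 (C 14 (C 15 (B 16 (C 13 (C 18 (C 19
  (C 21 (X 22)))))))) (BC 13 (C 16 (A 18 (B 2 (X 14)))) (C 16 (Split 26 (B 14 (B 23 (B 2 (B 18 (B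
  21 (C 22 (A 24 (X 28)))))))) (B 18 (B 2 (A 14 (B 23 (B 21 (C 22 (A 24 (X 28)))))))) (B 19 (C 14
  (X 23)))))) (Split 17 (B 13 (C 15 (X 16))) (B 2 (B 14 (B 13 (C 19 (X 21))))) (C 15 (C 13 (B 21
  (C 27 (C 18 (C 14 (X 28))))))))) (C 2 (A 13 (X 14)))) (C 13 (A 14 (Split 18 (B 2 (C 10 (B 15 (B
  19 (A 20 (B 16 (A 25 (C 21 (X 24))))))))) (C 16 (B 15 (C 2 (X 24)))) (C 16 (A 19 (B 15 (B 10 (X
  23))))))))))) (BC 13 (BC 10 (C 15 (AB 7 (C 11 (C 1 (C 2 (A 14 (B 17 (X 19)))))) (B 2 (C 1 (B 11
  (X 14)))))) (AC 7 (C 2 (C 11 (B 1 (X 14)))) (C 1 (C 11 (AC 16 (C 19 (B 14 (B 15 (C 17 (X 24)))))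
  (B 2 (A 14 (B 15 (C 18 (X 24)))))))))) (BC 11 (B 2 (C 1 (X 10))) (BC 2 (C 10 (C 15 (B 1 (C 14 (B
  23 (C 18 (X 24))))))) (Split 1 (C 10 (C 14 (B 7 (C 15 (X 20))))) (Split 20 (BC 7 (C 10 (X 14))
  (C 15 (B 10 (A 17 (B 18 (X 21)))))) (C 15 (B 7 (B 10 (C 14 (A 16 (C 17 (X 18))))))) (C 7 (B 10
  (C 14 (C 15 (X 17)))))) (B 10 (C 7 (B 14 (B 15 (BC 16 (C 17 (C 20 (X 21))) (B 24 (B 18 (C 17 (X
  25)))))))))))))"

text \<open>Position \<open>{5,8} / {4,6,9} / {3,12}\<close>. The triple 2, 4, 6 keeps 2 out of the
  second class.\<close>

definition cert55 :: cert where
  "cert55 =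
  AC 2 (Split 15 (BC 19 (C 13 (AB 20 (B 17 (B 14 (B 10 (C 1 (A 11 (B 7 (X 24))))))) (C 1 (C 14 (A
  18 (C 16 (X 24))))))) (C 10 (B 13 (C 1 (C 16 (X 24)))))) (Split 24 (BC 27 (C 18 (AB 1 (B 10 (C
  22 (B 16 (C 17 (X 20))))) (B 29 (B 25 (B 13 (X 21)))))) (C 21 (B 25 (C 22 (B 16 (C 18 (B 14 (X
  17)))))))) (C 14 (A 17 (B 1 (C 16 (B 7 (X 22)))))) (BC 18 (C 27 (C 20 (B 13 (AB 1 (B 21 (B 10 (C
  29 (C 22 (C 14 (C 26 (X 28))))))) (B 17 (C 7 (X 16))))))) (B 14 (A 17 (B 10 (X 13)))))) (BC 18
  (BC 17 (AC 14 (C 16 (A 30 (C 26 (B 22 (B 1 (C 10 (X 25))))))) (C 7 (AC 13 (B 19 (C 10 (X 25)))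
  (C 16 (C 10 (X 20)))))) (AC 14 (C 16 (C 7 (B 25 (B 21 (C 20 (C 22 (X 27))))))) (Split 26 (B 16
  (C 21 (B 22 (C 27 (C 1 (X 24)))))) (C 7 (C 16 (A 27 (B 21 (C 20 (X 22)))))) (B 21 (C 22 (A 27 (B
  16 (C 20 (C 7 (X 28)))))))))) (BC 27 (C 21 (A 24 (BC 14 (B 20 (C 7 (A 11 (X 22)))) (C 16 (C 7 (X
  20)))))) (C 20 (BC 13 (C 25 (B 16 (C 24 (C 17 (C 10 (B 22 (X 29))))))) (C 10 (C 22 (B 14 (X
  24))))))))) (Split 15 (BC 18 (AC 26 (Split 20 (C 7 (B 1 (C 13 (C 10 (X 11))))) (C 13 (C 7 (A 10
  (B 16 (X 25))))) (C 21 (B 27 (C 19 (AB 1 (C 17 (C 10 (X 28))) (C 13 (C 10 (X 16)))))))) (Split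
  13 (B 7 (A 19 (C 22 (B 10 (X 14))))) (AB 7 (Split 24 (B 1 (C 10 (B 19 (X 20)))) (C 10 (B 20 (C 1
  (X 22)))) (C 20 (A 27 (C 19 (B 14 (C 10 (X 22))))))) (B 1 (A 19 (C 14 (C 24 (B 10 (A 25 (C 17 (B
  16 (C 20 (X 21))))))))))) (BC 10 (C 1 (A 11 (B 14 (X 16)))) (C 14 (B 7 (B 16 (X 20))))))) (BC 27
  (C 21 (A 24 (C 19 (B 7 (C 25 (B 20 (B 11 (X 13)))))))) (B 26 (B 19 (C 20 (C 11 (C 16 (X
  24)))))))) (Split 18 (C 1 (C 10 (C 7 (C 19 (C 13 (B 16 (X 17))))))) (C 10 (C 1 (B 16 (X 24))))
  (C 20 (BC 1 (B 10 (C 7 (C 11 (X 19)))) (C 16 (C 10 (X 14)))))) (C 1 (Split 24 (C 17 (A 23 (B 10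
  (A 14 (C 19 (X 25)))))) (BC 21 (C 13 (A 23 (B 30 (C 11 (B 16 (C 14 (X 18))))))) (C 27 (B 29 (B
  13 (B 25 (B 14 (A 18 (C 7 (X 16))))))))) (B 14 (A 17 (AC 18 (B 10 (C 26 (C 19 (C 13 (X 28)))))
  (B 27 (C 19 (B 10 (A 13 (B 20 (A 21 (C 7 (X 22))))))))))))))"

text \<open>Position \<open>{6,9,22} / {4,8,18} / {3,12}\<close>.\<close>

definition cert56 :: cert where
  "cert56 =
  Split 24 (BC 16 (C 10 (A 26 (A 28 (AB 5 (B 29 (C 27 (C 2 (C 15 (C 1 (X 17)))))) (C 17 (C 2 (X
  15))))))) (C 5 (AB 14 (B 10 (A 28 (C 13 (B 2 (A 15 (C 19 (X 26))))))) (B 26 (C 20 (C 28 (B 2 (X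
  21)))))))) (BC 20 (C 14 (BC 7 (B 16 (C 5 (C 17 (B 26 (C 13 (B 1 (C 2 (X 11)))))))) (C 11 (C 2 (C
  1 (B 16 (C 5 (X 17)))))))) (C 16 (B 10 (B 14 (B 2 (C 19 (C 7 (X 21)))))))) (BC 27 (BC 2 (BC 14
  (BC 5 (C 13 (A 20 (C 1 (C 7 (B 10 (A 15 (C 11 (A 16 (B 17 (C 21 (X 28))))))))))) (Split 16 (B 17
  (C 26 (B 10 (B 21 (B 23 (B 28 (C 7 (X 13)))))))) (B 17 (C 23 (B 7 (B 10 (B 19 (B 25 (C 26 (C 30
  (C 20 (C 15 (X 28))))))))))) (B 20 (A 30 (X 32))))) (BC 16 (B 30 (C 20 (A 32 (B 5 (B 13 (B 1 (C
  15 (B 7 (X 17))))))))) (C 10 (BC 19 (C 1 (A 7 (B 17 (B 26 (C 29 (C 11 (X 20))))))) (C 17 (B 26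
  (C 5 (C 11 (X 20))))))))) (C 30 (AC 20 (C 16 (C 5 (A 10 (B 13 (C 14 (C 1 (C 11 (X 25)))))))) (B
  14 (BC 7 (B 16 (C 5 (X 25))) (C 25 (B 11 (X 17)))))))) (Split 13 (Split 11 (BC 7 (C 1 (A 25 (B
  28 (B 19 (C 14 (B 20 (C 2 (X 15)))))))) (Split 16 (C 15 (A 20 (B 1 (C 10 (X 17))))) (BC 14 (C 19
  (B 17 (X 28))) (C 2 (A 25 (B 20 (B 1 (X 28)))))) (B 19 (A 20 (B 1 (C 5 (C 2 (C 14 (X 25)))))))))
  (C 7 (A 19 (C 14 (B 5 (C 16 (C 20 (X 32))))))) (C 25 (B 7 (C 14 (C 10 (C 19 (AC 1 (B 21 (B 16 (B
  5 (X 15)))) (B 17 (X 26))))))))) (BC 5 (C 19 (A 20 (A 28 (C 23 (BC 1 (B 2 (X 7)) (C 11 (X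
  15))))))) (AB 7 (C 20 (C 10 (C 11 (C 15 (B 1 (C 2 (X 17))))))) (C 14 (C 28 (B 20 (B 11 (C 16 (B
  2 (X 19))))))))) (C 7 (C 14 (AC 1 (C 11 (C 2 (X 15))) (C 10 (B 2 (C 5 (X 11)))))))))"

text \<open>Position \<open>{3,12,18} / {4,8} / {6,9}\<close>. The triple 12, 18, 24 excludes 24
  from the front class.\<close>

definition cert57 :: cert where
  "cert57 =
  BC 24 (BC 16 (C 20 (AC 1 (C 14 (B 2 (B 5 (B 15 (C 21 (C 7 (X 25))))))) (B 15 (B 5 (X 25))))) (AB
  15 (BC 25 (C 7 (B 11 (BC 20 (B 13 (B 2 (C 17 (C 14 (B 21 (A 22 (B 10 (X 26)))))))) (B 10 (B 1 (B
  14 (C 32 (C 26 (B 19 (C 5 (C 17 (X 22)))))))))))) (C 2 (A 11 (A 13 (C 29 (C 21 (B 14 (B 17 (X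
  19))))))))) (BC 1 (C 13 (AB 17 (B 20 (C 5 (X 14))) (C 5 (C 7 (X 14))))) (C 13 (C 14 (B 2 (C 5 (C
  10 (C 7 (X 11)))))))))) (AC 15 (BC 30 (C 21 (A 27 (BC 11 (C 13 (C 14 (B 7 (B 5 (C 16 (B 1 (B 19
  (C 10 (X 20))))))))) (C 29 (C 25 (B 16 (C 2 (B 17 (B 10 (X 20)))))))))) (Split 5 (C 21 (B 27 (BC
  26 (C 28 (AC 10 (B 20 (C 16 (B 22 (B 14 (X 23))))) (C 22 (B 14 (C 23 (B 7 (X 17))))))) (C 19 (C
  10 (B 22 (A 28 (C 25 (C 7 (B 17 (B 14 (C 20 (X 23))))))))))))) (BC 20 (C 10 (B 7 (B 14 (B 16 (C
  2 (B 17 (C 21 (X 26)))))))) (C 16 (AB 21 (C 11 (C 19 (C 10 (A 14 (B 7 (X 23)))))) (B 10 (A 27 (C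
  29 (B 11 (C 23 (C 19 (X 26)))))))))) (Split 19 (B 21 (AC 10 (C 17 (X 23)) (B 16 (B 11 (B 17 (X
  23)))))) (B 21 (B 27 (C 13 (X 16)))) (C 13 (A 16 (C 21 (B 23 (C 14 (B 11 (X 27)))))))))) (Split
  10 (BC 1 (C 17 (B 19 (B 13 (B 5 (X 11))))) (C 13 (C 14 (B 7 (B 16 (C 19 (C 17 (B 5 (X
  23))))))))) (Split 1 (C 13 (A 17 (C 16 (C 11 (B 5 (X 20)))))) (C 16 (C 14 (C 5 (X 20)))) (B 13
  (C 14 (C 5 (C 11 (C 7 (X 16))))))) (C 17 (C 1 (C 14 (C 11 (C 7 (B 16 (X 20)))))))))"

text \<open>Position \<open>{4,8} / {3,12} / {6,9}\<close>. If 18 joins 4 and 8, then 22 is expelled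
  by \<open>3*8^2 + 18^2 = 2*4^2 + 22^2\<close>.\<close>

definition cert58 :: cert where
  "cert58 =
  Split 18 (BC 22 (Split 14 (BC 24 (AC 27 (C 7 (A 21 (B 28 (B 11 (C 10 (X 20)))))) (C 30 (B 32 (AB
  2 (C 21 (BC 10 (C 16 (B 13 (C 5 (B 15 (X 20))))) (C 16 (X 19)))) (B 16 (A 20 (C 7 (X 11))))))))
  (AC 15 (C 21 (A 27 (B 7 (A 11 (X 17))))) (B 17 (C 1 (C 2 (C 11 (B 7 (C 10 (X 25))))))))) (BC 24
  (C 28 (AB 10 (C 27 (B 7 (C 23 (C 5 (C 15 (X 26)))))) (B 2 (A 16 (C 15 (A 19 (X 20))))))) (AC 2
  (C 16 (Split 23 (C 26 (C 20 (B 21 (B 5 (X 15))))) (C 5 (C 10 (X 15))) (C 5 (C 25 (B 27 (B 10 (C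
  1 (X 15)))))))) (B 16 (B 10 (C 7 (A 25 (B 23 (C 17 (C 1 (X 15)))))))))) (BC 5 (C 13 (AC 16 (BC 7
  (C 15 (A 21 (X 24))) (B 11 (C 21 (C 17 (C 20 (C 24 (C 26 (X 27)))))))) (BC 2 (B 19 (C 15 (X
  20))) (B 25 (C 1 (C 15 (X 20))))))) (AC 13 (BC 15 (Split 24 (C 21 (C 27 (B 2 (C 7 (X 25))))) (BC
  2 (C 16 (B 20 (B 10 (X 19)))) (C 16 (X 25))) (B 26 (B 21 (C 28 (C 27 (C 10 (B 2 (X 16)))))))) (C
  10 (A 23 (BC 24 (B 26 (B 21 (C 27 (X 28)))) (C 16 (C 20 (B 17 (X 19)))))))) (Split 20 (BC 16 (C
  15 (B 11 (B 1 (A 17 (X 24))))) (C 17 (C 2 (C 15 (X 25))))) (BC 2 (C 15 (C 11 (B 1 (A 25 (B 16 (C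
  24 (X 28))))))) (C 24 (B 26 (A 27 (B 10 (B 15 (C 11 (X 17)))))))) (C 1 (Split 16 (B 11 (C 15 (B
  10 (B 17 (X 19))))) (B 11 (C 10 (C 15 (C 17 (C 2 (X 25)))))) (B 19 (C 2 (C 21 (B 23 (X
  27))))))))))) cert56) cert57 (BC 27 (AC 21 (C 24 (AC 11 (C 13 (X 19)) (B 19 (B 13 (A 17 (C 10 (A
  16 (C 5 (B 20 (B 15 (B 2 (X 32)))))))))))) (Split 5 (BC 13 (C 19 (B 11 (B 20 (B 14 (C 22 (B 7
  (BC 15 (C 23 (C 16 (C 24 (X 28)))) (C 25 (X 28))))))))) (C 14 (A 19 (B 16 (C 2 (C 1 (X 17)))))))
  (Split 16 (B 24 (AC 28 (C 19 (A 20 (X 22))) (B 26 (B 22 (B 32 (BC 7 (C 13 (B 23 (C 20 (X 29))))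
  (C 23 (C 20 (X 29))))))))) (C 19 (A 20 (BC 13 (B 28 (C 23 (C 14 (X 26)))) (B 23 (A 25 (C 15 (C 7
  (C 17 (C 28 (C 14 (B 22 (B 2 (X 24))))))))))))) (C 28 (C 7 (A 14 (BC 17 (C 15 (A 19 (B 23 (X
  26)))) (C 22 (C 24 (X 25)))))))) (B 29 (C 20 (B 24 (C 11 (B 19 (C 17 (C 23 (B 16 (C 2 (B 14 (C
  15 (B 10 (X 28))))))))))))))) (C 21 (A 24 (BC 19 (C 16 (A 20 (C 11 (B 17 (C 13 (C 5 (X 29)))))))
  (C 13 (B 20 (C 5 (C 14 (X 22)))))))))"

text \<open>Position \<open>{3,4,12} / {6,9} / {8}\<close>. The triple 3, 4, 5 excludes 5 from the
  front class.\<close>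

definition cert59 :: cert where
  "cert59 =
  BC 5 (AC 16 (BC 15 (C 13 (A 14 (A 19 (C 18 (B 2 (A 25 (C 21 (B 27 (X 29))))))))) (AB 1 (C 10 (B
  19 (B 14 (X 20)))) (B 11 (C 13 (X 14))))) (Split 18 (B 2 (B 1 (C 14 (C 15 (B 10 (C 20 (AC 7 (B
  22 (C 21 (X 24))) (C 24 (B 26 (X 28)))))))))) (C 24 (C 27 (A 29 (C 19 (B 11 (X 13)))))) (C 24
  (AC 15 (BC 21 (C 10 (A 27 (A 30 (B 20 (B 7 (C 19 (B 13 (X 22)))))))) (B 11 (AB 1 (B 2 (C 25 (B
  29 (B 20 (A 27 (B 7 (X 22))))))) (C 25 (B 29 (B 20 (A 27 (B 7 (X 22))))))))) (B 1 (B 2 (B 13 (C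
  17 (C 10 (X 19)))))))))) (AC 16 (BC 24 (BC 18 (C 2 (A 28 (Split 22 (B 27 (B 32 (C 14 (B 15 (C 7
  (X 13)))))) (B 11 (A 27 (C 17 (C 7 (X 23))))) (B 10 (A 14 (C 13 (B 7 (B 11 (B 1 (C 21 (C 20 (X
  27)))))))))))) (C 27 (C 21 (C 32 (C 13 (C 22 (C 26 (C 2 (B 20 (B 11 (X 28))))))))))) (BC 18 (B 2
  (C 14 (B 15 (B 17 (B 10 (C 19 (C 21 (B 22 (X 27))))))))) (Split 19 (BC 1 (C 17 (B 15 (B 7 (X
  21)))) (C 15 (B 21 (X 27)))) (C 13 (B 15 (B 1 (C 21 (B 27 (B 23 (X 26))))))) (C 15 (C 21 (C 27
  (C 11 (X 29)))))))) (AB 2 (BC 10 (C 15 (B 14 (X 18))) (C 19 (B 15 (B 14 (A 18 (C 11 (A 13 (B 20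
  (X 22))))))))) (Split 24 (Split 15 (B 1 (C 13 (B 14 (B 7 (X 17))))) (B 11 (BC 17 (C 14 (C 7 (A
  13 (B 28 (C 22 (B 18 (C 10 (C 26 (C 19 (X 31)))))))))) (B 7 (C 19 (X 23))))) (C 14 (C 13 (C 17
  (B 18 (B 10 (C 19 (C 20 (B 7 (X 11)))))))))) (Split 15 (B 1 (A 11 (AC 13 (C 21 (B 19 (X 27))) (B
  18 (X 22))))) (C 10 (C 19 (B 13 (B 14 (X 20))))) (C 18 (C 14 (B 13 (X 25))))) (BC 18 (C 27 (AB
  13 (B 1 (C 14 (X 15))) (B 19 (A 28 (C 10 (A 15 (B 14 (X 26)))))))) (C 27 (A 28 (AB 1 (C 7 (X
  25)) (B 11 (X 13)))))))))"

text \<open>Position \<open>{6,9} / {8} / {12}\<close>. The triple 3, 6, 9 excludes 3 from the front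
  class.\<close>

definition cert60 :: cert where
  "cert60 =
  BC 3 (Split 4 cert53 cert54 (BC 16 cert52 (Split 24 (BC 7 (BC 1 (C 17 (C 15 (B 13 (X 25)))) (B 2
  (X 10))) (Split 15 (C 10 (B 2 (B 18 (C 11 (AB 1 (B 5 (X 13)) (B 5 (X 13))))))) (C 1 (A 5 (C 10
  (X 11)))) (B 25 (BC 5 (B 10 (B 2 (C 11 (C 20 (B 13 (X 21)))))) (B 13 (C 18 (C 11 (B 1 (C 14 (X
  19)))))))))) (BC 18 (C 28 (AC 7 (C 21 (C 5 (C 13 (B 11 (C 1 (X 15)))))) (B 25 (B 21 (B 14 (A 27
  (C 29 (B 5 (B 1 (X 11)))))))))) (Split 15 (Split 2 (BC 1 (C 7 (A 17 (B 14 (A 20 (B 13 (C 10 (X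
  22))))))) (C 13 (B 19 (C 5 (B 11 (C 17 (X 20))))))) (C 17 (C 14 (B 10 (C 5 (X 11))))) (C 20 (AB
  1 (B 17 (C 11 (B 7 (C 5 (C 10 (C 13 (X 22))))))) (B 17 (C 5 (X 19)))))) (BC 13 (C 25 (AB 1 (B 28
  (C 14 (C 11 (B 10 (X 26))))) (C 21 (C 5 (X 14))))) (C 1 (C 5 (C 7 (X 10))))) (BC 5 (C 7 (X 11))
  (C 13 (B 11 (X 25)))))) (Split 13 (BC 19 (AC 11 (BC 15 (C 2 (A 5 (C 10 (X 17)))) (C 25 (B 2 (A
  18 (C 7 (X 21)))))) (AC 2 (C 5 (C 1 (A 7 (A 10 (B 14 (C 15 (X 17))))))) (C 14 (C 10 (C 5 (C 7 (C
  1 (X 15)))))))) (C 11 (C 15 (B 17 (C 2 (X 10)))))) (BC 1 (C 5 (A 15 (C 10 (B 2 (X 17))))) (AC 5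
  (Split 17 (C 21 (AC 2 (B 14 (B 15 (C 7 (X 20)))) (B 10 (X 19)))) (C 10 (A 11 (B 7 (C 20 (C 15 (X
  22)))))) (B 15 (B 14 (C 10 (B 7 (X 21)))))) (C 7 (C 11 (C 14 (X 15)))))) (BC 5 (C 11 (B 15 (C 20
  (C 7 (X 21))))) (C 15 (BC 1 (B 11 (C 14 (X 17))) (B 19 (C 7 (C 17 (X 20))))))))))) (Split 4
  cert59 (BC 5 (BC 13 (Split 17 (C 11 (AC 14 (C 15 (B 7 (A 10 (C 18 (B 20 (C 21 (X 27))))))) (B 7
  (A 15 (X 21))))) (C 14 (A 15 (C 11 (B 19 (C 1 (X 2)))))) (C 15 (B 7 (A 10 (A 14 (C 18 (B 20 (C
  21 (B 19 (X 27)))))))))) (Split 15 (B 2 (C 11 (AC 1 (B 7 (C 10 (C 16 (C 17 (C 18 (C 14 (X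
  25))))))) (C 10 (C 7 (A 16 (X 18))))))) (BC 18 (AC 7 (C 16 (A 20 (B 10 (X 14)))) (B 14 (C 2 (B 1
  (C 10 (B 11 (B 16 (X 20)))))))) (C 20 (C 21 (B 27 (C 11 (X 19)))))) (Split 21 (B 16 (C 24 (B 17
  (X 18)))) (C 1 (BC 7 (B 14 (X 17)) (C 16 (C 23 (B 14 (C 18 (X 24))))))) (C 14 (A 17 (Split 18 (B
  2 (C 16 (A 19 (X 28)))) (B 23 (C 27 (B 24 (C 1 (X 2))))) (B 19 (A 20 (X 27))))))))) cert55)
  cert58)"

text \<open>Position \<open>{6,12} / {8} / {9}\<close>. The triples 6, 12, 18 and 9, 18, 27 place 18
  and then 27.\<close>

definition cert61 :: cert where
  "cert61 =
  BC 18 cert51 (BC 27 cert50 (Split 14 (BC 23 (Split 16 (BC 24 (BC 21 (BC 1 (C 15 (A 17 (B 19 (B 7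
  (B 3 (X 4)))))) (C 7 (X 19))) (Split 7 (C 2 (C 26 (C 5 (X 10)))) (B 25 (A 28 (C 19 (B 15 (C 13
  (X 20)))))) (B 2 (AC 5 (C 13 (C 19 (B 1 (X 28)))) (B 15 (B 13 (B 20 (X 26)))))))) (Split 7 (C 25
  (C 29 (BC 2 (B 4 (C 10 (C 5 (X 26)))) (C 26 (B 5 (C 10 (C 1 (A 4 (B 3 (X 11)))))))))) (Split 11
  (BC 26 (C 2 (A 10 (A 22 (B 5 (B 13 (B 3 (X 20))))))) (C 5 (B 13 (B 1 (B 2 (B 15 (B 10 (X
  25)))))))) (C 13 (A 25 (B 5 (C 1 (X 29))))) (C 15 (A 20 (B 13 (X 28))))) (B 26 (C 22 (B 21 (BC
  10 (C 2 (C 19 (B 1 (X 28)))) (B 25 (X 28)))))))) cert46 (BC 4 (AC 20 (BC 15 (Split 21 (C 17 (A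
  19 (B 1 (C 29 (C 22 (B 7 (C 3 (C 5 (X 10))))))))) (C 2 (A 7 (C 19 (B 1 (B 3 (X 22)))))) (C 7 (C
  24 (C 17 (X 19))))) (C 11 (C 7 (B 5 (C 1 (X 19)))))) (Split 5 (B 2 (C 11 (A 15 (X 19)))) (C 11
  (C 7 (X 13))) (C 19 (C 3 (X 13))))) (Split 19 (C 2 (A 20 (C 3 (X 5)))) (C 29 (C 5 (B 20 (B 17 (X
  21))))) (Split 22 (B 20 (C 11 (B 7 (X 13)))) (C 13 (C 7 (C 20 (B 5 (B 2 (C 1 (C 3 (B 24 (X
  29))))))))) (C 28 (AB 1 (B 13 (C 5 (A 11 (B 15 (B 21 (C 7 (X 24))))))) (C 21 (C 20 (C 13 (B 3 (C
  2 (X 24)))))))))))) cert47) cert48 cert49))"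

section \<open>The upper levels of the tree\<close>

text \<open>Position \<open>{8,12} / {9} / {}\<close>. The triples 4, 8, 12 and 8, 12, 16 keep 4 and
  16 away from the front class.\<close>

definition cert62 :: cert where
  "cert62 =
  BC 4 (AC 16 (Split 5 (BC 11 (C 3 (A 7 (A 13 (B 20 (B 19 (C 14 (BC 1 (C 2 (X 6)) (C 2 (X
  6))))))))) (AC 15 (AC 10 (C 20 (AB 3 (B 13 (A 19 (AC 1 (B 6 (C 14 (C 2 (A 18 (C 7 (C 17 (X
  25))))))) (C 14 (C 6 (A 7 (C 24 (X 26)))))))) (B 7 (BC 1 (B 6 (X 13)) (B 14 (C 6 (A 17 (A 21 (C
  24 (X 26)))))))))) (B 6 (C 14 (B 2 (A 18 (C 1 (X 3))))))) (AB 10 (B 3 (A 6 (A 13 (A 20 (C 1 (X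
  17)))))) (AB 3 (B 7 (B 13 (C 1 (B 17 (C 20 (B 19 (AB 6 (B 14 (C 24 (X 26))) (B 14 (C 18 (A 22 (B
  25 (A 27 (C 28 (X 32)))))))))))))) (AB 20 (B 13 (A 19 (AC 17 (C 18 (B 23 (A 25 (A 29 (BC 24 (C
  30 (C 26 (B 21 (B 27 (X 28))))) (B 27 (X 28))))))) (B 1 (C 6 (B 25 (C 18 (B 14 (A 22 (C 27 (B 7
  (X 21)))))))))))) (AC 18 (B 13 (B 7 (C 1 (X 17)))) (B 23 (C 27 (B 19 (X 21)))))))))) cert12
  cert13) cert16) (AC 16 (Split 3 cert20 (BC 1 cert18 (AC 5 (Split 18 (BC 27 (C 29 (AC 24 (Split
  13 (C 11 (A 19 (C 14 (C 10 (B 6 (X 20)))))) (C 20 (BC 2 (C 6 (X 15)) (C 6 (X 17)))) (C 20 (AC 2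
  (C 10 (X 14)) (B 10 (X 14))))) (B 11 (A 21 (C 7 (A 17 (B 6 (X 25)))))))) (C 29 (Split 20 (BC 11
  (C 21 (B 15 (B 13 (C 14 (C 2 (X 6)))))) (C 24 (B 21 (B 15 (C 6 (X 17)))))) (C 11 (C 24 (C 28 (BC
  19 (C 23 (C 14 (B 13 (B 10 (B 17 (C 6 (C 2 (C 7 (C 21 (B 25 (C 26 (B 30 (X 31))))))))))))) (B 14
  (C 6 (X 23))))))) (BC 2 (C 6 (A 10 (A 15 (B 13 (C 21 (B 24 (X 28))))))) (C 6 (B 10 (A 17 (B 22
  (B 15 (B 13 (C 7 (X 24)))))))))))) (BC 24 (BC 25 (C 21 (A 23 (AC 10 (B 17 (C 19 (C 11 (X 13))))
  (B 2 (B 6 (B 11 (X 13))))))) (AB 10 (C 21 (Split 14 (B 23 (C 6 (B 22 (B 27 (B 15 (B 7 (X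
  28))))))) (C 6 (A 27 (B 15 (B 11 (C 19 (B 20 (X 28))))))) (C 6 (C 2 (X 23))))) (B 15 (C 20 (B 2
  (C 6 (C 7 (C 11 (X 14))))))))) (Split 2 (C 6 (A 10 (B 11 (C 7 (X 14))))) (C 20 (C 15 (AB 6 (B 10
  (X 30)) (B 14 (B 10 (X 11)))))) (B 6 (X 10)))) (BC 10 (Split 6 (B 11 (C 14 (B 7 (B 2 (A 13 (B 15
  (C 20 (X 24)))))))) (C 2 (B 15 (C 11 (C 13 (X 20))))) (C 2 (AC 11 (C 17 (C 20 (C 13 (C 14 (C 21
  (X 28)))))) (C 20 (C 13 (B 7 (C 14 (A 17 (C 19 (C 24 (X 28))))))))))) (C 14 (C 6 (B 2 (B 11 (B
  15 (B 19 (C 20 (B 13 (C 21 (X 26)))))))))))) cert17)) cert19) cert23)"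

text \<open>Position \<open>{12} / {9} / {}\<close>: 9 and 12 are separated. The three places for 8
  are the three preceding groups of positions; if it joins 9, then 7 is expelled by
  \<open>2*7^2 + 8^2 = 2*9^2\<close>.\<close>

definition cert63 :: cert where
  "cert63 =
  Split 8 cert62 (BC 7 (BC 1 cert26 (AB 14 (AC 11 cert24 (BC 15 (BC 4 (Split 13 (C 19 (C 17 (B 3
  (B 10 (B 5 (B 6 (X 16))))))) (C 2 (A 5 (A 18 (B 6 (C 10 (AB 16 (B 17 (X 24)) (B 17 (C 19 (C 22
  (X 24)))))))))) (C 5 (AB 2 (B 3 (A 6 (C 16 (X 20)))) (C 10 (A 20 (B 19 (C 6 (X 24)))))))) (Split
  3 (C 19 (C 17 (AB 2 (C 13 (C 16 (X 24))) (B 5 (X 16))))) (C 17 (B 16 (C 19 (AC 2 (C 18 (C 6 (X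
  25))) (B 5 (C 6 (X 10))))))) (C 6 (A 16 (C 5 (B 13 (X 17))))))) (Split 3 (BC 16 (C 2 (A 17 (C 24
  (Split 19 (B 13 (AC 4 (C 18 (X 27)) (B 5 (X 18)))) (C 18 (B 22 (X 27))) (C 5 (A 25 (B 18 (C 6 (C
  4 (X 27)))))))))) (C 18 (B 25 (AB 17 (C 27 (C 24 (C 5 (C 6 (B 10 (X 30)))))) (B 2 (C 6 (B 4 (B
  21 (X 27))))))))) (Split 24 (BC 16 (C 4 (A 6 (B 5 (C 2 (C 10 (X 13)))))) (C 18 (B 6 (C 2 (C 5 (X
  10)))))) (C 5 (A 16 (B 6 (C 18 (C 2 (C 21 (B 22 (X 27)))))))) (C 17 (B 4 (C 18 (C 2 (C 5 (X
  6))))))) (BC 4 (C 17 (C 16 (A 19 (B 13 (B 6 (C 5 (X 10))))))) (C 2 (C 6 (A 18 (C 20 (X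
  24))))))))) cert25)) cert34) (Split 6 (BC 4 cert38 (AC 2 (AC 10 (BC 13 (C 17 (B 19 (AB 11 (B 1
  (A 3 (C 7 (X 15)))) (C 7 (C 14 (X 15)))))) (C 5 (A 11 (B 1 (X 3))))) (AC 11 (BC 7 (C 5 (A 14 (AC
  1 (C 3 (C 13 (C 19 (BC 24 (B 17 (C 21 (X 23))) (C 26 (X 27)))))) (Split 24 (BC 26 (C 18 (C 16 (X
  27))) (C 17 (B 13 (B 22 (C 3 (B 19 (B 21 (X 23)))))))) (C 13 (A 22 (C 18 (B 16 (X 28))))) (AC 13
  (C 22 (C 16 (B 17 (B 3 (B 19 (C 20 (C 21 (X 23)))))))) (C 17 (B 3 (X 16)))))))) (C 13 (B 14 (C 1
  (A 3 (B 19 (AC 17 (C 20 (B 22 (B 18 (C 21 (X 27))))) (C 24 (C 26 (C 18 (X 27))))))))))) (AB 3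
  (BC 13 (C 5 (A 15 (B 1 (C 7 (X 16))))) (C 1 (A 14 (B 5 (C 7 (C 16 (X 18))))))) (AC 1 (BC 17 (C
  13 (C 14 (B 18 (C 5 (A 19 (C 21 (X 27))))))) (Split 26 (C 7 (X 13)) (C 24 (C 13 (A 18 (C 16 (C 5
  (X 19)))))) (B 18 (B 19 (AB 7 (B 13 (C 14 (C 5 (B 15 (X 22))))) (C 16 (C 20 (B 21 (X 27)))))))))
  (BC 13 (C 15 (C 5 (BC 7 (B 19 (C 17 (X 18))) (B 14 (B 17 (C 18 (B 16 (A 24 (C 26 (C 20 (X
  21))))))))))) (C 7 (A 15 (C 17 (C 14 (X 16)))))))))) cert37)) cert61 cert60)"

text \<open>Position \<open>{9} / {} / {}\<close>. Two empty classes allow \<open>Sym\<close> for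
  12, and again for 3 when 12 has joined 9. The leaf under \<open>Sym 3\<close> is the class with 3,
  9 and 12, closed by \<open>2*3^2 + 12^2 = 2*9^2\<close>.\<close>

definition cert_root :: cert where
  "cert_root =
  Sym 12 (Sym 3 Hit (AC 6 cert10 (AB 15 (Split 4 (BC 13 (AC 8 (Split 1 (C 2 (C 7 (B 5 (X 14)))) (C
  11 (C 14 (B 16 (B 2 (C 7 (C 10 (C 5 (X 20)))))))) (BC 16 (B 2 (C 5 (C 7 (C 20 (C 11 (B 14 (B 18
  (X 24)))))))) (C 7 (Split 10 (C 2 (C 5 (B 20 (B 11 (X 18))))) (C 5 (X 20)) (C 5 (B 20 (B 11 (C
  14 (C 2 (B 17 (B 21 (X 22)))))))))))) (AB 2 (Split 20 (BC 7 (AC 18 (C 16 (AB 10 (B 14 (B 19 (C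
  21 (C 22 (C 17 (X 25)))))) (B 19 (B 14 (C 21 (C 17 (X 25))))))) (B 19 (B 14 (B 16 (C 1 (X
  11)))))) (C 5 (A 14 (A 16 (B 18 (X 23)))))) (C 7 (B 5 (A 14 (A 16 (BC 18 (C 19 (B 17 (B 1 (C 10
  (X 24))))) (C 17 (B 1 (B 23 (C 24 (B 10 (C 21 (X 25)))))))))))) (C 5 (A 10 (AB 7 (B 16 (B 14 (C
  17 (X 21)))) (B 14 (A 16 (C 18 (C 17 (B 11 (A 21 (X 23))))))))))) (C 16 (C 1 (C 7 (C 14 (C 20
  (AC 10 (C 11 (A 18 (X 19))) (B 11 (B 18 (X 19))))))))))) (BC 14 (C 7 (A 11 (AC 1 (C 2 (A 8 (C 10
  (X 16)))) (C 16 (B 10 (C 18 (A 19 (B 2 (B 8 (C 5 (X 22))))))))))) (AC 5 (AB 8 (C 7 (A 11 (C 1 (C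
  16 (B 22 (B 2 (C 21 (C 20 (B 18 (X 23)))))))))) (Split 18 (B 2 (C 20 (C 1 (C 10 (C 7 (X 23))))))
  (C 16 (B 7 (C 21 (B 1 (C 17 (X 20)))))) (B 23 (C 20 (C 7 (B 16 (X 22))))))) (B 7 (C 21 (AB 1 (B
  8 (C 22 (B 16 (B 11 (B 17 (C 2 (C 18 (C 19 (C 20 (X 27)))))))))) (B 8 (X 20)))))))) cert5 cert6)
  cert9))) cert63"

section \<open>Evaluation of the certificate\<close>

lemmas cert_defs =
    cert1_def cert2_def cert3_def cert4_def cert5_def cert6_def cert7_def cert8_def
    cert9_def cert10_def cert11_def cert12_def cert13_def cert14_def cert15_def cert16_def
    cert17_def cert18_def cert19_def cert20_def cert21_def cert22_def cert23_def
    cert24_def cert25_def cert26_def cert27_def cert28_def cert29_def cert30_def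
    cert31_def cert32_def cert33_def cert34_def cert35_def cert36_def cert37_def
    cert38_def cert39_def cert40_def cert41_def cert42_def cert43_def cert44_def
    cert45_def cert46_def cert47_def cert48_def cert49_def cert50_def cert51_def
    cert52_def cert53_def cert54_def cert55_def cert56_def cert57_def cert58_def
    cert59_def cert60_def cert61_def cert62_def cert63_def cert_root_def

definition unmarked :: "bool list" where
  "unmarked = [False, False, False, False, False, False, False, False, False, False, False, False,
    False, False, False, False, False, False, False, False, False, False, False, False,
    False, False, False, False, False, False, False, False, False]"

text \<open>All bit lists become explicit, so each leaf is a \<open>hit\<close> of 33 truth values
  and is rewritten to \<open>True\<close> by any pattern that matches; the condition of
  \<open>Sym\<close> holds by reflexivity. A leaf without a matching solution would remain in the
  goal.\<close>

lemma check_cert_root: "check cert_root (unmarked[9 := True]) unmarked unmarked"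
  by (simp only: unmarked_def update_simps cert_defs check.simps hit_simps simp_thms)

lemma marks_unmarked: "marks unmarked P"
  by (auto simp: marks_def unmarked_def nth_Cons split: nat.splits)

text \<open>The certificate presupposes 9 in the front class. Some class contains 9, and both the
  cover and the freeness conditions are symmetric, so that class may be named
  \<open>P\<close>.\<close>

lemma no_solution_free_cover:
  assumes "\<forall>n. n \<in> P \<or> n \<in> Q \<or> n \<in> R" "solution_free P" "solution_free Q" "solution_free R"
  shows False
proof -
  have *: False if "9 \<in> P" "\<forall>n. n \<in> P \<or> n \<in> Q \<or> n \<in> R"
      "solution_free P" "solution_free Q" "solution_free R" for P Q R
    using check_sound[OF check_cert_root marks_update[OF marks_unmarked that(1)]
        marks_unmarked marks_unmarked that(2-)] .
  consider "9 \<in> P" | "9 \<in> Q" | "9 \<in> R" using assms(1) by blast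
  then show False
    using *[of P Q R] *[of Q P R] *[of R P Q] assms by cases blast+
qed

section \<open>Upper bound\<close>

text \<open>Bridge between lists, on which the certificates work, and assignments on the type
  \<open>var\<close> of the seven variables.\<close>

lemma mono_solution_of_list:
  assumes "solution xs" "\<forall>x\<in>set xs. \<chi> x = c"
  shows "\<exists>s. mono_solution (\<lambda>s :: var \<Rightarrow> nat.
      (s X1)^2 + (s X2)^2 + (s X3)^2 + (s X4)^2 = (s Y1)^2 + (s Y2)^2 + (s Y3)^2) 32 \<chi> s"
proof -
  from assms(1) obtain x1 x2 x3 x4 y1 y2 y3 where
    xs: "xs = [x1, x2, x3, x4, y1, y2, y3]" "x1^2 + x2^2 + x3^2 + x4^2 = y1^2 + y2^2 + y3^2"
      "set xs \<subseteq> {1..32}"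
    unfolding solution_def by (elim exE conjE)
  define s where "s = case_var x1 x2 x3 x4 y1 y2 y3"
  have s: "s X1 = x1" "s X2 = x2" "s X3 = x3" "s X4 = x4" "s Y1 = y1" "s Y2 = y2" "s Y3 = y3"
    by (simp_all add: s_def)
  have s_in: "s v \<in> set xs" for v
    by (cases v) (simp_all add: s xs(1))
  have "(s X1)^2 + (s X2)^2 + (s X3)^2 + (s X4)^2 = (s Y1)^2 + (s Y2)^2 + (s Y3)^2"
    by (simp only: s xs(2))
  moreover have "s v \<in> {1..32}" for v
    using xs(3) s_in[of v] by (rule subsetD)
  moreover have "\<chi> (s v) = c" for v
    using assms(2) s_in[of v] by (rule bspec)
  ultimately show ?thesis
    unfolding mono_solution_def by (intro exI[of _ s] exI[of _ c] conjI allI)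
qed

text \<open>The colour classes cover all numbers, so by the certificate one of them contains a
  listed solution. Its entries lie in \<open>{1..32}\<close>, where the colours are known.\<close>

lemma rado_property_32:
  "rado_property 3 (\<lambda>s :: var \<Rightarrow> nat.
      (s X1)^2 + (s X2)^2 + (s X3)^2 + (s X4)^2 = (s Y1)^2 + (s Y2)^2 + (s Y3)^2) 32"
  unfolding rado_property_def
proof (intro allI impI)
  fix \<chi> :: "nat \<Rightarrow> nat"
  assume \<chi>: "\<chi> ` {1..32} \<subseteq> {1..3}"
  \<comment> \<open>The third class is the complement of the first two instead of the numbers of
    colour 3: nothing is known about \<open>\<chi>\<close> outside \<open>{1..32}\<close>, while the
    cover must include every natural number.\<close>
  let ?P = "{n. \<chi> n = 1}" and ?Q = "{n. \<chi> n = 2}" and ?R = "{n. \<chi> n \<noteq> 1 \<and> \<chi> n \<noteq> 2}"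
  show "\<exists>s. mono_solution (\<lambda>s :: var \<Rightarrow> nat.
      (s X1)^2 + (s X2)^2 + (s X3)^2 + (s X4)^2 = (s Y1)^2 + (s Y2)^2 + (s Y3)^2) 32 \<chi> s"
    (is ?goal)
  proof -
    have *: ?goal if "\<not> solution_free S" "\<And>n. n \<in> S \<Longrightarrow> n \<in> {1..32} \<Longrightarrow> \<chi> n = c" for S c
    proof -
      from that(1) obtain xs where xs: "solution xs" "set xs \<subseteq> S"
        unfolding solution_free_def by metis
      have "\<forall>x\<in>set xs. \<chi> x = c"
      proof
        fix x assume "x \<in> set xs"
        moreover have "set xs \<subseteq> {1..32}" using xs(1) by (simp add: solution_def)
        ultimately show "\<chi> x = c" using xs(2) by (intro that(2)) (erule subsetD, assumption)+
      qed
      with xs(1) show ?goal by (rule mono_solution_of_list)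
    qed
    have three: "\<chi> n = 3" if "n \<in> ?R" "n \<in> {1..32}" for n
    proof -
      have "\<chi> n \<in> {1..3}" using \<chi> that(2) by (rule subsetD[OF _ imageI])
      then show ?thesis using that(1) by auto
    qed
    have cover: "\<forall>n. n \<in> ?P \<or> n \<in> ?Q \<or> n \<in> ?R" by auto
    consider "\<not> solution_free ?P" | "\<not> solution_free ?Q" | "\<not> solution_free ?R"
      using no_solution_free_cover[OF cover] by blast
    then show ?goal
    proof cases
      case 1
      then show ?goal by (rule *[where c = 1]) simp
    next
      case 2
      then show ?goal by (rule *[where c = 2]) simp
    next
      case 3
      then show ?goal using three by (rule *)
    qed
  qed
qed

section \<open>Lower bound\<close>

text \<open>Equal heads are contracted, since sums of squares coincide often and the lists would
  otherwise grow with the number of representations.\<close>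

fun merge :: "nat list \<Rightarrow> nat list \<Rightarrow> nat list" where
  "merge [] ys = ys"
| "merge (x # xs) [] = x # xs"
| "merge (x # xs) (y # ys) =
     (if x < y then x # merge xs (y # ys)
      else if y < x then y # merge (x # xs) ys else x # merge xs ys)"

text \<open>For evaluation in place of the defining equation: there \<open>simp only\<close> would rewrite both branches
  of the conditional, which takes exponential time.\<close>

lemma merge_Cons:
  "x < y \<Longrightarrow> merge (x # xs) (y # ys) = x # merge xs (y # ys)"
  "y < x \<Longrightarrow> merge (x # xs) (y # ys) = y # merge (x # xs) ys"
  "merge (x # xs) (x # ys) = x # merge xs ys"
  by simp_all

lemma set_merge: "set (merge xs ys) = set xs \<union> set ys"
  by (induction xs ys rule: merge.induct) auto

lemma sorted_merge: "sorted xs \<Longrightarrow> sorted ys \<Longrightarrow> sorted (merge xs ys)"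
  by (induction xs ys rule: merge.induct) (auto simp: set_merge)

fun disjoint_sorted :: "nat list \<Rightarrow> nat list \<Rightarrow> bool" where
  "disjoint_sorted [] ys = True"
| "disjoint_sorted (x # xs) [] = True"
| "disjoint_sorted (x # xs) (y # ys) =
     (if x < y then disjoint_sorted xs (y # ys)
      else if y < x then disjoint_sorted (x # xs) ys else False)"

text \<open>Evaluation rules in the manner of \<open>merge_Cons\<close>. Equal heads have no rule
  here: a common element would stop the evaluation and leave the goal unproved.\<close>

lemma disjoint_sorted_Cons:
  "x < y \<Longrightarrow> disjoint_sorted (x # xs) (y # ys) = disjoint_sorted xs (y # ys)"
  "y < x \<Longrightarrow> disjoint_sorted (x # xs) (y # ys) = disjoint_sorted (x # xs) ys"
  by simp_all

text \<open>If one head is smaller than the other, sortedness makes it smaller than the whole other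
  list, so dropping it loses no common element.\<close>

lemma disjoint_sorted:
  "disjoint_sorted xs ys \<Longrightarrow> sorted xs \<Longrightarrow> sorted ys \<Longrightarrow> set xs \<inter> set ys = {}"
  by (induction xs ys rule: disjoint_sorted.induct) (auto split: if_splits)

text \<open>The Minkowski sum of two finite sets. Each translate of a sorted list is sorted, so
  merging the translates yields a sorted list without a separate sorting step.\<close>

primrec sumset :: "nat list \<Rightarrow> nat list \<Rightarrow> nat list" where
  "sumset [] ys = []"
| "sumset (x # xs) ys = merge (map ((+) x) ys) (sumset xs ys)"

lemma set_sumset: "set (sumset xs ys) = {x + y |x y. x \<in> set xs \<and> y \<in> set ys}"
  by (induction xs) (auto simp: set_merge)

lemma sorted_sumset: "sorted ys \<Longrightarrow> sorted (sumset xs ys)"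
  by (induction xs) (auto simp: sorted_merge sorted_map)

lemma sumsetI: "x \<in> set xs \<Longrightarrow> y \<in> set ys \<Longrightarrow> x + y \<in> set (sumset xs ys)"
  by (auto simp: set_sumset)

text \<open>The sums of three squares are computed once and enter both sides: \<open>Q3\<close>
  itself, and \<open>sumset Q Q3\<close> for the sums of four.\<close>

definition avoids :: "nat list \<Rightarrow> bool" where
  "avoids S \<longleftrightarrow> sorted S \<and> (let Q = map (\<lambda>x. x^2) S; Q3 = sumset Q (sumset Q Q)
     in disjoint_sorted (sumset Q Q3) Q3)"

text \<open>A solution would put one number into both sumsets, which the sorted comparison shows to
  be disjoint.\<close>

lemma avoids_no_solution:
  assumes "avoids S" and S: "set [x1, x2, x3, x4, y1, y2, y3] \<subseteq> set S"
  shows "x1^2 + x2^2 + x3^2 + x4^2 \<noteq> y1^2 + y2^2 + y3^2"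
proof
  assume eq: "x1^2 + x2^2 + x3^2 + x4^2 = y1^2 + y2^2 + y3^2"
  define Q where "Q = map (\<lambda>x. x^2) S"
  define Q3 where "Q3 = sumset Q (sumset Q Q)"
  have Q: "x^2 \<in> set Q" if "x \<in> set S" for x
    using that by (simp add: Q_def)
  have "sorted Q"
    \<comment> \<open>Squaring is monotone on natural numbers, so a sorted class has sorted
      squares.\<close>
    using assms(1) unfolding avoids_def Q_def
    by (auto simp: sorted_wrt_map intro: sorted_wrt_mono_rel[rotated] power_mono)
  have "x1^2 + (x2^2 + (x3^2 + x4^2)) \<in> set (sumset Q Q3)"
    unfolding Q3_def using S by (intro sumsetI Q) auto
  moreover have "y1^2 + (y2^2 + y3^2) \<in> set Q3"
    unfolding Q3_def using S by (intro sumsetI Q) auto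
  moreover have "set (sumset Q Q3) \<inter> set Q3 = {}"
  proof (rule disjoint_sorted)
    show "disjoint_sorted (sumset Q Q3) Q3"
      using assms(1) unfolding avoids_def Q3_def Q_def Let_def by blast
  qed (simp_all add: Q3_def sorted_sumset \<open>sorted Q\<close>)
  ultimately show False using eq by (metis add.assoc disjoint_iff)
qed

section \<open>A colouring of \<open>{1..31}\<close> without monochromatic solution\<close>

text \<open>The colouring cannot be continued: 32 would complete
  \<open>7^2 + 2*12^2 + 32^2 = 3^2 + 2*26^2\<close> in this class,
  \<open>2*18^2 + 2*30^2 = 20^2 + 2*32^2\<close> in the second and
  \<open>1^2 + 10^2 + 14^2 + 27^2 = 2*1^2 + 32^2\<close> in the third.\<close>

definition "class1 = [2, 3, 7, 12, 16, 21, 24, 26, 31 :: nat]"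
definition "class2 = [4, 5, 8, 11, 13, 18, 19, 20, 28, 29, 30 :: nat]"
definition "class3 = [1, 6, 9, 10, 14, 15, 17, 22, 23, 25, 27 :: nat]"

lemmas classes_def = class1_def class2_def class3_def

lemmas sum_simps = sumset.simps list.map merge.simps(1,2) merge_Cons
  disjoint_sorted.simps(1,2) disjoint_sorted_Cons Let_def arith_simps power2_eq_square
  one_plus_numeral numeral_plus_one mult_1 one_add_one numeral_less_iff less_num_simps le_num_simps

lemma avoids_class1: "avoids class1"
  \<comment> \<open>The given rules carry out the arithmetic, the merging and the comparison; they
    do not evaluate \<open>sorted\<close>, which is left to the final \<open>simp\<close>.\<close>
  by (simp only: classes_def avoids_def sum_simps) simp

lemma avoids_class2: "avoids class2"
  by (simp only: classes_def avoids_def sum_simps) simp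

lemma avoids_class3: "avoids class3"
  by (simp only: classes_def avoids_def sum_simps) simp

text \<open>Counting replaces a check of each number: the lists have 9 + 11 + 11 = 31 distinct
  entries in a set of size 31.\<close>

lemma classes_cover: "set (class1 @ class2 @ class3) = {1..31}"
proof (rule card_subset_eq)
  show "set (class1 @ class2 @ class3) \<subseteq> {1..31}"
    by (simp add: classes_def)
  have "distinct (class1 @ class2 @ class3)"
    by (simp add: classes_def)
  then have "card (set (class1 @ class2 @ class3)) = length (class1 @ class2 @ class3)"
    by (rule distinct_card)
  then show "card (set (class1 @ class2 @ class3)) = card {1..31::nat}"
    by (simp add: classes_def)
qed simp

text \<open>One colouring of the natural numbers refutes the property for every \<open>N\<close>
  below 32, since all values of a solution then lie in \<open>{1..31}\<close>.\<close>

lemma not_rado_property: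
  assumes "N < 32"
  shows "\<not> rado_property 3 (\<lambda>s :: var \<Rightarrow> nat.
      (s X1)^2 + (s X2)^2 + (s X3)^2 + (s X4)^2 = (s Y1)^2 + (s Y2)^2 + (s Y3)^2) N"
proof
  \<comment> \<open>Colour 3 is also the default outside the three lists.\<close>
  define \<chi> :: "nat \<Rightarrow> nat" where
    "\<chi> n = (if n \<in> set class1 then 1 else if n \<in> set class2 then 2 else 3)" for n
  assume "rado_property 3 (\<lambda>s :: var \<Rightarrow> nat.
      (s X1)^2 + (s X2)^2 + (s X3)^2 + (s X4)^2 = (s Y1)^2 + (s Y2)^2 + (s Y3)^2) N"
  moreover have "\<chi> ` {1..N} \<subseteq> {1..3}" by (auto simp: \<chi>_def)
  ultimately obtain s :: "var \<Rightarrow> nat" and c where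
    eq: "(s X1)^2 + (s X2)^2 + (s X3)^2 + (s X4)^2 = (s Y1)^2 + (s Y2)^2 + (s Y3)^2"
    and range: "\<And>v. s v \<in> {1..N}" and mono: "\<And>v. \<chi> (s v) = c"
    unfolding rado_property_def mono_solution_def by blast
  have cover: "s v \<in> set class1 \<union> set class2 \<union> set class3" for v
  proof -
    have "s v \<in> {1..31}" using range[of v] assms by auto
    then have "s v \<in> set (class1 @ class2 @ class3)" by (simp only: classes_cover)
    then show ?thesis by simp
  qed
  have "(\<forall>v. s v \<in> set class1) \<or> (\<forall>v. s v \<in> set class2) \<or> (\<forall>v. s v \<in> set class3)"
  proof -
    consider "c = 1" | "c = 2" | "c \<noteq> 1" "c \<noteq> 2" by metis
    then show ?thesis
    proof cases
      case 1
      have "s v \<in> set class1" for v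
        using mono[of v] unfolding 1 \<chi>_def by (simp split: if_splits)
      then show ?thesis by simp
    next
      case 2
      have "s v \<in> set class2" for v
        using mono[of v] unfolding 2 \<chi>_def by (simp split: if_splits)
      then show ?thesis by simp
    next
      case 3
      \<comment> \<open>Colour 3 alone does not imply membership in \<open>class3\<close>;
        \<open>cover\<close> rules out the default.\<close>
      have "s v \<in> set class3" for v
        using mono[of v] cover[of v] 3 unfolding \<chi>_def by (auto split: if_splits)
      then show ?thesis by simp
    qed
  qed
  \<comment> \<open>The three cases for the common colour collapse to a single list \<open>S\<close>
    that avoids solutions.\<close>
  then obtain S where "avoids S" "\<And>v. s v \<in> set S"
    using avoids_class1 avoids_class2 avoids_class3 by metis
  then show False
    using avoids_no_solution[of S "s X1" "s X2" "s X3" "s X4" "s Y1" "s Y2" "s Y3"] eq by simp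
qed

text \<open>The value 32 is attained by \<open>rado_property_32\<close>, and
  \<open>not_rado_property\<close> excludes everything smaller, so the infimum is a minimum.\<close>

theorem theorem2:
  shows "rado_number 3 (\<lambda>s :: var \<Rightarrow> nat.
      (s X1)^2 + (s X2)^2 + (s X3)^2 + (s X4)^2 = (s Y1)^2 + (s Y2)^2 + (s Y3)^2) = 32"
proof -
  let ?E = "\<lambda>s :: var \<Rightarrow> nat.
      (s X1)^2 + (s X2)^2 + (s X3)^2 + (s X4)^2 = (s Y1)^2 + (s Y2)^2 + (s Y3)^2"
  have "Inf (enat ` {N. 0 < N \<and> rado_property 3 ?E N}) = enat 32"
  proof (rule cInf_eq_minimum)
    show "enat 32 \<in> enat ` {N. 0 < N \<and> rado_property 3 ?E N}"
      using rado_property_32 by simp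
  next
    fix x assume "x \<in> enat ` {N. 0 < N \<and> rado_property 3 ?E N}"
    then obtain N where "x = enat N" "rado_property 3 ?E N" by blast
    then show "enat 32 \<le> x" using not_rado_property not_le_imp_less by auto
  qed
  \<comment> \<open>The numeral 32 of type \<open>enat\<close> is identified with the image of the
    natural number 32.\<close>
  then show ?thesis by (simp add: rado_number_def numeral_eq_enat)
qed

end
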